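(* Let $\mathcal L_{\mathrm{SU}(2)}$ be the Laplacian on $\mathrm{SU}(2)$. For $0<r\leq 1$, $\alpha>\frac{3}{r}$ and $1\leq p<\infty$, the operator $(I-\mathcal L_{\mathrm{SU}(2)})^{-\frac{\alpha}{2}}$ is $r$-nuclear on $L^p(\mathrm{SU}(2))$.
   Context: $\mathrm{SU}(2)$ carries its normalised Haar measure. Its unitary dual is $\{[t^\ell]:\ell\in\frac12\mathbb N_0\}$ with $t^\ell:\mathrm{SU}(2)\to\mathbb C^{(2\ell+1)\times(2\ell+1)}$ irreducible unitary of dimension $2\ell+1$ ($\mathbb N_0=\{0,1,2,\dots\}$). The Laplacian is normalised so that $\mathcal L_{\mathrm{SU}(2)}t^\ell_{mn}=-\ell(\ell+1)t^\ell_{mn}$ for all matrix entries; $(I-\mathcal L_{\mathrm{SU}(2)})^{-\alpha/2}$ is the operator acting on $t^\ell_{mn}$ by multiplication by $(1+\ell(\ell+1))^{-\alpha/2}$. For $0<r\le1$ and a Banach space $E$, a linear operator $T:E\to E$ is $r$-nuclear if there are sequences $(x_n')$ in $E'$ and $(y_n)$ in $E$ with $Tx=\sum_{n=1}^\infty\langle x,x_n'\rangle y_n$ for all $x\in E$ and $\sum_{n=1}^\infty\|x_n'\|_{E'}^r\|y_n\|_E^r<\infty$. *)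

theory Defs
  imports "HOL-Analysis.Analysis" "HOL-Computational_Algebra.Polynomial"
begin

text \<open>
  Function spaces are given by a carrier \<open>E\<close> of complex-valued functions and a seminorm \<open>N\<close>
  on it; the normed space meant is the quotient of \<open>E\<close> by the functions of seminorm \<open>0\<close>.
  Operators act on representatives, so identities between vectors are only required up to
  seminorm \<open>0\<close>.
\<close>

definition linear_operator_on ::
    "('a \<Rightarrow> complex) set \<Rightarrow> (('a \<Rightarrow> complex) \<Rightarrow> real) \<Rightarrow> (('a \<Rightarrow> complex) \<Rightarrow> 'a \<Rightarrow> complex) \<Rightarrow> bool"
  where "linear_operator_on E N T \<longleftrightarrow>
    (\<forall>f\<in>E. T f \<in> E) \<and>
    (\<forall>f\<in>E. N f = 0 \<longrightarrow> N (T f) = 0) \<and>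
    (\<forall>f\<in>E. \<forall>g\<in>E. N (\<lambda>x. T (\<lambda>y. f y + g y) x - (T f x + T g x)) = 0) \<and>
    (\<forall>f\<in>E. \<forall>c. N (\<lambda>x. T (\<lambda>y. c * f y) x - c * T f x) = 0)"

definition bounded_operator_on ::
    "('a \<Rightarrow> complex) set \<Rightarrow> (('a \<Rightarrow> complex) \<Rightarrow> real) \<Rightarrow> (('a \<Rightarrow> complex) \<Rightarrow> 'a \<Rightarrow> complex) \<Rightarrow> bool"
  where "bounded_operator_on E N T \<longleftrightarrow>
    linear_operator_on E N T \<and> (\<exists>C. \<forall>f\<in>E. N (T f) \<le> C * N f)"

definition dual_space ::
    "('a \<Rightarrow> complex) set \<Rightarrow> (('a \<Rightarrow> complex) \<Rightarrow> real) \<Rightarrow> (('a \<Rightarrow> complex) \<Rightarrow> complex) set"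
  where "dual_space E N = {\<phi>.
    (\<forall>f\<in>E. \<forall>g\<in>E. \<phi> (\<lambda>y. f y + g y) = \<phi> f + \<phi> g) \<and>
    (\<forall>f\<in>E. \<forall>c. \<phi> (\<lambda>y. c * f y) = c * \<phi> f) \<and>
    (\<exists>C. \<forall>f\<in>E. cmod (\<phi> f) \<le> C * N f)}"

definition dual_norm ::
    "('a \<Rightarrow> complex) set \<Rightarrow> (('a \<Rightarrow> complex) \<Rightarrow> real) \<Rightarrow> (('a \<Rightarrow> complex) \<Rightarrow> complex) \<Rightarrow> real"
  where "dual_norm E N \<phi> = (SUP f\<in>{f\<in>E. N f \<le> 1}. cmod (\<phi> f))"

definition r_nuclear_on ::
    "('a \<Rightarrow> complex) set \<Rightarrow> (('a \<Rightarrow> complex) \<Rightarrow> real) \<Rightarrow> real \<Rightarrow>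
      (('a \<Rightarrow> complex) \<Rightarrow> 'a \<Rightarrow> complex) \<Rightarrow> bool"
  where "r_nuclear_on E N r T \<longleftrightarrow>
    linear_operator_on E N T \<and>
    (\<exists>\<phi> y. (\<forall>n::nat. \<phi> n \<in> dual_space E N) \<and> (\<forall>n. y n \<in> E) \<and>
      (\<forall>f\<in>E. (\<lambda>m. N (\<lambda>x. T f x - (\<Sum>n<m. \<phi> n f * y n x))) \<longlonglongrightarrow> 0) \<and>
      summable (\<lambda>n. dual_norm E N (\<phi> n) powr r * N (y n) powr r))"

definition Lp_space :: "'a measure \<Rightarrow> real \<Rightarrow> ('a \<Rightarrow> complex) set"
  where "Lp_space M p =
    {f \<in> borel_measurable M. integrable M (\<lambda>x. cmod (f x) powr p)}"

definition Lp_norm :: "'a measure \<Rightarrow> real \<Rightarrow> ('a \<Rightarrow> complex) \<Rightarrow> real"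
  where "Lp_norm M p f = (\<integral>x. cmod (f x) powr p \<partial>M) powr (1 / p)"


definition SU2 :: "(complex^2^2) set"
  where "SU2 = {g. g ** (\<chi> i j. cnj (g $ j $ i)) = mat 1 \<and> det g = 1}"

definition normalized_haar_SU2 :: "(complex^2^2) measure \<Rightarrow> bool"
  where "normalized_haar_SU2 \<mu> \<longleftrightarrow>
    sets \<mu> = sets (restrict_space borel SU2) \<and>
    emeasure \<mu> (space \<mu>) = 1 \<and>
    (\<forall>g\<in>SU2. distr \<mu> \<mu> (\<lambda>h. g ** h) = \<mu>)"

text \<open>
  Half-integers \<open>l\<close> are encoded by \<open>k = 2l\<close>, and the matrix indices run over \<open>{0..k}\<close>.
  The irreducible unitary representation \<open>t\<^sup>l\<close> acts on the homogeneous polynomials in \<open>(z, w)\<close>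
  of degree \<open>k\<close> by \<open>(t\<^sup>l(g) f)(z, w) = f((z, w) g)\<close>, and its matrix is taken with respect to
  the orthonormal basis \<open>z\<^sup>i w\<^sup>k\<^sup>-\<^sup>i / sqrt (i! (k - i)!)\<close>.
  In the formula \<open>w\<close> is set to \<open>1\<close>.
\<close>

definition su2_rep :: "nat \<Rightarrow> nat \<Rightarrow> nat \<Rightarrow> complex^2^2 \<Rightarrow> complex"
  where "su2_rep k i j g =
    complex_of_real (sqrt (fact i * fact (k - i) / (fact j * fact (k - j)))) *
    coeff ([:g$2$1, g$1$1:] ^ j * [:g$2$2, g$1$2:] ^ (k - j)) i"

text \<open>
  The one-parameter subgroups \<open>exp (s X\<^sub>1)\<close>, \<open>exp (s X\<^sub>2)\<close>, \<open>exp (s X\<^sub>3)\<close>, where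
  \<open>X\<^sub>j = (\<i>/2) \<sigma>\<^sub>j\<close> for the Pauli matrices \<open>\<sigma>\<^sub>j\<close>.
\<close>

definition su2_exp1 :: "real \<Rightarrow> complex^2^2"
  where "su2_exp1 s = vector [
    vector [complex_of_real (cos (s/2)), \<i> * complex_of_real (sin (s/2))],
    vector [\<i> * complex_of_real (sin (s/2)), complex_of_real (cos (s/2))]]"

definition su2_exp2 :: "real \<Rightarrow> complex^2^2"
  where "su2_exp2 s = vector [
    vector [complex_of_real (cos (s/2)), complex_of_real (sin (s/2))],
    vector [- complex_of_real (sin (s/2)), complex_of_real (cos (s/2))]]"

definition su2_exp3 :: "real \<Rightarrow> complex^2^2"
  where "su2_exp3 s = vector [vector [cis (s/2), 0], vector [0, cis (- (s/2))]]"

definition left_inv_deriv ::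
    "(real \<Rightarrow> complex^2^2) \<Rightarrow> (complex^2^2 \<Rightarrow> complex) \<Rightarrow> complex^2^2 \<Rightarrow> complex"
  where "left_inv_deriv \<gamma> f g = vector_derivative (\<lambda>s. f (g ** \<gamma> s)) (at 0)"

definition laplacian_SU2 :: "(complex^2^2 \<Rightarrow> complex) \<Rightarrow> complex^2^2 \<Rightarrow> complex"
  where "laplacian_SU2 f g =
    left_inv_deriv su2_exp1 (left_inv_deriv su2_exp1 f) g +
    left_inv_deriv su2_exp2 (left_inv_deriv su2_exp2 f) g +
    left_inv_deriv su2_exp3 (left_inv_deriv su2_exp3 f) g"

text \<open>
  \<open>T\<close> is \<open>(I - L)\<close> to the power \<open>-\<alpha>/2\<close> on \<open>L\<^sup>p\<close>: the bounded operator which multiplies each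
  matrix entry of each \<open>t\<^sup>l\<close>, an eigenfunction of \<open>I - L\<close>, by the power of its eigenvalue \<open>\<nu>\<close>.
  The eigenvalue is \<open>1 + l (l + 1)\<close>; see \<open>laplacian_su2_rep\<close> and
  \<open>bessel_potential_SU2_iff\<close> below. Boundedness makes \<open>T\<close> unique (up to null functions), as
  the span of the matrix entries is dense for \<open>p < \<infinity>\<close>.
\<close>

definition bessel_potential_SU2 ::
    "(complex^2^2) measure \<Rightarrow> real \<Rightarrow> real \<Rightarrow>
      ((complex^2^2 \<Rightarrow> complex) \<Rightarrow> complex^2^2 \<Rightarrow> complex) \<Rightarrow> bool"
  where "bessel_potential_SU2 \<mu> p \<alpha> T \<longleftrightarrow>
    bounded_operator_on (Lp_space \<mu> p) (Lp_norm \<mu> p) T \<and>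
    (\<forall>k i j. \<forall>\<nu>::real. i \<le> k \<longrightarrow> j \<le> k \<longrightarrow>
      (\<forall>g\<in>SU2. su2_rep k i j g - laplacian_SU2 (su2_rep k i j) g = \<nu> * su2_rep k i j g) \<longrightarrow>
      (AE g in \<mu>. T (su2_rep k i j) g = complex_of_real (\<nu> powr (- \<alpha> / 2)) * su2_rep k i j g))"


definition mono_coeff :: "nat \<Rightarrow> nat \<Rightarrow> nat \<Rightarrow> complex^2^2 \<Rightarrow> complex"
  where "mono_coeff i j n g = coeff ([:g$2$1, g$1$1:] ^ j * [:g$2$2, g$1$2:] ^ n) i"

definition coeff_deriv :: "(real \<Rightarrow> complex poly) \<Rightarrow> complex poly \<Rightarrow> bool"
  where "coeff_deriv F D \<longleftrightarrow> (\<forall>i. ((\<lambda>s. coeff (F s) i) has_vector_derivative coeff D i) (at 0))"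

lemma coeff_deriv_mult:
  assumes "coeff_deriv F F'" "coeff_deriv G G'"
  shows "coeff_deriv (\<lambda>s. F s * G s) (F 0 * G' + F' * G 0)"
  unfolding coeff_deriv_def
proof
  fix i
  have "((\<lambda>s. \<Sum>j\<le>i. coeff (F s) j * coeff (G s) (i - j)) has_vector_derivative
    (\<Sum>j\<le>i. coeff (F 0) j * coeff G' (i - j) + coeff F' j * coeff (G 0) (i - j))) (at 0)"
    by (intro has_vector_derivative_sum has_vector_derivative_mult)
      (use assms in \<open>auto simp: coeff_deriv_def\<close>)
  then show "((\<lambda>s. coeff (F s * G s) i) has_vector_derivative coeff (F 0 * G' + F' * G 0) i) (at 0)"
    by (simp add: coeff_mult sum.distrib)
qed

lemma coeff_deriv_power:
  assumes "coeff_deriv F F'"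
  shows "coeff_deriv (\<lambda>s. F s ^ n) (of_nat n * F 0 ^ (n - 1) * F')"
proof (induction n)
  case 0
  then show ?case by (simp add: coeff_deriv_def)
next
  case (Suc n)
  have "F 0 * (of_nat n * F 0 ^ (n - 1) * F') + F' * F 0 ^ n = of_nat (Suc n) * F 0 ^ n * F'"
    by (cases n) (simp_all add: algebra_simps)
  with coeff_deriv_mult[OF assms Suc] show ?case by simp
qed

lemma mono_coeff_deriv:
  fixes \<gamma> :: "real \<Rightarrow> complex^2^2"
  assumes d: "\<And>a b. ((\<lambda>s. \<gamma> s $ a $ b) has_vector_derivative X a b) (at 0)"
    and 0: "\<gamma> 0 = mat 1"
  shows "((\<lambda>s. mono_coeff i j n (g ** \<gamma> s)) has_vector_derivative
     (of_nat j * (X 1 1 * mono_coeff i j n g + X 2 1 * mono_coeff i (j - 1) (n + 1) g) +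
      of_nat n * (X 1 2 * mono_coeff i (j + 1) (n - 1) g + X 2 2 * mono_coeff i j n g))) (at 0)"
proof -
  define P where "P = [:g$2$1, g$1$1:]"
  define Q where "Q = [:g$2$2, g$1$2:]"
  have c: "coeff_deriv (\<lambda>s. [:(g ** \<gamma> s)$2$b, (g ** \<gamma> s)$1$b:]) (smult (X 1 b) P + smult (X 2 b) Q)" for b
    unfolding coeff_deriv_def P_def Q_def
  proof
    fix i
    have e: "((\<lambda>s. (g ** \<gamma> s)$a$b) has_vector_derivative g$a$1 * X 1 b + g$a$2 * X 2 b) (at 0)" for a
      unfolding matrix_matrix_mult_def
      by (auto simp: sum_2 intro!: derivative_intros d)
    show "((\<lambda>s. coeff [:(g ** \<gamma> s)$2$b, (g ** \<gamma> s)$1$b:] i) has_vector_derivative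
       coeff (smult (X 1 b) [:g$2$1, g$1$1:] + smult (X 2 b) [:g$2$2, g$1$2:]) i) (at 0)"
      using e[of 2] e[of 1] by (auto simp: coeff_pCons mult.commute split: nat.split)
  qed
  have g0: "g ** \<gamma> 0 = g" by (simp add: 0)
  have *: "coeff_deriv (\<lambda>s. [:(g ** \<gamma> s)$2$1, (g ** \<gamma> s)$1$1:] ^ j * [:(g ** \<gamma> s)$2$2, (g ** \<gamma> s)$1$2:] ^ n)
     (P ^ j * (of_nat n * Q ^ (n - 1) * (smult (X 1 2) P + smult (X 2 2) Q)) +
      (of_nat j * P ^ (j - 1) * (smult (X 1 1) P + smult (X 2 1) Q)) * Q ^ n)"
    using coeff_deriv_mult[OF coeff_deriv_power[OF c, of 1 j] coeff_deriv_power[OF c, of 2 n]]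
    by (simp add: g0 P_def Q_def)
  have e1: "(of_nat j * P ^ (j - 1) * (smult (X 1 1) P + smult (X 2 1) Q)) * Q ^ n =
    smult (of_nat j * X 1 1) (P ^ j * Q ^ n) + smult (of_nat j * X 2 1) (P ^ (j - 1) * Q ^ (n + 1))"
    by (cases j) (simp_all add: of_nat_poly algebra_simps smult_add_left smult_add_right)
  have e2: "P ^ j * (of_nat n * Q ^ (n - 1) * (smult (X 1 2) P + smult (X 2 2) Q)) =
    smult (of_nat n * X 1 2) (P ^ (j + 1) * Q ^ (n - 1)) + smult (of_nat n * X 2 2) (P ^ j * Q ^ n)"
    by (cases n) (simp_all add: of_nat_poly algebra_simps smult_add_left smult_add_right)
  show ?thesis
    using *[unfolded coeff_deriv_def e1 e2, rule_format, of i]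
    by (simp add: mono_coeff_def P_def Q_def algebra_simps)
qed

lemma su2_exp_0: "su2_exp1 0 = mat 1" "su2_exp2 0 = mat 1" "su2_exp3 0 = mat 1"
  by (auto simp: su2_exp1_def su2_exp2_def su2_exp3_def vec_eq_iff mat_def forall_2)

lemma su2_exp_deriv:
  "((\<lambda>s. su2_exp1 s $ a $ b) has_vector_derivative (if a = b then 0 else \<i> / 2)) (at 0)"
  "((\<lambda>s. su2_exp2 s $ a $ b) has_vector_derivative
     (if a = b then 0 else if a = 1 then 1 / 2 else - (1 / 2))) (at 0)"
  "((\<lambda>s. su2_exp3 s $ a $ b) has_vector_derivative
     (if a = b then if a = 1 then \<i> / 2 else - (\<i> / 2) else 0)) (at 0)"
proof -
  have c: "((\<lambda>s::real. complex_of_real (cos (s/2))) has_vector_derivative 0) (at 0)"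
    and s: "((\<lambda>s::real. complex_of_real (sin (s/2))) has_vector_derivative 1/2) (at 0)"
  proof -
    have "((\<lambda>s::real. cos (s/2)) has_real_derivative 0) (at 0)"
      by (auto intro!: derivative_eq_intros)
    from has_vector_derivative_of_real[OF this, where 'a = complex]
    show "((\<lambda>s::real. complex_of_real (cos (s/2))) has_vector_derivative 0) (at 0)" by simp
    have "((\<lambda>s::real. sin (s/2)) has_real_derivative 1/2) (at 0)"
      by (auto intro!: derivative_eq_intros)
    from has_vector_derivative_of_real[OF this, where 'a = complex]
    show "((\<lambda>s::real. complex_of_real (sin (s/2))) has_vector_derivative 1/2) (at 0)" by simp
  qed
  have si: "((\<lambda>s::real. \<i> * complex_of_real (sin (s/2))) has_vector_derivative \<i>/2) (at 0)"
    using has_vector_derivative_mult_right[OF s, of \<i>] by simp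
  have ms: "((\<lambda>s::real. - complex_of_real (sin (s/2))) has_vector_derivative -(1/2)) (at 0)"
    using has_vector_derivative_minus[OF s] by simp
  have cis: "cis (s/2) = complex_of_real (cos (s/2)) + \<i> * complex_of_real (sin (s/2))"
    "cis (-(s/2)) = complex_of_real (cos (s/2)) - \<i> * complex_of_real (sin (s/2))" for s
    by (simp_all add: complex_eq_iff)
  have e: "((\<lambda>s::real. cis (s/2)) has_vector_derivative \<i>/2) (at 0)"
    unfolding cis using has_vector_derivative_add[OF c si] by simp
  have e': "((\<lambda>s::real. cis (-(s/2))) has_vector_derivative -(\<i>/2)) (at 0)"
    unfolding cis using has_vector_derivative_diff[OF c si] by simp
  show "((\<lambda>s. su2_exp1 s $ a $ b) has_vector_derivative (if a = b then 0 else \<i> / 2)) (at 0)"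
    using exhaust_2[of a] exhaust_2[of b] c si by (auto simp: su2_exp1_def)
  show "((\<lambda>s. su2_exp2 s $ a $ b) has_vector_derivative
     (if a = b then 0 else if a = 1 then 1 / 2 else - (1 / 2))) (at 0)"
    using exhaust_2[of a] exhaust_2[of b] c s ms by (auto simp: su2_exp2_def)
  show "((\<lambda>s. su2_exp3 s $ a $ b) has_vector_derivative
     (if a = b then if a = 1 then \<i> / 2 else - (\<i> / 2) else 0)) (at 0)"
    using exhaust_2[of a] exhaust_2[of b] e e' by (auto simp: su2_exp3_def)
qed

lemma left_inv_deriv_comb:
  fixes \<gamma> :: "real \<Rightarrow> complex^2^2"
  assumes d: "\<And>a b. ((\<lambda>s. \<gamma> s $ a $ b) has_vector_derivative X a b) (at 0)"
    and 0: "\<gamma> 0 = mat 1"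
  shows "left_inv_deriv \<gamma> (\<lambda>g. a * mono_coeff i j n g + b * mono_coeff i j' n' g) = (\<lambda>g.
     a * (of_nat j * (X 1 1 * mono_coeff i j n g + X 2 1 * mono_coeff i (j - 1) (n + 1) g) +
      of_nat n * (X 1 2 * mono_coeff i (j + 1) (n - 1) g + X 2 2 * mono_coeff i j n g)) +
     b * (of_nat j' * (X 1 1 * mono_coeff i j' n' g + X 2 1 * mono_coeff i (j' - 1) (n' + 1) g) +
      of_nat n' * (X 1 2 * mono_coeff i (j' + 1) (n' - 1) g + X 2 2 * mono_coeff i j' n' g)))"
  unfolding left_inv_deriv_def
  by (intro ext vector_derivative_at has_vector_derivative_add has_vector_derivative_mult_right
      mono_coeff_deriv d 0)

lemma laplacian_mono_coeff:
  "laplacian_SU2 (\<lambda>g. c * mono_coeff i j n g) g =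
    - (of_nat (j + n) / 2 * (of_nat (j + n) / 2 + 1)) * (c * mono_coeff i j n g)"
proof -
  note D1 = left_inv_deriv_comb[OF su2_exp_deriv(1) su2_exp_0(1)]
  note D2 = left_inv_deriv_comb[OF su2_exp_deriv(2) su2_exp_0(2)]
  note D3 = left_inv_deriv_comb[OF su2_exp_deriv(3) su2_exp_0(3)]
  let ?m = "mono_coeff i"
  have m: "(\<lambda>g. c * ?m j n g) = (\<lambda>g. c * ?m j n g + 0 * ?m j n g)" by simp
  have 1: "left_inv_deriv su2_exp1 (\<lambda>g. c * ?m j n g) =
    (\<lambda>g. (c * of_nat j * \<i> / 2) * ?m (j - 1) (n + 1) g + (c * of_nat n * \<i> / 2) * ?m (j + 1) (n - 1) g)"
    by (subst m, subst D1) (simp add: algebra_simps)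
  have 2: "left_inv_deriv su2_exp2 (\<lambda>g. c * ?m j n g) =
    (\<lambda>g. (- c * of_nat j / 2) * ?m (j - 1) (n + 1) g + (c * of_nat n / 2) * ?m (j + 1) (n - 1) g)"
    by (subst m, subst D2) (simp add: algebra_simps)
  have 3: "left_inv_deriv su2_exp3 (\<lambda>g. c * ?m j n g) =
    (\<lambda>g. (c * (of_nat j - of_nat n) * \<i> / 2) * ?m j n g + 0 * ?m j n g)"
    by (subst m, subst D3) (simp add: algebra_simps diff_divide_distrib)
  show ?thesis
    unfolding laplacian_SU2_def 1 2 3 D1 D2 D3
    by (cases j; cases n) (simp_all add: field_simps)
qed

lemma laplacian_su2_rep:
  assumes "j \<le> k"
  shows "laplacian_SU2 (su2_rep k i j) g =
    - complex_of_real (real k / 2 * (real k / 2 + 1)) * su2_rep k i j g"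
proof -
  have "su2_rep k i j = (\<lambda>g. complex_of_real (sqrt (fact i * fact (k - i) / (fact j * fact (k - j)))) *
      mono_coeff i j (k - j) g)"
    by (simp add: su2_rep_def mono_coeff_def fun_eq_iff)
  then show ?thesis
    using laplacian_mono_coeff[of _ i j "k - j"] assms by (simp del: of_nat_add)
qed

lemma bessel_potential_SU2_iff:
  assumes "normalized_haar_SU2 \<mu>"
  shows "bessel_potential_SU2 \<mu> p \<alpha> T \<longleftrightarrow>
    bounded_operator_on (Lp_space \<mu> p) (Lp_norm \<mu> p) T \<and>
    (\<forall>k i j. i \<le> k \<longrightarrow> j \<le> k \<longrightarrow>
      (AE g in \<mu>. T (su2_rep k i j) g =
        complex_of_real ((1 + real k / 2 * (real k / 2 + 1)) powr (- \<alpha> / 2)) * su2_rep k i j g))"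
    (is "_ \<longleftrightarrow> ?B \<and> ?R")
proof -
  have space: "space \<mu> = SU2"
    using assms sets_eq_imp_space_eq[of \<mu> "restrict_space borel SU2"]
    by (simp add: normalized_haar_SU2_def space_restrict_space)
  let ?ev = "\<lambda>k. 1 + real k / 2 * (real k / 2 + 1)"
  have ev: "su2_rep k i j g - laplacian_SU2 (su2_rep k i j) g =
      complex_of_real (?ev k) * su2_rep k i j g" if "j \<le> k" for k i j g
    unfolding laplacian_su2_rep[OF that] by (simp add: algebra_simps)
  have "bessel_potential_SU2 \<mu> p \<alpha> T" if B: ?B and R: ?R
    unfolding bessel_potential_SU2_def
  proof (intro conjI B allI impI)
    fix k i j and \<nu> :: real
    assume "i \<le> k" "j \<le> k" and
      \<nu>: "\<forall>g\<in>SU2. su2_rep k i j g - laplacian_SU2 (su2_rep k i j) g = \<nu> * su2_rep k i j g"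
    then have "AE g in \<mu>. T (su2_rep k i j) g =
        complex_of_real (?ev k powr (- \<alpha> / 2)) * su2_rep k i j g"
      using R by blast
    moreover have "\<nu> = ?ev k \<or> su2_rep k i j g = 0" if "g \<in> SU2" for g
      using \<nu> that ev[OF \<open>j \<le> k\<close>, of i g] of_real_eq_iff mult_cancel_right by metis
    ultimately show "AE g in \<mu>. T (su2_rep k i j) g =
        complex_of_real (\<nu> powr (- \<alpha> / 2)) * su2_rep k i j g"
      by (elim AE_mp) (rule AE_I2, force simp: space)
  qed
  moreover have ?R if "bessel_potential_SU2 \<mu> p \<alpha> T"
    using that ev unfolding bessel_potential_SU2_def by blast
  ultimately show ?thesis
    unfolding bessel_potential_SU2_def by blast
qed

end

theory Submission
  imports Defs "Jordan_Normal_Form.Determinant"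
begin

text \<open>
  The operator is a sum of dyadic blocks, the \<open>j\<close>-th of which is the convolution with a central
  polynomial of degree less than \<open>2 \<cdot> 2\<^sup>j\<close>. On \<open>L\<^sup>p\<close> such a block has norm at most the \<open>L\<^sup>1\<close>-norm of
  its kernel, which is \<open>O(2\<^sup>-\<^sup>\<alpha>\<^sup>j)\<close>, and its rank is \<open>O(2\<^sup>3\<^sup>j)\<close>. An operator of rank \<open>n\<close> and norm \<open>a\<close>
  is the sum of \<open>n\<close> operators of rank one whose norms are \<open>O(a)\<close> (Auerbach's lemma), so the
  \<open>r\<close>-nuclear sum is dominated by \<open>\<Sum>\<^sub>j 2\<^sup>3\<^sup>j 2\<^sup>-\<^sup>\<alpha>\<^sup>r\<^sup>j\<close>, which converges as \<open>\<alpha> r > 3\<close>.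
\<close>

text \<open>Splitting a block directly into matrix entries is too costly: for p far from 2 the
  rank-one pieces belonging to single entries have L^p operator norms that grow with l. For p = 1
  the zonal entry costs a factor of order \<open>sqrt l\<close>. Auerbach's lemma avoids this loss
  because only the norm of the whole block enters. That norm is the second obstacle. Cutting the
  multiplier sharply at powers of two would make the L^1 norms of the kernels too large by a factor
  of order 2^j, as for Lebesgue constants. The blocks are therefore differences of functions
  \<open>tail N\<close>, which continue the multiplier linearly below the cut; control of second
  differences then suffices for a weighted L^2 estimate of the kernel. Multipliers are functions of
  the dimension n = 2l + 1, for which 1 + l(l + 1) = (n^2 + 3) / 4.\<close>

no_notation vec_index (infixl "$" 100)

text \<open>
  An Auerbach basis up to a factor \<open>2\<close>: a tuple in the unit ball whose determinant is at least
  half of the supremum. By Cramer's rule its coordinate functionals are quotients of determinants.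
\<close>

lemma near_auerbach:
  fixes q :: "(nat \<Rightarrow> complex) \<Rightarrow> real" and \<epsilon> :: real
  assumes "\<epsilon> > 0" and low: "\<And>v i. i < n \<Longrightarrow> \<epsilon> * cmod (v i) \<le> q v"
    and hom: "\<And>c v. q (\<lambda>i. c * v i) = cmod c * q v"
  obtains e B where "\<And>i. i < n \<Longrightarrow> q (e i) \<le> 1"
    and "\<And>v l. l < n \<Longrightarrow> v l = (\<Sum>i<n. (\<Sum>m<n. B i m * v m) * e i l)"
    and "\<And>v i. i < n \<Longrightarrow> cmod (\<Sum>m<n. B i m * v m) \<le> 2 * q v"
proof -
  define A where "A e = Matrix.mat n n (\<lambda>(l, i). e i l)" for e :: "nat \<Rightarrow> nat \<Rightarrow> complex"
  have A: "A e \<in> carrier_mat n n" for e by (simp add: A_def)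
  define S where "S = {cmod (Determinant.det (A e)) | e. \<forall>i<n. q (e i) \<le> 1}"
  \<comment> \<open>Leibniz expansion: \<open>low\<close> bounds every entry of a tuple in the unit
    ball by 1 / \<epsilon>.\<close>
  have "bdd_above S"
  proof (rule bdd_aboveI)
    fix x assume "x \<in> S"
    then obtain e where x: "x = cmod (Determinant.det (A e))" and e: "\<forall>i<n. q (e i) \<le> 1"
      by (auto simp: S_def)
    have "cmod (e i l) \<le> 1 / \<epsilon>" if "i < n" "l < n" for i l
      using low[OF that(2), of "e i"] e that \<open>\<epsilon> > 0\<close> by (force simp: field_simps)
    then have "(\<Prod>i = 0..<n. cmod (A e $$ (i, p i))) \<le> (\<Prod>i = 0..<n. 1 / \<epsilon>)" if "p permutes {0..<n}" for p
      using permutes_in_image[OF that] by (intro prod_mono) (auto simp: A_def)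
    then have "cmod (signof p * (\<Prod>i = 0..<n. A e $$ (i, p i))) \<le> (1 / \<epsilon>) ^ n" if "p permutes {0..<n}" for p
      using that by (simp add: norm_mult prod_norm sign_def)
    then show "x \<le> (\<Sum>p | p permutes {0..<n}. (1 / \<epsilon>) ^ n)"
      unfolding x det_def'[OF A] by (intro order_trans[OF norm_sum] sum_mono) simp
  qed
  define \<delta> :: "nat \<Rightarrow> nat \<Rightarrow> complex" where "\<delta> i l = (if i = l then 1 else 0)" for i l
  \<comment> \<open>Shrinking the standard basis by \<open>c\<close> puts it into the unit ball with
    determinant \<open>c ^ n\<close>, so the supremum is positive.\<close>
  define c where "c = 1 / (1 + (\<Sum>i<n. q (\<delta> i)))"
  have q\<delta>: "q (\<delta> i) \<ge> 0" if "i < n" for i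
    using low[OF that, of "\<delta> i"] \<open>\<epsilon> > 0\<close> by (simp add: \<delta>_def)
  then have "(\<Sum>i<n. q (\<delta> i)) \<ge> 0" by (intro sum_nonneg) simp
  then have "c > 0" by (simp add: c_def)
  have "q (\<lambda>l. of_real c * \<delta> i l) \<le> 1" if "i < n" for i
  proof -
    have "q (\<delta> i) \<le> (\<Sum>i<n. q (\<delta> i))"
      using that q\<delta> by (intro member_le_sum) auto
    also have "\<dots> \<le> 1 / c" using \<open>c > 0\<close> by (simp add: c_def)
    finally have "cmod (of_real c) * q (\<delta> i) \<le> 1"
      using \<open>c > 0\<close> by (simp add: field_simps)
    then show ?thesis unfolding hom .
  qed
  moreover have "A (\<lambda>i l. of_real c * \<delta> i l) = of_real c \<cdot>\<^sub>m 1\<^sub>m n"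
    by (rule eq_matI) (auto simp: A_def \<delta>_def)
  then have "cmod (Determinant.det (A (\<lambda>i l. of_real c * \<delta> i l))) = c ^ n"
    using \<open>c > 0\<close> by (simp add: norm_power)
  ultimately have cS: "c ^ n \<in> S" by (force simp: S_def)
  then have "Sup S > 0"
    using \<open>c > 0\<close> cSup_upper[OF cS \<open>bdd_above S\<close>] zero_less_power[of c n] by linarith
  \<comment> \<open>Accepting half of the supremum avoids proving that it is attained; this is the
    source of the factor 2.\<close>
  then have "Sup S / 2 < Sup S" by simp
  then obtain s where "s \<in> S" "Sup S / 2 < s"
    using less_cSup_iff[OF _ \<open>bdd_above S\<close>] cS by blast
  then obtain e where e: "\<forall>i<n. q (e i) \<le> 1" and s: "Sup S / 2 < cmod (Determinant.det (A e))"
    by (auto simp: S_def)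
  let ?d = "Determinant.det (A e)"
  have d: "?d \<noteq> 0" using s \<open>Sup S > 0\<close> by auto
  \<comment> \<open>The inverse of \<open>A e\<close>, written through the adjugate.\<close>
  define B where "B i m = adj_mat (A e) $$ (i, m) / ?d" for i m
  note adj = adj_mat[OF A[of e]]
  define x where "x v = Matrix.vec n (\<lambda>i. \<Sum>m<n. B i m * v m)" for v
  have Ax: "A e *\<^sub>v x v = Matrix.vec n v" for v
  proof -
    have "x v = (1 / ?d) \<cdot>\<^sub>v (adj_mat (A e) *\<^sub>v Matrix.vec n v)"
      by (rule eq_vecI)
        (use adj in \<open>auto simp: x_def B_def scalar_prod_def sum_distrib_left lessThan_atLeast0 intro!: sum.cong\<close>)
    then have "A e *\<^sub>v x v = (1 / ?d) \<cdot>\<^sub>v ((A e * adj_mat (A e)) *\<^sub>v Matrix.vec n v)"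
      using A[of e] adj(1) by (simp add: mult_mat_vec[of _ n n] assoc_mult_mat_vec[of _ n n _ n])
    also have "\<dots> = Matrix.vec n v"
      unfolding adj(2) using d by (intro eq_vecI) (auto simp: scalar_prod_def sum.remove)
    finally show ?thesis .
  qed
  have "v l = (\<Sum>i<n. (\<Sum>m<n. B i m * v m) * e i l)" if "l < n" for v l
  proof -
    have "v l = vec_index (A e *\<^sub>v x v) l"
      using that by (simp add: Ax)
    also have "\<dots> = (\<Sum>i<n. (\<Sum>m<n. B i m * v m) * e i l)"
      using that by (auto simp: A_def x_def scalar_prod_def lessThan_atLeast0 mult.commute intro!: sum.cong)
    finally show ?thesis .
  qed
  moreover have "cmod (\<Sum>m<n. B i m * v m) \<le> 2 * q v" if "i < n" for v i
  proof (cases "q v = 0")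
    case True
    then have "v m = 0" if "m < n" for m
      using low[OF that, of v] \<open>\<epsilon> > 0\<close> by (simp add: mult_le_0_iff)
    then show ?thesis by (simp add: True)
  next
    case False
    have "0 \<le> \<epsilon> * cmod (v i)" using \<open>\<epsilon> > 0\<close> by simp
    also note low[OF that, of v]
    finally have "q v \<ge> 0" .
    with False have qv: "q v > 0" by simp
    \<comment> \<open>By Cramer's rule, putting the unit vector \<open>w\<close> in place of
      \<open>e i\<close> multiplies the determinant by the i-th coordinate of \<open>w\<close>. The
      new determinant is at most \<open>Sup S\<close>, hence less than twice the old one.\<close>
    define w where "w = (\<lambda>l. of_real (1 / q v) * v l)"
    have "q w = 1" using qv unfolding w_def hom by (simp add: norm_divide)
    then have "cmod (Determinant.det (A (e(i := w)))) \<in> S"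
      using e by (force simp: S_def)
    then have "cmod (Determinant.det (A (e(i := w)))) \<le> Sup S"
      by (rule cSup_upper) fact
    also have "A (e(i := w)) = replace_col (A e) (A e *\<^sub>v x w) i"
      unfolding Ax by (rule eq_matI) (auto simp: A_def replace_col_def)
    also have "Determinant.det \<dots> = (\<Sum>m<n. B i m * w m) * ?d"
      using cramer_lemma_mat[OF A, of "x w" i e] that by (simp add: x_def)
    also have "(\<Sum>m<n. B i m * w m) = of_real (1 / q v) * (\<Sum>m<n. B i m * v m)"
      by (simp add: w_def sum_distrib_left mult_ac)
    finally have "cmod (\<Sum>m<n. B i m * v m) * cmod ?d \<le> Sup S * q v"
      using qv by (simp add: norm_mult norm_divide field_simps)
    also have "\<dots> \<le> (2 * q v) * cmod ?d"
      using s qv by (simp add: mult_right_mono)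
    finally show ?thesis using d by simp
  qed
  ultimately show thesis using that e by blast
qed

no_notation scalar_prod (infix "\<bullet>" 70)
hide_const (open) Matrix.mat Matrix.vec Matrix.row Determinant.det module.smult
hide_fact (open) Matrix.vec_eq_iff Matrix.mat_def Matrix.vec_def

section \<open>The group SU(2) and its matrix coefficients\<close>

abbreviation su2_inv :: "complex^2^2 \<Rightarrow> complex^2^2"
  where "su2_inv g \<equiv> \<chi> i j. cnj (g $ j $ i)"

lemma su2_inv_right: "g \<in> SU2 \<Longrightarrow> g ** su2_inv g = mat 1"
  by (simp add: SU2_def)

lemma su2_inv_left: "g \<in> SU2 \<Longrightarrow> su2_inv g ** g = mat 1"
  using su2_inv_right matrix_left_right_inverse by blast

lemma SU2_det: "g \<in> SU2 \<Longrightarrow> g$1$1 * g$2$2 - g$1$2 * g$2$1 = 1"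
  by (simp add: SU2_def det_2)

lemma SU2_mult: "g \<in> SU2 \<Longrightarrow> h \<in> SU2 \<Longrightarrow> g ** h \<in> SU2"
proof -
  assume g: "g \<in> SU2" and h: "h \<in> SU2"
  have "su2_inv (g ** h) = su2_inv h ** su2_inv g"
    by (simp add: vec_eq_iff matrix_matrix_mult_def sum_2 mult.commute)
  then have "(g ** h) ** su2_inv (g ** h) = g ** (h ** su2_inv h) ** su2_inv g"
    by (simp add: matrix_mul_assoc)
  also have "\<dots> = mat 1" using g h by (simp add: su2_inv_right)
  finally show ?thesis using g h by (simp add: SU2_def det_mul)
qed

lemma SU2_su2_inv: "g \<in> SU2 \<Longrightarrow> su2_inv g \<in> SU2"
proof -
  assume g: "g \<in> SU2"
  have "su2_inv (su2_inv g) = g" by (simp add: vec_eq_iff)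
  moreover have "Determinants.det (su2_inv g) = cnj (Determinants.det g)" by (simp add: det_2 mult.commute)
  ultimately show ?thesis using su2_inv_left[OF g] g by (simp add: SU2_def)
qed

lemma SU2_entries:
  assumes "g \<in> SU2"
  shows "g$2$2 = cnj (g$1$1)" "g$1$2 = - cnj (g$2$1)"
proof -
  \<comment> \<open>The adjugate is a left inverse because the determinant is 1, so it coincides
    with the conjugate transpose.\<close>
  define a where "a = (vector [vector [g$2$2, - g$1$2], vector [- g$2$1, g$1$1]] :: complex^2^2)"
  have "a ** g = mat 1"
    using SU2_det[OF assms]
    by (simp add: a_def vec_eq_iff matrix_matrix_mult_def sum_2 forall_2 mat_def algebra_simps)
  then have "a = a ** (g ** su2_inv g)" "(a ** g) ** su2_inv g = su2_inv g"
    using su2_inv_right[OF assms] by simp_all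
  then have "a = su2_inv g" by (simp add: matrix_mul_assoc)
  then have "a$1$1 = su2_inv g$1$1" "a$1$2 = su2_inv g$1$2" by (simp_all only:)
  then show "g$2$2 = cnj (g$1$1)" "g$1$2 = - cnj (g$2$1)"
    unfolding a_def by (simp_all, metis minus_minus)
qed

lemma SU2_norm:
  assumes "g \<in> SU2"
  shows "(cmod (g$1$1))\<^sup>2 + (cmod (g$2$1))\<^sup>2 = 1"
proof -
  have "complex_of_real ((cmod (g$1$1))\<^sup>2 + (cmod (g$2$1))\<^sup>2) = 1"
    using SU2_det[OF assms] unfolding SU2_entries[OF assms] of_real_add complex_norm_square
    by (simp add: algebra_simps)
  then show ?thesis using of_real_eq_1_iff by blast
qed

lemma SU2_entry_le: "g \<in> SU2 \<Longrightarrow> cmod (g $ i $ j) \<le> 1"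
proof -
  assume g: "g \<in> SU2"
  have "(cmod (g$1$1))\<^sup>2 \<le> 1\<^sup>2" "(cmod (g$2$1))\<^sup>2 \<le> 1\<^sup>2"
    using SU2_norm[OF g] zero_le_power2[of "cmod (g$1$1)"] zero_le_power2[of "cmod (g$2$1)"]
    by (simp_all only: one_power2; linarith)+
  then have "cmod (g$1$1) \<le> 1" "cmod (g$2$1) \<le> 1"
    using power2_le_imp_le zero_le_one by blast+
  then show ?thesis
    using exhaust_2[of i] exhaust_2[of j] SU2_entries[OF g] by auto
qed

lemma continuous_on_entry: "continuous_on S (\<lambda>g::complex^2^2. g $ i $ j)"
  by (intro continuous_intros)

lemma compact_SU2: "compact SU2"
proof -
  have "closed SU2"
  proof -
    have e: "SU2 = {g. g ** su2_inv g = mat 1} \<inter> {g. g$1$1 * g$2$2 - g$1$2 * g$2$1 = 1}"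
      by (auto simp: SU2_def det_2)
    have "{g. g ** su2_inv g = mat 1} =
        (\<Inter>i. \<Inter>j. {g::complex^2^2. (\<Sum>k\<in>UNIV. g$i$k * cnj (g$j$k)) = mat 1 $ i $ j})"
      by (auto simp: vec_eq_iff matrix_matrix_mult_def)
    then show ?thesis
      unfolding e by (auto intro!: closed_Int closed_INT closed_Collect_eq continuous_intros)
  qed
  moreover have "norm g \<le> 4" if "g \<in> SU2" for g
  proof -
    have "norm g \<le> (\<Sum>i\<in>UNIV. \<Sum>j\<in>UNIV. cmod (g$i$j))"
      unfolding norm_vec_def[of g]
      by (rule order_trans[OF L2_set_le_sum sum_mono]) (simp_all add: norm_vec_def L2_set_le_sum)
    then show ?thesis
      using SU2_entry_le[OF that, of 1 1] SU2_entry_le[OF that, of 1 2]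
        SU2_entry_le[OF that, of 2 1] SU2_entry_le[OF that, of 2 2]
      by (simp add: sum_2)
  qed
  ultimately show ?thesis
    by (auto simp: compact_eq_bounded_closed bounded_iff)
qed

text \<open>The maximal torus. It acts diagonally in the monomial basis and so separates the
  weights.\<close>

definition su2_diag :: "real \<Rightarrow> complex^2^2"
  where "su2_diag t = vector [vector [cis t, 0], vector [0, cis (- t)]]"

lemma su2_diag_SU2: "su2_diag t \<in> SU2"
  by (auto simp: su2_diag_def SU2_def vec_eq_iff matrix_matrix_mult_def sum_2 forall_2 mat_def
      det_2 cis_cnj cis_mult)

text \<open>A group element without zero entries, which links the different weights. Together with
  the torus it replaces an appeal to irreducibility; the triple 3, 4, 5 keeps it rational.\<close>

definition su2_rot :: "complex^2^2"
  where "su2_rot = vector [vector [3/5, 4/5], vector [- (4/5), 3/5]]"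

lemma su2_rot_SU2: "su2_rot \<in> SU2"
  by (auto simp: su2_rot_def SU2_def vec_eq_iff matrix_matrix_mult_def sum_2 forall_2 mat_def det_2)

section \<open>Algebra of the unnormalised matrix coefficients\<close>

lemma degree_linear_powers_le: "degree ([:a, b:] ^ j * [:c, d:] ^ n) \<le> j + n"
proof -
  have "degree ([:a, b:] ^ j * [:c, d:] ^ n) \<le> 1 * j + 1 * n"
    by (intro degree_mult_le[THEN order_trans] add_mono degree_power_le[THEN order_trans] mult_right_mono)
      auto
  then show ?thesis by simp
qed

lemma mono_coeff_gt: "i > j + n \<Longrightarrow> mono_coeff i j n g = 0"
  unfolding mono_coeff_def using degree_linear_powers_le le_less_trans coeff_eq_0 by blast

lemma mono_coeff_Suc1:
  "mono_coeff 0 (Suc j) n g = g$2$1 * mono_coeff 0 j n g"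
  "mono_coeff (Suc i) (Suc j) n g = g$2$1 * mono_coeff (Suc i) j n g + g$1$1 * mono_coeff i j n g"
  unfolding mono_coeff_def power_Suc mult.assoc
  unfolding mult_pCons_left by simp_all

lemma mono_coeff_Suc2:
  "mono_coeff 0 j (Suc n) g = g$2$2 * mono_coeff 0 j n g"
  "mono_coeff (Suc i) j (Suc n) g = g$2$2 * mono_coeff (Suc i) j n g + g$1$2 * mono_coeff i j n g"
  unfolding mono_coeff_def power_Suc mult.left_commute[of "_ ^ j" "[:_, _:]"]
  unfolding mult_pCons_left by simp_all

lemma mono_coeff_0_0: "mono_coeff i 0 0 g = (if i = 0 then 1 else 0)"
  by (simp add: mono_coeff_def)

text \<open>In row 0 no cancellation is possible, so its entries at \<open>su2_rot\<close> are
  visibly nonzero.\<close>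

lemma mono_coeff_0: "mono_coeff 0 j n g = g$2$1 ^ j * g$2$2 ^ n"
proof (induction j)
  case 0
  show ?case by (induction n) (simp_all add: mono_coeff_Suc2 mono_coeff_0_0)
qed (simp add: mono_coeff_Suc1)

lemma mono_coeff_diag: "mono_coeff i j n (su2_diag t) = (if i = j then cis ((real j - real n) * t) else 0)"
proof -
  have "[:0, cis t:] ^ j = monom (cis t ^ j) j"
    by (metis monom_0 monom_Suc monom_power mult.right_neutral One_nat_def nat_mult_1)
  moreover have "[:cis (-t), 0:] ^ n = [:cis (-t) ^ n:]"
    by (simp add: poly_const_pow)
  ultimately have "mono_coeff i j n (su2_diag t) = (if i = j then cis t ^ j * cis (-t) ^ n else 0)"
    by (simp add: mono_coeff_def su2_diag_def mult.commute)
  then show ?thesis by (simp add: Complex.DeMoivre cis_mult algebra_simps)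
qed

text \<open>The representation property without normalising factors: the coefficients describe the
  substitution of linear forms in z^j w^n, and composing substitutions multiplies matrices.\<close>

lemma mono_coeff_mult:
  "mono_coeff i j n (g ** h) = (\<Sum>l\<le>j + n. mono_coeff i l (j + n - l) g * mono_coeff l j n h)"
proof -
  define P where "P = [:g$2$1, g$1$1:]"
  define Q where "Q = [:g$2$2, g$1$2:]"
  \<comment> \<open>\<open>H p k\<close> homogenises \<open>p\<close> to degree \<open>k\<close> and
    substitutes the forms \<open>P\<close> and \<open>Q\<close>; by \<open>step\<close> this is
    multiplicative in linear factors.\<close>
  define H where "H p k = (\<Sum>l\<le>k. smult (coeff p l) (P ^ l * Q ^ (k - l)))" for p :: "complex poly" and k
  have step: "H ([:a, b:] * p) (Suc k) = (smult a Q + smult b P) * H p k" if "degree p \<le> k" for a b p k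
  proof -
    have "coeff p (Suc k) = 0" using that by (intro coeff_eq_0) simp
    then have "smult a Q * H p k = (\<Sum>l\<le>Suc k. smult (a * coeff p l) (P ^ l * Q ^ (Suc k - l)))"
      by (simp add: H_def sum_distrib_left Suc_diff_le mult_ac)
    moreover have "smult b P * H p k =
        (\<Sum>l\<le>Suc k. smult (case l of 0 \<Rightarrow> 0 | Suc l \<Rightarrow> b * coeff p l) (P ^ l * Q ^ (Suc k - l)))"
      by (subst sum.atMost_Suc_shift) (simp add: H_def sum_distrib_left mult_ac)
    moreover have "coeff ([:a, b:] * p) l = a * coeff p l + (case l of 0 \<Rightarrow> 0 | Suc l \<Rightarrow> b * coeff p l)" for l
      by (simp add: mult_pCons_left coeff_pCons split: nat.split)
    ultimately show ?thesis
      unfolding H_def by (simp only: distrib_right smult_add_left sum.distrib)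
  qed
  have e: "H ([:h$2$1, h$1$1:] ^ j * [:h$2$2, h$1$2:] ^ n) (j + n) =
    (smult (h$2$1) Q + smult (h$1$1) P) ^ j * (smult (h$2$2) Q + smult (h$1$2) P) ^ n"
  proof (induction j)
    case 0
    show ?case
    proof (induction n)
      case 0
      show ?case by (simp add: H_def)
    next
      case (Suc n)
      then show ?case using step[of "[:h$2$2, h$1$2:] ^ n" n] degree_linear_powers_le[of 0 0 0 "h$2$2" "h$1$2" n] by simp
    qed
  next
    case (Suc j)
    show ?case unfolding power_Suc mult.assoc add_Suc step[OF degree_linear_powers_le] Suc ..
  qed
  have "smult (h$2$1) Q + smult (h$1$1) P = [:(g**h)$2$1, (g**h)$1$1:]"
    "smult (h$2$2) Q + smult (h$1$2) P = [:(g**h)$2$2, (g**h)$1$2:]"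
    by (simp_all add: P_def Q_def matrix_matrix_mult_def sum_2 mult.commute add.commute)
  with e have "mono_coeff i j n (g ** h) = coeff (H ([:h$2$1, h$1$1:] ^ j * [:h$2$2, h$1$2:] ^ n) (j + n)) i"
    by (simp add: mono_coeff_def)
  then show ?thesis
    by (simp add: H_def coeff_sum mono_coeff_def P_def Q_def mult.commute)
qed

text \<open>The Clebsch-Gordan rule for the product with the two-dimensional representation, in
  explicit form. Differentiating P^a Q^b in z lowers the degree, and determinant 1 means
  \<open>g$1$1\<close> Q - \<open>g$1$2\<close> P = 1, which raises it back. Only the first row of g
  needs this; the second row follows from the recursions.\<close>

lemma mono_coeff_entry:
  assumes "g \<in> SU2"
  shows "of_nat (j + n + 1) * (g$1$1 * mono_coeff i j n g) =
      of_nat (i + 1) * mono_coeff (i + 1) (j + 1) n g + of_nat n * mono_coeff i j (n - 1) g"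
    and "of_nat (j + n + 1) * (g$1$2 * mono_coeff i j n g) =
      of_nat (i + 1) * mono_coeff (i + 1) j (n + 1) g - of_nat j * mono_coeff i (j - 1) n g"
proof -
  define P where "P = [:g$2$1, g$1$1:]"
  define Q where "Q = [:g$2$2, g$1$2:]"
  have PQ: "smult (g$1$1) Q = smult (g$1$2) P + 1"
    using SU2_det[OF assms] by (simp add: P_def Q_def one_pCons algebra_simps)
  define x where "x a b = coeff (P ^ a * Q ^ b) i" for a b
  have x: "g$1$1 * x a (b + 1) = g$1$2 * x (a + 1) b + x a b" for a b
  proof -
    have "P ^ a * Q ^ b * smult (g$1$1) Q = P ^ a * Q ^ b * (smult (g$1$2) P + 1)"
      by (simp add: PQ)
    then have "coeff (smult (g$1$1) (P ^ a * Q ^ (b + 1))) i =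
        coeff (smult (g$1$2) (P ^ (a + 1) * Q ^ b) + P ^ a * Q ^ b) i"
      by (simp add: algebra_simps)
    then show ?thesis unfolding x_def by simp
  qed
  have dP: "pderiv P = [:g$1$1:]" "pderiv Q = [:g$1$2:]"
    by (simp_all add: P_def Q_def pderiv_pCons)
  have pow: "pderiv (P ^ a) = smult (of_nat a * g$1$1) (P ^ (a - 1))"
    "pderiv (Q ^ a) = smult (of_nat a * g$1$2) (Q ^ (a - 1))" for a
    unfolding pderiv_power dP by simp_all
  have d: "of_nat (i + 1) * mono_coeff (i + 1) a b g =
      of_nat a * g$1$1 * x (a - 1) b + of_nat b * g$1$2 * x a (b - 1)" for a b
  proof -
    have "of_nat (i + 1) * mono_coeff (i + 1) a b g = coeff (pderiv (P ^ a * Q ^ b)) i"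
      by (simp add: mono_coeff_def P_def Q_def coeff_pderiv)
    then show ?thesis unfolding pderiv_mult pow x_def by (simp add: mult_ac)
  qed
  have m: "mono_coeff i a b g = x a b" for a b
    by (simp add: mono_coeff_def P_def Q_def x_def)
  show "of_nat (j + n + 1) * (g$1$1 * mono_coeff i j n g) =
      of_nat (i + 1) * mono_coeff (i + 1) (j + 1) n g + of_nat n * mono_coeff i j (n - 1) g"
    unfolding d m using x[of j "n - 1"] by (cases n) (simp_all add: algebra_simps)
  show "of_nat (j + n + 1) * (g$1$2 * mono_coeff i j n g) =
      of_nat (i + 1) * mono_coeff (i + 1) j (n + 1) g - of_nat j * mono_coeff i (j - 1) n g"
    unfolding d m using x[of "j - 1" n] by (cases j) (simp_all add: algebra_simps)
qed

section \<open>Characters as Chebyshev polynomials of the trace\<close>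

text \<open>This is U_k(t / 2), with U_k the Chebyshev polynomial of the second kind: the character
  of dimension k + 1 in terms of the trace t. It is polymorphic because traces of coefficients are
  complex while the estimates are real.\<close>

fun cheb :: "nat \<Rightarrow> 'a::comm_ring_1 \<Rightarrow> 'a"
  where "cheb 0 t = 1" | "cheb (Suc 0) t = t" | "cheb (Suc (Suc k)) t = t * cheb (Suc k) t - cheb k t"

lemma cheb_of_real: "cheb k (of_real t :: complex) = of_real (cheb k t)"
  by (induction k t rule: cheb.induct) simp_all

lemma trace_mono_coeff:
  assumes "g \<in> SU2"
  shows "(\<Sum>j\<le>k. mono_coeff j j (k - j) g) = cheb k (g$1$1 + g$2$2)"
proof -
  define tr where "tr k = (\<Sum>j\<le>k. mono_coeff j j (k - j) g)" for k
  \<comment> \<open>The sum along the neighbouring diagonal closes the recursion for the trace.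
    Eliminating it with determinant 1 leaves the Chebyshev recurrence.\<close>
  define X where "X k = (\<Sum>j\<le>k. mono_coeff (Suc j) j (k - j) g)" for k
  have tr_Suc: "tr (Suc k) = g$1$1 * tr k + g$2$1 * X k + g$2$2 ^ Suc k" for k
    unfolding tr_def X_def
    by (subst sum.atMost_Suc_shift)
      (simp add: mono_coeff_Suc1 mono_coeff_0 sum.distrib sum_distrib_left)
  have X_Suc: "X (Suc k) = g$2$2 * X k + g$1$2 * tr k" for k
    unfolding X_def tr_def
    by (simp add: mono_coeff_Suc2 Suc_diff_le sum.distrib sum_distrib_left mono_coeff_gt)
  have "tr (Suc (Suc k)) = (g$1$1 + g$2$2) * tr (Suc k) - tr k" for k
  proof -
    have "g$2$1 * X (Suc k) = g$2$2 * (tr (Suc k) - g$1$1 * tr k - g$2$2 ^ Suc k) + g$1$2 * g$2$1 * tr k"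
      unfolding X_Suc tr_Suc by (simp add: algebra_simps)
    then have "tr (Suc (Suc k)) = (g$1$1 + g$2$2) * tr (Suc k) - (g$1$1 * g$2$2 - g$1$2 * g$2$1) * tr k"
      unfolding tr_Suc[of "Suc k"] by (simp add: algebra_simps)
    then show ?thesis using SU2_det[OF assms] by simp
  qed
  moreover have "tr 0 = 1" "tr (Suc 0) = g$1$1 + g$2$2"
    by (simp_all add: tr_def mono_coeff_0_0 mono_coeff_Suc1 mono_coeff_Suc2)
  ultimately have "tr k = cheb k (g$1$1 + g$2$2)"
    by (induction k "g$1$1 + g$2$2" rule: cheb.induct) simp_all
  then show ?thesis by (simp add: tr_def)
qed

text \<open>Needed for the bound by the dimension: a sum of cosines over the k + 1 weights is
  trivially bounded, which the recurrence does not show.\<close>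

lemma cheb_cos: "cheb k (2 * cos \<theta>) = (\<Sum>j\<le>k. cos ((real k - 2 * real j) * \<theta>))"
proof -
  define u where "u k = (\<Sum>j\<le>k. cos ((real k - 2 * real j) * \<theta>))" for k
  have "u (Suc (Suc k)) = 2 * cos \<theta> * u (Suc k) - u k" for k
  proof -
    have "2 * cos \<theta> * u (Suc k) =
        (\<Sum>j\<le>Suc k. cos ((real (Suc (Suc k)) - 2 * real j) * \<theta>)) + (\<Sum>j\<le>Suc k. cos ((real k - 2 * real j) * \<theta>))"
      unfolding u_def sum_distrib_left sum.distrib[symmetric]
    proof (intro sum.cong refl)
      fix j
      have "(real (Suc (Suc k)) - 2 * real j) * \<theta> = (real (Suc k) - 2 * real j) * \<theta> + \<theta>"
        "(real k - 2 * real j) * \<theta> = (real (Suc k) - 2 * real j) * \<theta> - \<theta>"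
        by (simp_all add: algebra_simps)
      then show "2 * cos \<theta> * cos ((real (Suc k) - 2 * real j) * \<theta>) =
         cos ((real (Suc (Suc k)) - 2 * real j) * \<theta>) + cos ((real k - 2 * real j) * \<theta>)"
        by (simp only: cos_add cos_diff) simp
    qed
    also have "(\<Sum>j\<le>Suc k. cos ((real k - 2 * real j) * \<theta>)) = u k + cos ((real k - 2 * real (Suc k)) * \<theta>)"
      by (simp add: u_def)
    also have "(\<Sum>j\<le>Suc k. cos ((real (Suc (Suc k)) - 2 * real j) * \<theta>)) =
        u (Suc (Suc k)) - cos ((real (Suc (Suc k)) - 2 * real (Suc (Suc k))) * \<theta>)"
      by (simp add: u_def)
    \<comment> \<open>The two surplus end terms cancel: both arguments equal -(k + 2)
      \<theta>.\<close>
    also have "cos ((real (Suc (Suc k)) - 2 * real (Suc (Suc k))) * \<theta>) = cos ((real k - 2 * real (Suc k)) * \<theta>)"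
      by (simp add: algebra_simps)
    finally show ?thesis by simp
  qed
  moreover have "u 0 = 1" "u (Suc 0) = 2 * cos \<theta>"
    by (simp_all add: u_def)
  ultimately have "cheb k (2 * cos \<theta>) = u k"
    by (induction k "2 * cos \<theta>" rule: cheb.induct) simp_all
  then show ?thesis by (simp add: u_def)
qed

lemma abs_cheb_le:
  fixes t :: real
  assumes "\<bar>t\<bar> \<le> 2"
  shows "\<bar>cheb k t\<bar> \<le> real k + 1"
proof -
  have "t = 2 * cos (arccos (t / 2))"
    using assms by (subst cos_arccos) (auto simp: abs_le_iff)
  then have "cheb k t = (\<Sum>j\<le>k. cos ((real k - 2 * real j) * arccos (t / 2)))"
    using cheb_cos by metis
  also have "\<bar>\<dots>\<bar> \<le> (\<Sum>j\<le>k. 1)"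
    by (rule order_trans[OF sum_abs sum_mono]) simp
  finally show ?thesis by simp
qed

lemma continuous_on_cheb: "continuous_on S (cheb k :: real \<Rightarrow> real)"
proof -
  have "continuous_on S (\<lambda>t::real. cheb k t)"
    by (induction k rule: induct_nat_012) (auto intro!: continuous_intros)
  then show ?thesis .
qed

definition rtr :: "complex^2^2 \<Rightarrow> real"
  where "rtr g = Re (g$1$1 + g$2$2)"

lemma trace_SU2: "g \<in> SU2 \<Longrightarrow> g$1$1 + g$2$2 = of_real (rtr g)"
  by (simp add: rtr_def SU2_entries complex_eq_iff)

lemma trace_mono_coeff_rtr:
  assumes "g \<in> SU2"
  shows "(\<Sum>j\<le>k. mono_coeff j j (k - j) g) = of_real (cheb k (rtr g))"
  using trace_mono_coeff[OF assms] trace_SU2[OF assms] cheb_of_real by metis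

lemma abs_rtr_le: "g \<in> SU2 \<Longrightarrow> \<bar>rtr g\<bar> \<le> 2"
  using SU2_entry_le[of g 1 1] abs_Re_le_cmod[of "g$1$1"]
  by (simp add: rtr_def SU2_entries)

lemma rtr_mult_commute: "rtr (g ** h) = rtr (h ** g)"
  by (simp add: rtr_def matrix_matrix_mult_def sum_2)

lemma rtr_mult_su2_inv: "rtr (g ** su2_inv h) = rtr (su2_inv g ** h)"
  by (simp add: rtr_def matrix_matrix_mult_def sum_2)

section \<open>The algebra of representative functions\<close>

text \<open>The representative functions of SU(2). The rule \<open>cong\<close> is there because
  functions are defined on all 2 x 2 matrices while only their values on the group matter.\<close>

inductive repfun :: "(complex^2^2 \<Rightarrow> complex) \<Rightarrow> bool" where
  mono: "repfun (mono_coeff i j n)"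
| add: "repfun f \<Longrightarrow> repfun h \<Longrightarrow> repfun (\<lambda>g. f g + h g)"
| scale: "repfun f \<Longrightarrow> repfun (\<lambda>g. c * f g)"
| cong: "repfun f \<Longrightarrow> (\<And>g. g \<in> SU2 \<Longrightarrow> h g = f g) \<Longrightarrow> repfun h"

lemma repfun_sum: "finite I \<Longrightarrow> (\<And>i. i \<in> I \<Longrightarrow> repfun (f i)) \<Longrightarrow> repfun (\<lambda>g. \<Sum>i\<in>I. f i g)"
proof (induction I rule: finite_induct)
  case empty
  show ?case using repfun.scale[OF repfun.mono, of 0] by simp
qed (simp add: repfun.add)

lemma repfun_diff: "repfun f \<Longrightarrow> repfun h \<Longrightarrow> repfun (\<lambda>g. f g - h g)"
  using repfun.add[OF _ repfun.scale[of h "- 1"], of f] by simp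

lemma continuous_on_mono_coeff: "continuous_on S (mono_coeff i j n)"
proof (induction j arbitrary: i)
  case 0
  show ?case
  proof (induction n arbitrary: i)
    case 0
    show ?case unfolding mono_coeff_0_0[abs_def] by (simp add: continuous_on_const)
  next
    case (Suc n)
    then show ?case
      by (cases i) (auto simp: mono_coeff_Suc2[abs_def] intro!: continuous_intros)
  qed
next
  case (Suc j)
  then show ?case
    by (cases i) (auto simp: mono_coeff_Suc1[abs_def] intro!: continuous_intros)
qed

lemma continuous_on_repfun: "repfun f \<Longrightarrow> continuous_on SU2 f"
proof (induction rule: repfun.induct)
  case (cong f h)
  then show ?case using continuous_on_cong by metis
qed (auto intro!: continuous_intros continuous_on_mono_coeff)

lemma repfun_bounded:
  assumes "repfun f"
  obtains B where "B > 0" "\<And>g. g \<in> SU2 \<Longrightarrow> cmod (f g) \<le> B"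
proof -
  have "bounded (f ` SU2)"
    using compact_SU2 continuous_on_repfun[OF assms] compact_continuous_image compact_imp_bounded by blast
  then show thesis using that unfolding bounded_pos by blast
qed

text \<open>For the first row this is \<open>mono_coeff_entry\<close> after division by j + n + 1.
  For the second row, solve the recursions \<open>mono_coeff_Suc1\<close> and
  \<open>mono_coeff_Suc2\<close> for the product.\<close>

lemma repfun_entry: "repfun f \<Longrightarrow> repfun (\<lambda>g. g$a$b * f g)"
proof (induction rule: repfun.induct)
  case (mono i j n)
  have divide: "repfun h" if "repfun f" and "\<And>g. g \<in> SU2 \<Longrightarrow> of_nat (j + n + 1) * h g = f g" for f h j n
    by (rule repfun.cong[OF repfun.scale[OF that(1), of "1 / of_nat (j + n + 1)"]])
      (simp add: that(2)[symmetric] del: of_nat_add of_nat_Suc)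
  have 1: "repfun (\<lambda>g. g$1$1 * mono_coeff i j n g)" for i j n
    by (rule divide[OF _ mono_coeff_entry(1)]) (intro repfun.intros)
  have 2: "repfun (\<lambda>g. g$1$2 * mono_coeff i j n g)" for i j n
    by (rule divide[OF _ mono_coeff_entry(2)]) (intro repfun_diff repfun.intros)
  have 3: "repfun (\<lambda>g. g$2$1 * mono_coeff i j n g)"
  proof (cases i)
    case (Suc k)
    show ?thesis
      by (rule repfun.cong[OF repfun.add[OF repfun.mono[of i "Suc j" n] repfun.scale[OF 1[of k j n], of "- 1"]]])
        (simp add: Suc mono_coeff_Suc1)
  qed (use repfun.mono[of 0 "Suc j" n] in \<open>simp add: mono_coeff_Suc1[abs_def]\<close>)
  have 4: "repfun (\<lambda>g. g$2$2 * mono_coeff i j n g)"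
  proof (cases i)
    case (Suc k)
    show ?thesis
      by (rule repfun.cong[OF repfun.add[OF repfun.mono[of i j "Suc n"] repfun.scale[OF 2[of k j n], of "- 1"]]])
        (simp add: Suc mono_coeff_Suc2)
  qed (use repfun.mono[of 0 j "Suc n"] in \<open>simp add: mono_coeff_Suc2[abs_def]\<close>)
  show ?case
    using 1 2 3 4 exhaust_2[of a] exhaust_2[of b] by auto
next
  case (add f h)
  then show ?case using repfun.add by (fastforce simp: distrib_left)
next
  case (scale f c)
  then show ?case using repfun.scale[of "\<lambda>g. g$a$b * f g" c] by (simp add: mult.left_commute)
next
  case (cong f h)
  then show ?case using repfun.cong[of "\<lambda>g. g$a$b * f g"] by simp
qed

text \<open>A coefficient is a polynomial in the entries of g, so its recursions reduce the product
  to \<open>repfun_entry\<close>. Closure under products is what makes Stone-Weierstrass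
  available.\<close>

lemma repfun_mult: "repfun f \<Longrightarrow> repfun h \<Longrightarrow> repfun (\<lambda>g. f g * h g)"
proof (induction rule: repfun.induct)
  case (mono i j n)
  show ?case
  proof (induction j arbitrary: i)
    case 0
    show ?case
    proof (induction n arbitrary: i)
      case 0
      show ?case using mono repfun.scale[OF mono, of 0] by (cases i) (simp_all add: mono_coeff_0_0)
    next
      case (Suc n)
      show ?case
      proof (cases i)
        case 0
        then show ?thesis using repfun_entry[OF Suc[of 0], of 2 2] by (simp add: mono_coeff_Suc2 mult_ac)
      next
        case (Suc k)
        then show ?thesis
          using repfun.add[OF repfun_entry[OF Suc.IH[of "Suc k"], of 2 2] repfun_entry[OF Suc.IH[of k], of 1 2]]
          by (simp add: mono_coeff_Suc2 algebra_simps)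
      qed
    qed
  next
    case (Suc j)
    show ?case
    proof (cases i)
      case 0
      then show ?thesis using repfun_entry[OF Suc[of 0], of 2 1] by (simp add: mono_coeff_Suc1 mult_ac)
    next
      case (Suc k)
      then show ?thesis
        using repfun.add[OF repfun_entry[OF Suc.IH[of "Suc k"], of 2 1] repfun_entry[OF Suc.IH[of k], of 1 1]]
        by (simp add: mono_coeff_Suc1 algebra_simps)
    qed
  qed
next
  case (add f f')
  then show ?case using repfun.add by (fastforce simp: distrib_right)
next
  case (scale f c)
  then show ?case using repfun.scale[of "\<lambda>g. f g * h g" c] by (simp add: mult.assoc)
next
  case (cong f f')
  then show ?case using repfun.cong[of "\<lambda>g. f g * h g"] by simp
qed

lemma repfun_const: "repfun (\<lambda>g. c)"
  using repfun.scale[OF repfun.mono[of 0 0 0], of c] by (simp add: mono_coeff_0_0)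

lemma repfun_cheb:
  assumes "g \<in> SU2"
  shows "repfun (\<lambda>h. of_real (cheb k (rtr (h ** g))))"
proof -
  have "repfun (\<lambda>h. \<Sum>j\<le>k. \<Sum>l\<le>k. mono_coeff j l (k - l) h * mono_coeff l j (k - j) g)"
    by (intro repfun_sum) (auto simp: mult.commute[of _ "mono_coeff _ _ _ g"] intro: repfun.intros)
  moreover have "of_real (cheb k (rtr (h ** g))) =
      (\<Sum>j\<le>k. \<Sum>l\<le>k. mono_coeff j l (k - l) h * mono_coeff l j (k - j) g)" if "h \<in> SU2" for h
    unfolding trace_mono_coeff_rtr[OF SU2_mult[OF that assms], symmetric] mono_coeff_mult
    by (intro sum.cong) auto
  ultimately show ?thesis by (rule repfun.cong)
qed

section \<open>Haar integrals of representative functions\<close>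

locale haar_SU2 =
  fixes \<mu> :: "(complex^2^2) measure"
  assumes haar: "normalized_haar_SU2 \<mu>"
begin

lemma sets_haar: "sets \<mu> = sets (restrict_space borel SU2)"
  using haar by (simp add: normalized_haar_SU2_def)

lemma space_haar: "space \<mu> = SU2"
  using sets_eq_imp_space_eq[OF sets_haar] by (simp add: space_restrict_space)

lemma finite_measure_haar: "finite_measure \<mu>"
  using haar by (intro finite_measureI) (simp add: normalized_haar_SU2_def)

sublocale finite_measure \<mu> by (rule finite_measure_haar)

lemma measure_haar: "measure \<mu> SU2 = 1" "measure \<mu> (space \<mu>) = 1"
  using haar by (simp_all add: normalized_haar_SU2_def measure_def space_haar)

lemma borel_measurable_haar: "continuous_on SU2 f \<Longrightarrow> f \<in> borel_measurable \<mu>"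
  using borel_measurable_continuous_on_restrict measurable_cong_sets[OF sets_haar refl] by blast

lemma borel_measurable_repfun: "repfun f \<Longrightarrow> f \<in> borel_measurable \<mu>"
  by (intro borel_measurable_haar continuous_on_repfun)

lemma integrable_bounded:
  fixes f :: "complex^2^2 \<Rightarrow> 'b::{banach, second_countable_topology}"
  assumes "f \<in> borel_measurable \<mu>" "\<And>g. g \<in> SU2 \<Longrightarrow> norm (f g) \<le> B"
  shows "integrable \<mu> f"
  using assms by (intro integrable_const_bound[where B = B]) (auto simp: space_haar)

lemma integrable_repfun: "repfun f \<Longrightarrow> integrable \<mu> f"
  using repfun_bounded integrable_bounded borel_measurable_repfun by metis

lemma measurable_translate: "g \<in> SU2 \<Longrightarrow> (\<lambda>h. g ** h) \<in> measurable \<mu> \<mu>"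
proof -
  assume g: "g \<in> SU2"
  have "continuous_on SU2 (\<lambda>h. g ** h)"
    unfolding matrix_matrix_mult_def by (intro continuous_intros)
  then have "(\<lambda>h. g ** h) \<in> measurable \<mu> (restrict_space borel SU2)"
    by (intro measurable_restrict_space2 borel_measurable_haar) (auto simp: space_haar SU2_mult g)
  then show ?thesis using measurable_cong_sets[OF refl sets_haar] by blast
qed

lemma integral_translate:
  fixes f :: "complex^2^2 \<Rightarrow> 'b::{banach, second_countable_topology}"
  assumes "g \<in> SU2" "f \<in> borel_measurable \<mu>"
  shows "(LINT h|\<mu>. f (g ** h)) = (LINT h|\<mu>. f h)"
proof -
  have "distr \<mu> \<mu> (\<lambda>h. g ** h) = \<mu>"
    using haar assms by (simp add: normalized_haar_SU2_def)
  then show ?thesis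
    using integral_distr[OF measurable_translate[OF assms(1)] assms(2)] by metis
qed

text \<open>By left invariance the vector of integrals is fixed by the representation. The torus
  kills every component except the one of weight zero, and row 0 of the equation at
  \<open>su2_rot\<close> kills that one too.\<close>

lemma integral_mono_coeff:
  "(LINT g|\<mu>. mono_coeff i j n g) = (if i = 0 \<and> j = 0 \<and> n = 0 then 1 else 0)"
proof (cases "j + n = 0")
  case True
  then show ?thesis by (simp add: mono_coeff_0_0 measure_haar)
next
  case False
  define k where "k = j + n"
  define v where "v i = (LINT g|\<mu>. mono_coeff i j n g)" for i
  have inv: "v i = (\<Sum>l\<le>k. mono_coeff i l (k - l) g * v l)" if "g \<in> SU2" for i g
  proof -
    have "v i = (LINT h|\<mu>. mono_coeff i j n (g ** h))"
      using integral_translate[OF that borel_measurable_repfun[OF repfun.mono]] by (simp add: v_def)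
    also have "\<dots> = (\<Sum>l\<le>k. mono_coeff i l (k - l) g * v l)"
      unfolding mono_coeff_mult k_def v_def
      by (subst Bochner_Integration.integral_sum) (auto intro: integrable_repfun repfun.intros)
    finally show ?thesis .
  qed
  have diag: "v i = cis ((real i - real (k - i)) * t) * v i" if "i \<le> k" for i t
    using inv[OF su2_diag_SU2, of i t] that by (simp add: mono_coeff_diag if_distrib if_distribR cong: if_cong)
  have off: "v i = 0" if "i \<le> k" "2 * i \<noteq> k" for i
  proof -
    have "real i - real (k - i) \<noteq> 0" using that by (simp add: of_nat_diff)
    \<comment> \<open>This angle turns the weight factor into -1.\<close>
    then have "v i = cis pi * v i"
      using diag[OF that(1), of "pi / (real i - real (k - i))"] by simp
    then show ?thesis by simp
  qed
  have "v i = 0" if "i \<le> k" for i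
  proof (cases "2 * i = k")
    case True
    \<comment> \<open>As k > 0, index 0 is not the middle one, so \<open>v 0\<close> is already
      known to vanish; its row equation leaves a nonzero multiple of the middle component.\<close>
    have "0 = v 0" using off[of 0] False by (simp add: k_def)
    also have "v 0 = mono_coeff 0 i (k - i) su2_rot * v i"
      unfolding inv[OF su2_rot_SU2, of 0]
      by (subst sum.remove[of _ i]) (use that True off in \<open>auto intro!: sum.neutral\<close>)
    finally show ?thesis by (simp add: mono_coeff_0 su2_rot_def)
  qed (use off that in blast)
  moreover have "v i = 0" if "i > k" for i
    using that by (simp add: v_def k_def mono_coeff_gt)
  ultimately have "v i = 0" by (meson not_le)
  then show ?thesis using False by (auto simp: v_def)
qed

text \<open>Haar measure is introduced by left invariance alone. On representative functions right
  invariance follows because the integrals of all coefficients are known.\<close>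

lemma integral_right_translate:
  assumes "repfun f" "g \<in> SU2"
  shows "(LINT h|\<mu>. f (h ** g)) = (LINT h|\<mu>. f h) \<and> integrable \<mu> (\<lambda>h. f (h ** g))"
  using assms(1)
proof (induction rule: repfun.induct)
  case (mono i j n)
  have int: "integrable \<mu> (\<lambda>h. mono_coeff i l (j + n - l) h * mono_coeff l j n g)" for l
    using integrable_repfun[OF repfun.mono] by simp
  have "(LINT h|\<mu>. mono_coeff i j n (h ** g)) =
      (\<Sum>l\<le>j+n. (LINT h|\<mu>. mono_coeff i l (j + n - l) h) * mono_coeff l j n g)"
    unfolding mono_coeff_mult by (subst Bochner_Integration.integral_sum) (use int in auto)
  also have "\<dots> = (LINT h|\<mu>. mono_coeff i j n h)"
    unfolding integral_mono_coeff by (cases "j + n = 0") (auto simp: mono_coeff_0_0 intro!: sum.neutral)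
  finally show ?case unfolding mono_coeff_mult using int by auto
next
  case (add f h)
  then show ?case using integrable_repfun by (simp add: Bochner_Integration.integral_add)
next
  case (cong f h)
  have "(LINT k|\<mu>. h (k ** g)) = (LINT k|\<mu>. f (k ** g))" "(LINT k|\<mu>. h k) = (LINT k|\<mu>. f k)"
    by (intro Bochner_Integration.integral_cong refl; use cong SU2_mult assms in \<open>simp add: space_haar\<close>)+
  moreover have "integrable \<mu> (\<lambda>k. h (k ** g)) = integrable \<mu> (\<lambda>k. f (k ** g))"
    by (intro Bochner_Integration.integrable_cong refl) (use cong SU2_mult assms in \<open>simp add: space_haar\<close>)
  ultimately show ?case using cong by simp
qed simp

end

section \<open>Characters and kernels\<close>

text \<open>Summation by parts with t U_k = U_(k+1) + U_(k-1). Shifting \<open>c\<close> by one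
  makes \<open>c 0\<close> = 0 absorb the lower boundary, so only the terms at the upper end
  remain.\<close>

lemma cheb_sum_mult_poisson:
  fixes \<rho> t :: real and c :: "nat \<Rightarrow> real"
  assumes "c 0 = 0"
  shows "(\<Sum>k\<le>m. ((1 + \<rho>\<^sup>2) * c (k + 1) - \<rho> * (c k + c (k + 2))) * cheb k t) =
    (1 - \<rho> * t + \<rho>\<^sup>2) * (\<Sum>k\<le>m. c (k + 1) * cheb k t)
      + \<rho> * (c (m + 1) * cheb (m + 1) t - c (m + 2) * cheb m t)"
proof (induction m)
  case (Suc m)
  show ?case unfolding sum.atMost_Suc Suc by (simp add: algebra_simps)
qed (use assms in \<open>simp add: algebra_simps\<close>)

lemma poisson_denom_ge:
  fixes \<rho> t :: real
  assumes "0 \<le> \<rho>" "\<bar>t\<bar> \<le> 2"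
  shows "(1 - \<rho>)\<^sup>2 \<le> 1 - \<rho> * t + \<rho>\<^sup>2"
proof -
  have "\<rho> * t \<le> \<rho> * 2" using assms by (intro mult_left_mono) auto
  then show ?thesis by (simp add: power2_eq_square algebra_simps)
qed

text \<open>Comparison with \<Sum> (k + 1) \<rho>^k gives convergence, and the recurrence becomes a
  linear equation for the sum. The uniform bound on partial sums serves dominated convergence
  below.\<close>

lemma poisson_sums:
  fixes \<rho> t :: real
  assumes "0 \<le> \<rho>" "\<rho> < 1" "\<bar>t\<bar> \<le> 2"
  shows "(\<lambda>k. \<rho> ^ k * cheb k t) sums (1 / (1 - \<rho> * t + \<rho>\<^sup>2))"
    and "\<bar>\<Sum>k<m. \<rho> ^ k * cheb k t\<bar> \<le> 1 / (1 - \<rho>)\<^sup>2"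
proof -
  have g: "(\<lambda>k. real (Suc k) * \<rho> ^ k) sums (1 / (1 - \<rho>)\<^sup>2)"
    using assms by (intro geometric_deriv_sums) auto
  have le: "norm (\<rho> ^ k * cheb k t) \<le> real (Suc k) * \<rho> ^ k" for k
    using abs_cheb_le[OF assms(3), of k] assms(1)
    by (simp add: abs_mult mult.commute[of "\<rho> ^ k"] mult_right_mono)
  have sm: "summable (\<lambda>k. \<rho> ^ k * cheb k t)"
    by (rule summable_comparison_test'[OF sums_summable[OF g], of 0]) (use le in simp)
  have w: "1 - \<rho> * t + \<rho>\<^sup>2 > 0"
    using poisson_denom_ge[OF assms(1,3)] assms(2) zero_less_power2[of "1 - \<rho>"] by linarith
  define s where "s = (\<Sum>k. \<rho> ^ k * cheb k t)"
  have s: "(\<lambda>k. \<rho> ^ k * cheb k t) sums s"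
    using sm by (simp add: s_def summable_sums)
  have s1: "(\<lambda>k. \<rho> ^ Suc k * cheb (Suc k) t) sums (s - 1)"
    using s by (subst sums_Suc_iff) simp
  have "(\<lambda>k. \<rho> ^ Suc (Suc k) * cheb (Suc (Suc k)) t) sums (s - 1 - \<rho> * t)"
    using sums_Suc_iff[of "\<lambda>k. \<rho> ^ Suc k * cheb (Suc k) t"] s1 by simp
  moreover have "(\<lambda>k. \<rho> * t * (\<rho> ^ Suc k * cheb (Suc k) t) - \<rho>\<^sup>2 * (\<rho> ^ k * cheb k t)) sums
      (\<rho> * t * (s - 1) - \<rho>\<^sup>2 * s)"
    by (intro sums_diff sums_mult s1 s)
  moreover have "\<rho> * t * (\<rho> ^ Suc k * cheb (Suc k) t) - \<rho>\<^sup>2 * (\<rho> ^ k * cheb k t) =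
      \<rho> ^ Suc (Suc k) * cheb (Suc (Suc k)) t" for k
    by (simp add: power2_eq_square algebra_simps)
  ultimately have "s - 1 - \<rho> * t = \<rho> * t * (s - 1) - \<rho>\<^sup>2 * s"
    by (simp only: sums_unique2)
  then have "s = 1 / (1 - \<rho> * t + \<rho>\<^sup>2)"
    using w by (simp add: field_simps)
  with s show "(\<lambda>k. \<rho> ^ k * cheb k t) sums (1 / (1 - \<rho> * t + \<rho>\<^sup>2))" by simp
  have "\<bar>\<Sum>k<m. \<rho> ^ k * cheb k t\<bar> \<le> (\<Sum>k<m. real (Suc k) * \<rho> ^ k)"
    using le by (intro order_trans[OF sum_abs] sum_mono) simp
  also have "\<dots> \<le> 1 / (1 - \<rho>)\<^sup>2"
    using sum_le_suminf[OF sums_summable[OF g], of "{..<m}"] sums_unique[OF g] assms(1) by simp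
  finally show "\<bar>\<Sum>k<m. \<rho> ^ k * cheb k t\<bar> \<le> 1 / (1 - \<rho>)\<^sup>2" .
qed

lemma continuous_on_rtr: "continuous_on S rtr"
  unfolding rtr_def[abs_def] by (intro continuous_intros)

lemma continuous_on_cheb_rtr: "continuous_on S (\<lambda>g. cheb k (rtr g))"
  by (rule continuous_on_compose2[OF continuous_on_cheb continuous_on_rtr]) auto

context haar_SU2
begin

lemma borel_measurable_cheb_rtr [measurable]: "(\<lambda>g. cheb k (rtr g)) \<in> borel_measurable \<mu>"
  by (rule borel_measurable_haar[OF continuous_on_cheb_rtr])

lemma borel_measurable_rtr [measurable]: "rtr \<in> borel_measurable \<mu>"
  by (rule borel_measurable_haar[OF continuous_on_rtr])

lemma integrable_cheb_sums:
  "integrable \<mu> (\<lambda>g. \<Sum>k<m. d k * cheb k (rtr g))"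
proof (intro Bochner_Integration.integrable_sum Bochner_Integration.integrable_mult_right)
  fix k show "integrable \<mu> (\<lambda>g. cheb k (rtr g))"
    using abs_cheb_le[OF abs_rtr_le] by (intro integrable_bounded[where B = "real k + 1"]) auto
qed

lemma integrable_cheb_cheb: "integrable \<mu> (\<lambda>g. cheb k (rtr g) * cheb l (rtr g))"
proof (rule integrable_bounded[where B = "(real k + 1) * (real l + 1)"])
  fix g assume "g \<in> SU2"
  then show "norm (cheb k (rtr g) * cheb l (rtr g)) \<le> (real k + 1) * (real l + 1)"
    using abs_cheb_le[OF abs_rtr_le] unfolding real_norm_def abs_mult by (intro mult_mono) auto
qed measurable

lemma integral_cheb: "(LINT g|\<mu>. cheb k (rtr g)) = (if k = 0 then 1 else 0)"
proof -
  have "complex_of_real (LINT g|\<mu>. cheb k (rtr g)) = (LINT g|\<mu>. (\<Sum>j\<le>k. mono_coeff j j (k - j) g))"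
    unfolding integral_complex_of_real[symmetric]
    by (intro Bochner_Integration.integral_cong refl) (simp add: space_haar trace_mono_coeff_rtr)
  also have "\<dots> = (\<Sum>j\<le>k. LINT g|\<mu>. mono_coeff j j (k - j) g)"
    by (intro Bochner_Integration.integral_sum integrable_repfun repfun.mono)
  also have "\<dots> = of_real (if k = 0 then 1 else 0)"
    unfolding integral_mono_coeff by (cases "k = 0") (auto intro!: sum.neutral)
  finally have "complex_of_real (LINT g|\<mu>. cheb k (rtr g)) = of_real (if k = 0 then 1 else 0)" .
  then show ?thesis by (simp only: of_real_eq_iff)
qed

text \<open>Orthonormality of the characters follows from \<open>integral_cheb\<close> alone: the
  recurrence moves a factor t from one character to the other and so lowers
  \<open>l\<close>.\<close>

lemma integral_cheb_cheb: "(LINT g|\<mu>. cheb k (rtr g) * cheb l (rtr g)) = (if k = l then 1 else 0)"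
proof (induction l arbitrary: k rule: induct_nat_012)
  case 0
  show ?case by (simp add: integral_cheb)
next
  case 1
  show ?case
  proof (cases k)
    case (Suc k')
    have "cheb k t * cheb (Suc 0) t = cheb (Suc (Suc k')) t * cheb 0 t + cheb k' t * cheb 0 t" for t :: real
      by (simp add: Suc mult.commute)
    then show ?thesis
      using Suc integrable_cheb_cheb[of "Suc (Suc k')" 0] integrable_cheb_cheb[of k' 0]
      by (simp add: integral_cheb del: cheb.simps(3))
  qed (use integral_cheb[of "Suc 0"] in simp)
next
  case (ge2 l)
  show ?case
  proof (cases k)
    case 0
    have "cheb k t * cheb (Suc (Suc l)) t = cheb (Suc 0) t * cheb (Suc l) t - cheb 0 t * cheb l t" for t :: real
      by (simp add: 0)
    then show ?thesis using 0 integrable_cheb_cheb by (simp only: Bochner_Integration.integral_diff ge2) simp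
  next
    case (Suc k')
    have "cheb k t * cheb (Suc (Suc l)) t =
        cheb (Suc (Suc k')) t * cheb (Suc l) t + cheb k' t * cheb (Suc l) t - cheb k t * cheb l t" for t :: real
      by (simp add: Suc algebra_simps)
    then show ?thesis
      using Suc integrable_cheb_cheb
      by (simp only: Bochner_Integration.integral_diff Bochner_Integration.integral_add
          Bochner_Integration.integrable_add ge2) simp
  qed
qed

lemma integral_cheb_sum_square:
  "(LINT g|\<mu>. (\<Sum>k<m. d k * cheb k (rtr g))\<^sup>2) = (\<Sum>k<m. (d k)\<^sup>2)"
  "integrable \<mu> (\<lambda>g. (\<Sum>k<m. d k * cheb k (rtr g))\<^sup>2)"
proof -
  have e: "(\<Sum>k<m. d k * cheb k t)\<^sup>2 = (\<Sum>k<m. \<Sum>l<m. d k * d l * (cheb k t * cheb l t))" for t :: real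
    by (simp add: power2_eq_square sum_product mult_ac)
  show "integrable \<mu> (\<lambda>g. (\<Sum>k<m. d k * cheb k (rtr g))\<^sup>2)"
    unfolding e by (intro Bochner_Integration.integrable_sum integrable_mult_right integrable_cheb_cheb)
  have "(LINT g|\<mu>. (\<Sum>k<m. d k * cheb k (rtr g))\<^sup>2) =
      (\<Sum>k<m. \<Sum>l<m. d k * d l * (LINT g|\<mu>. cheb k (rtr g) * cheb l (rtr g)))"
    unfolding e by (simp add: Bochner_Integration.integral_sum integrable_cheb_cheb)
  also have "\<dots> = (\<Sum>k<m. (d k)\<^sup>2)"
    by (simp add: integral_cheb_cheb if_distrib power2_eq_square cong: if_cong)
  finally show "(LINT g|\<mu>. (\<Sum>k<m. d k * cheb k (rtr g))\<^sup>2) = (\<Sum>k<m. (d k)\<^sup>2)" .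
qed

text \<open>Parseval for the partial sums gives \<Sum> \<rho>^(2k), estimated by \<Sum> \<rho>^k;
  dominated convergence passes to the limit.\<close>

lemma integral_poisson_square:
  assumes "0 \<le> \<rho>" "\<rho> < 1"
  shows "(LINT g|\<mu>. (1 / (1 - \<rho> * rtr g + \<rho>\<^sup>2))\<^sup>2) \<le> 1 / (1 - \<rho>)"
    and "integrable \<mu> (\<lambda>g. (1 / (1 - \<rho> * rtr g + \<rho>\<^sup>2))\<^sup>2)"
proof -
  define s where "s m g = (\<Sum>k<m. \<rho> ^ k * cheb k (rtr g))\<^sup>2" for m g
  let ?f = "\<lambda>g. (1 / (1 - \<rho> * rtr g + \<rho>\<^sup>2))\<^sup>2"
  have conv: "AE g in \<mu>. (\<lambda>m. s m g) \<longlonglongrightarrow> ?f g"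
    unfolding s_def using poisson_sums(1)[OF assms abs_rtr_le]
    by (intro AE_I2 tendsto_power) (simp add: sums_def space_haar)
  have bound: "AE g in \<mu>. norm (s m g) \<le> (1 / (1 - \<rho>)\<^sup>2)\<^sup>2" for m
    unfolding s_def real_norm_def power_abs using poisson_sums(2)[OF assms abs_rtr_le]
    by (intro AE_I2 power_mono) (auto simp: space_haar)
  have meas: "s m \<in> borel_measurable \<mu>" "?f \<in> borel_measurable \<mu>" for m
    unfolding s_def by measurable
  have lim: "integrable \<mu> ?f" "(\<lambda>m. LINT g|\<mu>. s m g) \<longlonglongrightarrow> (LINT g|\<mu>. ?f g)"
    using integrable_dominated_convergence[OF meas(2,1) integrable_const conv bound]
      integral_dominated_convergence[OF meas(2,1) integrable_const conv bound] by auto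
  then show "integrable \<mu> ?f" by simp
  have "(LINT g|\<mu>. s m g) \<le> 1 / (1 - \<rho>)" for m
  proof -
    have "(LINT g|\<mu>. s m g) = (\<Sum>k<m. (\<rho> ^ k)\<^sup>2)"
      unfolding s_def by (rule integral_cheb_sum_square)
    also have "\<dots> \<le> (\<Sum>k<m. \<rho> ^ k)"
      using assms by (intro sum_mono) (simp add: power2_eq_square mult_left_le power_le_one)
    also have "\<dots> \<le> (\<Sum>k. \<rho> ^ k)"
      using assms by (intro sum_le_suminf summable_geometric) auto
    finally show ?thesis using assms by (simp add: suminf_geometric)
  qed
  then show "(LINT g|\<mu>. ?f g) \<le> 1 / (1 - \<rho>)"
    using LIMSEQ_le_const2[OF lim(2)] by blast
qed

text \<open>
  Writing the kernel \<open>F\<close> as \<open>(w F) w\<^sup>-\<^sup>1\<close> with \<open>w(t) = 1 - \<rho>t + \<rho>\<^sup>2\<close>, the Cauchy-Schwarz inequality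
  turns the \<open>L\<^sup>1\<close>-norm of \<open>F\<close> into two \<open>L\<^sup>2\<close>-norms. Multiplication by \<open>w\<close> acts on the Chebyshev
  coefficients as a second difference, and \<open>w\<^sup>-\<^sup>1\<close> is the generating function of the \<open>cheb k\<close>.
\<close>

lemma integral_abs_cheb_sum_le:
  fixes c :: "nat \<Rightarrow> real"
  assumes "N \<ge> 1" "D > 0" and c0: "c 0 = 0" and cN: "\<And>n. n \<ge> 2 * N \<Longrightarrow> c n = 0"
    and c: "\<And>n. 1 \<le> n \<Longrightarrow> n \<le> 2 * N \<Longrightarrow> \<bar>c n\<bar> \<le> (real N)\<^sup>2 * D"
    and d: "\<And>n. 1 \<le> n \<Longrightarrow> n \<le> 2 * N \<Longrightarrow> \<bar>2 * c n - c (n - 1) - c (n + 1)\<bar> \<le> D"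
  shows "(LINT g|\<mu>. \<bar>\<Sum>k<2*N. c (k + 1) * cheb k (rtr g)\<bar>) \<le> 5 * real N * D"
proof -
  \<comment> \<open>The weight is tuned to the scale N: (1 - \<rho>)^2 cancels the size N^2 D of the
    coefficients, while w^-1 has squared L^2 norm at most N.\<close>
  define \<rho> where "\<rho> = 1 - 1 / real N"
  have \<rho>: "0 \<le> \<rho>" "\<rho> < 1" "1 - \<rho> = 1 / real N" using \<open>N \<ge> 1\<close> by (auto simp: \<rho>_def field_simps)
  define w where "w t = 1 - \<rho> * t + \<rho>\<^sup>2" for t
  define a where "a k = (1 + \<rho>\<^sup>2) * c (k + 1) - \<rho> * (c k + c (k + 2))" for k
  define F where "F t = (\<Sum>k<2*N. c (k + 1) * cheb k t)" for t
  define G where "G t = (\<Sum>k<2*N. a k * cheb k t)" for t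
  have w: "w t > 0" if "\<bar>t\<bar> \<le> 2" for t
    using poisson_denom_ge[OF \<rho>(1) that] \<rho>(2) zero_less_power2[of "1 - \<rho>"] unfolding w_def by linarith
  \<comment> \<open>With m = 2 N - 1 the boundary terms contain \<open>c (2 * N)\<close> and
    \<open>c (2 * N + 1)\<close>, which vanish.\<close>
  have wF: "w t * F t = G t" for t
    using cheb_sum_mult_poisson[where c = c and m = "2 * N - 1" and \<rho> = \<rho> and t = t, OF c0] cN \<open>N \<ge> 1\<close>
    unfolding w_def F_def G_def a_def lessThan_Suc_atMost[symmetric] by simp
  have a: "(a k)\<^sup>2 \<le> 4 * D\<^sup>2" if "k < 2 * N" for k
  proof -
    \<comment> \<open>Separates the second difference of \<open>c\<close> from a remainder; each
      contributes at most D.\<close>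
    have "a k = (1 - \<rho>)\<^sup>2 * c (k + 1) + \<rho> * (2 * c (k + 1) - c k - c (k + 2))"
      by (simp add: a_def power2_eq_square algebra_simps)
    also have "\<bar>\<dots>\<bar> \<le> (1 - \<rho>)\<^sup>2 * ((real N)\<^sup>2 * D) + 1 * D"
    proof (intro order_trans[OF abs_triangle_ineq] add_mono)
      show "\<bar>(1 - \<rho>)\<^sup>2 * c (k + 1)\<bar> \<le> (1 - \<rho>)\<^sup>2 * ((real N)\<^sup>2 * D)"
        using c[of "k + 1"] that by (simp add: abs_mult mult_left_mono)
      show "\<bar>\<rho> * (2 * c (k + 1) - c k - c (k + 2))\<bar> \<le> 1 * D"
        unfolding abs_mult using d[of "k + 1"] that \<rho>(1,2) by (intro mult_mono) auto
    qed
    also have "\<dots> = 2 * D" using \<open>N \<ge> 1\<close> by (simp add: \<rho>(3) power2_eq_square)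
    finally show ?thesis using power_mono[of "\<bar>a k\<bar>" "2 * D" 2] by (simp add: power2_eq_square)
  qed
  have G2: "(LINT g|\<mu>. (G (rtr g))\<^sup>2) \<le> 8 * real N * D\<^sup>2"
    using sum_mono[of "{..<2*N}" "\<lambda>k. (a k)\<^sup>2" "\<lambda>_. 4 * D\<^sup>2"] a
    unfolding G_def integral_cheb_sum_square by simp
  have int: "integrable \<mu> (\<lambda>g. (G (rtr g))\<^sup>2)" "integrable \<mu> (\<lambda>g. (1 / w (rtr g))\<^sup>2)"
      "integrable \<mu> (\<lambda>g. \<bar>F (rtr g)\<bar>)"
    unfolding G_def w_def F_def
    by (intro integral_cheb_sum_square(2) integral_poisson_square(2) integrable_abs integrable_cheb_sums \<rho>)+
  have "(LINT g|\<mu>. \<bar>F (rtr g)\<bar>) \<le> (LINT g|\<mu>. (1 / (2 * D)) * (G (rtr g))\<^sup>2 + (D / 2) * (1 / w (rtr g))\<^sup>2)"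
  proof (rule integral_mono)
    fix g assume "g \<in> space \<mu>"
    then have pos: "w (rtr g) > 0" using w[OF abs_rtr_le] by (simp add: space_haar)
    define x y where "x = \<bar>G (rtr g)\<bar>" and "y = 1 / w (rtr g)"
    \<comment> \<open>Cauchy-Schwarz in the form of AM-GM. The weight D balances the integrals 8 N
      D^2 and N, giving 4 N D + N D / 2.\<close>
    have "0 \<le> (x - D * y)\<^sup>2 / (2 * D)" using \<open>D > 0\<close> by simp
    also have "\<dots> = x\<^sup>2 / (2 * D) + (D / 2) * y\<^sup>2 - x * y"
      using \<open>D > 0\<close> by (simp add: power2_eq_square field_simps)
    finally have "x * y \<le> x\<^sup>2 / (2 * D) + (D / 2) * y\<^sup>2" by simp
    moreover have "\<bar>F (rtr g)\<bar> = x * y"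
      using pos wF[of "rtr g", symmetric] by (simp add: x_def y_def abs_mult)
    ultimately show "\<bar>F (rtr g)\<bar> \<le> (1 / (2 * D)) * (G (rtr g))\<^sup>2 + (D / 2) * (1 / w (rtr g))\<^sup>2"
      by (simp add: x_def y_def)
  qed (intro int Bochner_Integration.integrable_add integrable_mult_right)+
  also have "\<dots> = (1 / (2 * D)) * (LINT g|\<mu>. (G (rtr g))\<^sup>2) + (D / 2) * (LINT g|\<mu>. (1 / w (rtr g))\<^sup>2)"
    using int by simp
  also have "\<dots> \<le> (1 / (2 * D)) * (8 * real N * D\<^sup>2) + (D / 2) * real N"
    using G2 integral_poisson_square(1)[OF \<rho>(1,2)] \<open>D > 0\<close> \<rho>(3)
    by (intro add_mono mult_left_mono) (auto simp: w_def)
  also have "\<dots> \<le> 5 * real N * D" using \<open>D > 0\<close> by (simp add: power2_eq_square field_simps)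
  finally show ?thesis by (simp add: F_def)
qed

text \<open>Schur's lemma by hand. The matrix \<open>C\<close> of integrals against a class function
  commutes with the representation, so it is scalar: the torus kills the off-diagonal entries and
  \<open>su2_rot\<close> equates the diagonal ones. Orthonormality of the characters then gives the
  trace.\<close>

lemma integral_cheb_mono_coeff:
  assumes x: "x \<in> SU2" and i: "i \<le> j + n"
  shows "(LINT y|\<mu>. of_real (cheb k (rtr (x ** su2_inv y))) * mono_coeff i j n y) =
    (if k = j + n then mono_coeff i j n x / of_nat (k + 1) else 0)"
proof -
  define p where "p = j + n"
  define T where "T i l = mono_coeff i l (p - l)" for i l
  define C where "C i l = (LINT z|\<mu>. of_real (cheb k (rtr z)) * T i l z)" for i l
  have T_mult: "T i l (g ** h) = (\<Sum>m\<le>p. T i m g * T m l h)" if "l \<le> p" for i l g h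
    using that by (simp add: T_def mono_coeff_mult)
  have rep1: "repfun (\<lambda>z. of_real (cheb k (rtr z)))"
    using repfun_cheb[of "mat 1" k] SU2_mult[OF su2_rot_SU2 SU2_su2_inv[OF su2_rot_SU2]]
    by (simp add: su2_inv_right[OF su2_rot_SU2])
  have int: "integrable \<mu> (\<lambda>z. of_real (cheb k (rtr z)) * T i l z)" for i l
    unfolding T_def by (intro integrable_repfun repfun_mult rep1 repfun.mono)
  have left: "(LINT z|\<mu>. of_real (cheb k (rtr z)) * T i l (g ** z)) = (\<Sum>m\<le>p. T i m g * C m l)"
    if "l \<le> p" for i l g
  proof -
    have "(LINT z|\<mu>. of_real (cheb k (rtr z)) * T i l (g ** z)) =
        (LINT z|\<mu>. (\<Sum>m\<le>p. T i m g * (of_real (cheb k (rtr z)) * T m l z)))"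
      unfolding T_mult[OF that] by (simp add: sum_distrib_left mult_ac)
    also have "\<dots> = (\<Sum>m\<le>p. T i m g * C m l)"
      unfolding C_def using int by (subst Bochner_Integration.integral_sum) auto
    finally show ?thesis .
  qed
  have right: "(LINT z|\<mu>. of_real (cheb k (rtr z)) * T i l (z ** g)) = (\<Sum>m\<le>p. C i m * T m l g)"
    if "l \<le> p" for i l g
  proof -
    have "(LINT z|\<mu>. of_real (cheb k (rtr z)) * T i l (z ** g)) =
        (LINT z|\<mu>. (\<Sum>m\<le>p. (of_real (cheb k (rtr z)) * T i m z) * T m l g))"
      unfolding T_mult[OF that] by (simp add: sum_distrib_left mult_ac)
    also have "\<dots> = (\<Sum>m\<le>p. C i m * T m l g)"
      unfolding C_def using int by (subst Bochner_Integration.integral_sum) auto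
    finally show ?thesis .
  qed
  have translate: "(LINT y|\<mu>. of_real (cheb k (rtr (g ** su2_inv y))) * T i l y) =
      (LINT z|\<mu>. of_real (cheb k (rtr z)) * T i l (g ** z))"
    "(LINT z|\<mu>. of_real (cheb k (rtr z)) * T i l (z ** g)) =
      (LINT z|\<mu>. of_real (cheb k (rtr z)) * T i l (g ** z))" if g: "g \<in> SU2" for i l g
  proof -
    \<comment> \<open>The substitutions y = g z and y = z g in the integral of \<open>H\<close>
      produce the two sides; the character is unchanged because it is conjugation invariant.\<close>
    define H where "H y = of_real (cheb k (rtr (y ** su2_inv g))) * T i l y" for y
    have H: "repfun H" unfolding H_def[abs_def] T_def
      by (intro repfun_mult repfun_cheb SU2_su2_inv g repfun.mono)
    have e: "rtr (g ** su2_inv y) = rtr (y ** su2_inv g)" for y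
      by (metis rtr_mult_su2_inv rtr_mult_commute)
    have "(g ** z) ** su2_inv g = g ** (z ** su2_inv g)" for z by (simp add: matrix_mul_assoc)
    moreover have "(z ** su2_inv g) ** g = z" for z
      using su2_inv_left[OF g] by (metis matrix_mul_assoc matrix_mul_rid)
    ultimately have 1: "rtr ((g ** z) ** su2_inv g) = rtr z" for z
      by (metis rtr_mult_commute)
    have 2: "(z ** g) ** su2_inv g = z" for z
      using su2_inv_right[OF g] by (metis matrix_mul_assoc matrix_mul_rid)
    show "(LINT y|\<mu>. of_real (cheb k (rtr (g ** su2_inv y))) * T i l y) =
      (LINT z|\<mu>. of_real (cheb k (rtr z)) * T i l (g ** z))"
      using integral_translate[OF g borel_measurable_repfun[OF H]] by (simp add: H_def e 1)
    show "(LINT z|\<mu>. of_real (cheb k (rtr z)) * T i l (z ** g)) =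
      (LINT z|\<mu>. of_real (cheb k (rtr z)) * T i l (g ** z))"
      using integral_translate[OF g borel_measurable_repfun[OF H]] integral_right_translate[OF H g]
      by (simp add: H_def 1 2)
  qed
  have comm: "(\<Sum>m\<le>p. T i m g * C m l) = (\<Sum>m\<le>p. C i m * T m l g)" if "g \<in> SU2" "l \<le> p" for i l g
    unfolding left[OF that(2), symmetric] right[OF that(2), symmetric] translate(2)[OF that(1)] ..
  have off: "C i l = 0" if "i \<le> p" "l \<le> p" "i \<noteq> l" for i l
  proof -
    have diag: "T a b (su2_diag t) = (if a = b then cis ((real b - real (p - b)) * t) else 0)" for a b t
      by (simp add: T_def mono_coeff_diag)
    \<comment> \<open>For this angle the two weight factors differ by cis \<pi> = -1.\<close>
    define t where "t = pi / (2 * (real i - real l))"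
    have "cis ((real i - real (p - i)) * t) * C i l = C i l * cis ((real l - real (p - l)) * t)"
      using comm[OF su2_diag_SU2 that(2), of i t] that(1,2)
      by (simp add: diag if_distrib if_distribR cong: if_cong)
    moreover have "(real i - real (p - i)) * t = (real l - real (p - l)) * t + 2 * (real i - real l) * t"
      using that by (simp add: of_nat_diff algebra_simps)
    moreover have "2 * (real i - real l) * t = pi" using that(3) by (simp add: t_def)
    ultimately have "- (cis ((real l - real (p - l)) * t) * C i l) = C i l * cis ((real l - real (p - l)) * t)"
      by (simp flip: cis_mult)
    then show ?thesis by (simp add: mult.commute)
  qed
  \<comment> \<open>Row 0 of the commutation relation at \<open>su2_rot\<close>, where a common
    nonzero entry cancels.\<close>
  have C_diag: "C l l = C 0 0" if "l \<le> p" for l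
  proof -
    have "(\<Sum>m\<le>p. T 0 m su2_rot * C m l) = T 0 l su2_rot * C l l"
      by (subst sum.remove[of _ l]) (use that off in \<open>auto intro!: sum.neutral\<close>)
    moreover have "(\<Sum>m\<le>p. C 0 m * T m l su2_rot) = C 0 0 * T 0 l su2_rot"
      by (subst sum.remove[of _ 0]) (use that off in \<open>auto intro!: sum.neutral\<close>)
    moreover have "T 0 l su2_rot \<noteq> 0"
      by (simp add: T_def mono_coeff_0 su2_rot_def)
    ultimately show ?thesis using comm[OF su2_rot_SU2 that, of 0] by simp
  qed
  have "(\<Sum>l\<le>p. C l l) = (\<Sum>l\<le>p. C 0 0)" by (intro sum.cong refl C_diag) simp
  then have "of_nat (p + 1) * C 0 0 = (\<Sum>l\<le>p. C l l)" by simp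
  also have "\<dots> = (LINT z|\<mu>. (\<Sum>l\<le>p. of_real (cheb k (rtr z)) * T l l z))"
    unfolding C_def using int by (subst Bochner_Integration.integral_sum) auto
  also have "\<dots> = (LINT z|\<mu>. complex_of_real (cheb k (rtr z) * cheb p (rtr z)))"
    by (intro Bochner_Integration.integral_cong refl)
      (simp add: space_haar T_def sum_distrib_left[symmetric] trace_mono_coeff_rtr)
  also have "\<dots> = of_real (if k = p then 1 else 0)"
    unfolding integral_complex_of_real integral_cheb_cheb ..
  finally have C00: "C 0 0 = (if k = p then 1 / of_nat (p + 1) else 0)"
    by (auto simp: field_simps simp del: of_nat_add of_nat_Suc split: if_splits)
  have "(LINT y|\<mu>. of_real (cheb k (rtr (x ** su2_inv y))) * mono_coeff i j n y) =
      (LINT y|\<mu>. of_real (cheb k (rtr (x ** su2_inv y))) * T i j y)"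
    by (simp add: T_def p_def)
  also have "\<dots> = (\<Sum>m\<le>p. T i m x * C m j)"
    unfolding translate(1)[OF x] by (rule left) (simp add: p_def)
  also have "\<dots> = T i j x * C 0 0"
    using off[of _ j] C_diag[of j] by (subst sum.remove[of _ j]) (auto simp: p_def intro!: sum.neutral)
  finally show ?thesis by (simp add: C00 T_def p_def)
qed

end

section \<open>Lebesgue spaces of a unit measure\<close>

text \<open>The supporting line at \<open>a\<close>, read off from Young's inequality with the
  conjugate exponent p / (p - 1).\<close>

lemma powr_ge_tangent:
  fixes a b p :: real
  assumes "a > 0" "b \<ge> 0" "p \<ge> 1"
  shows "a powr p + p * a powr (p - 1) * (b - a) \<le> b powr p"
proof (cases "p = 1")
  case False
  then have p: "p > 1" using assms by simp
  define q where "q = p / (p - 1)"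
  have q: "q > 1" "1 / p + 1 / q = 1" "(p - 1) * q = p" using p by (simp_all add: q_def field_simps)
  have "b * a powr (p - 1) \<le> b powr p / p + (a powr (p - 1)) powr q / q"
    using assms p q by (intro Youngs_inequality) auto
  also have "(a powr (p - 1)) powr q = a powr p" by (simp add: powr_powr q)
  finally have "p * (b * a powr (p - 1)) \<le> p * (b powr p / p + a powr p / q)"
    using p by (intro mult_left_mono) auto
  also have "\<dots> = b powr p + a powr p * (p - 1)" using p by (simp add: q_def field_simps)
  finally have "p * (b * a powr (p - 1)) \<le> b powr p + a powr p * (p - 1)" .
  moreover have "a powr p = a powr (p - 1) * a" using assms by (simp add: powr_diff)
  ultimately show ?thesis by (simp add: algebra_simps)
qed (use assms in simp)

lemma powr_convex_combination:
  fixes s t u v p :: real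
  assumes "p \<ge> 1" "s \<ge> 0" "t \<ge> 0" "u \<ge> 0" "v \<ge> 0" "u + v = 1"
  shows "(u * s + v * t) powr p \<le> u * s powr p + v * t powr p"
proof -
  define z where "z = u * s + v * t"
  show ?thesis
  proof (cases "z = 0")
    case False
    then have z: "z > 0" using assms by (simp add: z_def less_le)
    have "u * (z powr p + p * z powr (p - 1) * (s - z)) + v * (z powr p + p * z powr (p - 1) * (t - z))
        \<le> u * s powr p + v * t powr p"
      using assms z by (intro add_mono mult_left_mono powr_ge_tangent) auto
    moreover have "u * (z powr p + p * z powr (p - 1) * (s - z)) + v * (z powr p + p * z powr (p - 1) * (t - z))
        = (u + v) * z powr p + p * z powr (p - 1) * (z - (u + v) * z)"
      by (simp add: z_def algebra_simps)
    ultimately show ?thesis by (simp add: assms(6) z_def)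
  qed (use assms in \<open>simp add: z_def[symmetric]\<close>)
qed

text \<open>Integrate the supporting line at a = I / L against \<open>K\<close>. The mass of
  \<open>K\<close> may be smaller than \<open>L\<close>: it is multiplied by (1 - p) a^p, which is
  not positive, so the inequality keeps its direction.\<close>

lemma integral_powr_jensen:
  fixes K b :: "'a \<Rightarrow> real"
  assumes "p \<ge> 1" and "integrable M K" "integrable M (\<lambda>x. K x * b x)" "integrable M (\<lambda>x. K x * b x powr p)"
    and pos: "\<And>x. x \<in> space M \<Longrightarrow> K x \<ge> 0" "\<And>x. x \<in> space M \<Longrightarrow> b x \<ge> 0"
    and L: "integral\<^sup>L M K \<le> L" "L > 0"
  shows "(LINT x|M. K x * b x) powr p \<le> L powr (p - 1) * (LINT x|M. K x * b x powr p)"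
proof -
  define I where "I = (LINT x|M. K x * b x)"
  have I0: "I \<ge> 0" unfolding I_def by (intro integral_nonneg_AE AE_I2) (simp add: pos)
  have J0: "(LINT x|M. K x * b x powr p) \<ge> 0" by (intro integral_nonneg_AE AE_I2) (simp add: pos)
  show ?thesis
  proof (cases "I = 0")
    case True
    then show ?thesis using J0 L \<open>p \<ge> 1\<close> by (simp add: I_def[symmetric])
  next
    case False
    define a where "a = I / L"
    have a: "a > 0" "a * L = I" using False I0 L by (simp_all add: a_def)
    have "I * a powr (p - 1) = a powr p * L"
      using a(1) unfolding a(2)[symmetric] by (simp add: powr_diff)
    have "a powr p * L \<le> (1 - p) * (a powr p * integral\<^sup>L M K) + p * a powr (p - 1) * I"
    proof -
      have "(1 - p) * (a powr p * L) \<le> (1 - p) * (a powr p * integral\<^sup>L M K)"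
        using L \<open>p \<ge> 1\<close> by (intro mult_left_mono_neg mult_left_mono) auto
      moreover have "p * a powr (p - 1) * I = p * (a powr p * L)"
        using \<open>I * a powr (p - 1) = a powr p * L\<close> by (simp add: mult.commute)
      ultimately show ?thesis by (simp only:) (simp add: algebra_simps)
    qed
    also have "\<dots> = (LINT x|M. (1 - p) * a powr p * K x + p * a powr (p - 1) * (K x * b x))"
      using assms by (simp add: I_def)
    also have "\<dots> \<le> (LINT x|M. K x * b x powr p)"
    proof (rule integral_mono)
      fix x assume x: "x \<in> space M"
      have "a powr p = a powr (p - 1) * a" using a by (simp add: powr_diff)
      then have "K x * ((1 - p) * a powr p + p * a powr (p - 1) * b x) =
          K x * (a powr p + p * a powr (p - 1) * (b x - a))"
        by (simp add: algebra_simps)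
      also have "\<dots> \<le> K x * b x powr p"
        using powr_ge_tangent[OF a(1) pos(2)[OF x] \<open>p \<ge> 1\<close>] pos(1)[OF x] by (rule mult_left_mono)
      finally show "(1 - p) * a powr p * K x + p * a powr (p - 1) * (K x * b x) \<le> K x * b x powr p"
        by (simp add: algebra_simps)
    qed (use assms in \<open>auto intro!: Bochner_Integration.integrable_add integrable_mult_right\<close>)
    finally have "L powr (p - 1) * (a powr p * L) \<le> L powr (p - 1) * (LINT x|M. K x * b x powr p)"
      by (intro mult_left_mono) auto
    moreover have "L powr (p - 1) * (a powr p * L) = I powr p"
      using a L by (simp add: powr_diff powr_mult[symmetric] a_def)
    ultimately show ?thesis by (simp add: I_def)
  qed
qed

locale Lp_unit_measure = finite_measure M for M :: "'a measure" +
  fixes p :: real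
  assumes mass: "measure M (space M) = 1" and p: "p \<ge> 1"
begin

lemma Lp_measurable: "f \<in> Lp_space M p \<Longrightarrow> f \<in> borel_measurable M"
  by (simp add: Lp_space_def)

lemma Lp_integrable_powr: "f \<in> Lp_space M p \<Longrightarrow> integrable M (\<lambda>x. cmod (f x) powr p)"
  by (simp add: Lp_space_def)

lemma Lp_spaceI:
  assumes "f \<in> borel_measurable M" "integrable M h" "\<And>x. x \<in> space M \<Longrightarrow> cmod (f x) powr p \<le> h x"
  shows "f \<in> Lp_space M p"
  unfolding Lp_space_def using assms
  by (auto intro!: Bochner_Integration.integrable_bound[OF assms(2)] AE_I2)
    (metis order_trans norm_ge_zero powr_ge_zero abs_of_nonneg order.trans)

lemma Lp_integrable: "f \<in> Lp_space M p \<Longrightarrow> integrable M f"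
proof -
  assume f: "f \<in> Lp_space M p"
  have "cmod z \<le> 1 + cmod z powr p" for z
    using powr_mono[of 1 p "cmod z"] p by (cases "cmod z \<le> 1") (auto simp: add_increasing2 intro: add_increasing)
  then show ?thesis
    using Lp_measurable[OF f] Lp_integrable_powr[OF f]
    by (intro Bochner_Integration.integrable_bound[of M "\<lambda>x. 1 + cmod (f x) powr p" f]) (auto intro!: AE_I2)
qed

lemma Lp_norm_nonneg: "Lp_norm M p f \<ge> 0"
  by (simp add: Lp_norm_def)

lemma integral_powr_nonneg: "(LINT x|M. cmod (f x) powr p) \<ge> 0"
  by (intro integral_nonneg_AE AE_I2) simp

lemma Lp_norm_powr: "Lp_norm M p f powr p = (LINT x|M. cmod (f x) powr p)"
  using p integral_powr_nonneg[of f] by (simp add: Lp_norm_def powr_powr)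

lemma Lp_norm_le_iff: "a \<ge> 0 \<Longrightarrow> Lp_norm M p f \<le> a \<longleftrightarrow> (LINT x|M. cmod (f x) powr p) \<le> a powr p"
  using p Lp_norm_nonneg[of f] powr_mono2[of p "Lp_norm M p f" a] powr_less_mono2[of p a "Lp_norm M p f"]
  unfolding Lp_norm_powr[symmetric] by linarith

lemma Lp_norm_cong_AE:
  "f \<in> borel_measurable M \<Longrightarrow> g \<in> borel_measurable M \<Longrightarrow> AE x in M. f x = g x \<Longrightarrow> Lp_norm M p f = Lp_norm M p g"
  unfolding Lp_norm_def by (intro arg_cong[where f = "\<lambda>x. x powr _"] integral_cong_AE) auto

lemma Lp_norm_cong: "(\<And>x. x \<in> space M \<Longrightarrow> f x = g x) \<Longrightarrow> Lp_norm M p f = Lp_norm M p g"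
  unfolding Lp_norm_def by (intro arg_cong[where f = "\<lambda>x. x powr _"] Bochner_Integration.integral_cong) auto

lemma Lp_space_cong: "(\<And>x. x \<in> space M \<Longrightarrow> f x = g x) \<Longrightarrow> f \<in> Lp_space M p \<longleftrightarrow> g \<in> Lp_space M p"
  unfolding Lp_space_def mem_Collect_eq
  by (intro conj_cong measurable_cong Bochner_Integration.integrable_cong) auto

lemma Lp_norm_zero: "Lp_norm M p (\<lambda>x. 0) = 0"
  using p by (simp add: Lp_norm_def)

lemma Lp_scale: "f \<in> Lp_space M p \<Longrightarrow> (\<lambda>x. c * f x) \<in> Lp_space M p"
  by (auto simp: Lp_space_def norm_mult powr_mult)

lemma Lp_norm_scale: "Lp_norm M p (\<lambda>x. c * f x) = cmod c * Lp_norm M p f"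
  using p by (simp add: Lp_norm_def norm_mult powr_mult powr_powr integral_powr_nonneg)

lemma Lp_bounded:
  assumes "f \<in> borel_measurable M" "\<And>x. x \<in> space M \<Longrightarrow> cmod (f x) \<le> B"
  shows "f \<in> Lp_space M p" "Lp_norm M p f \<le> B"
proof -
  have "space M \<noteq> {}" using mass by auto
  then have B: "B \<ge> 0" using assms(2) norm_ge_zero order_trans by blast
  have le: "cmod (f x) powr p \<le> B powr p" if "x \<in> space M" for x
    using assms(2)[OF that] p by (intro powr_mono2) auto
  show "f \<in> Lp_space M p"
    using assms(1) le by (intro Lp_spaceI[of f "\<lambda>_. B powr p"]) auto
  have "(LINT x|M. cmod (f x) powr p) \<le> (LINT x|M. B powr p)"
    using le by (intro integral_mono') auto
  then show "Lp_norm M p f \<le> B" using mass by (simp add: Lp_norm_le_iff[OF B])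
qed

lemma Lp_add:
  assumes f: "f \<in> Lp_space M p" and g: "g \<in> Lp_space M p"
  shows "(\<lambda>x. f x + g x) \<in> Lp_space M p"
proof (rule Lp_spaceI[of _ "\<lambda>x. 2 powr p * (cmod (f x) powr p + cmod (g x) powr p)"])
  fix x
  have "cmod (f x + g x) powr p \<le> (2 * max (cmod (f x)) (cmod (g x))) powr p"
    using norm_triangle_ineq[of "f x" "g x"] p by (intro powr_mono2) auto
  also have "\<dots> = 2 powr p * max (cmod (f x)) (cmod (g x)) powr p" by (simp add: powr_mult)
  also have "\<dots> \<le> 2 powr p * (cmod (f x) powr p + cmod (g x) powr p)"
    by (intro mult_left_mono) (auto simp: max_def)
  finally show "cmod (f x + g x) powr p \<le> 2 powr p * (cmod (f x) powr p + cmod (g x) powr p)" .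
qed (use Lp_measurable[OF f] Lp_measurable[OF g] Lp_integrable_powr[OF f] Lp_integrable_powr[OF g] in auto)

lemma Lp_zero: "(\<lambda>x. 0) \<in> Lp_space M p"
  using p by (simp add: Lp_space_def)

lemma Lp_diff: "f \<in> Lp_space M p \<Longrightarrow> g \<in> Lp_space M p \<Longrightarrow> (\<lambda>x. f x - g x) \<in> Lp_space M p"
  using Lp_add[OF _ Lp_scale[of g "- 1"], of f] by simp

lemma Lp_sum: "finite I \<Longrightarrow> (\<And>i. i \<in> I \<Longrightarrow> f i \<in> Lp_space M p) \<Longrightarrow> (\<lambda>x. \<Sum>i\<in>I. f i x) \<in> Lp_space M p"
  by (induction I rule: finite_induct) (auto intro: Lp_add Lp_zero)

text \<open>Minkowski from convexity: (f + g) / (a + b) is a convex combination of f / a and g / b.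
  Positive slack in \<open>a\<close> and \<open>b\<close> covers functions of norm zero.\<close>

lemma Lp_norm_triangle:
  assumes f: "f \<in> Lp_space M p" and g: "g \<in> Lp_space M p"
  shows "Lp_norm M p (\<lambda>x. f x + g x) \<le> Lp_norm M p f + Lp_norm M p g"
proof -
  have *: "Lp_norm M p (\<lambda>x. f x + g x) \<le> a + b"
    if "a > 0" "b > 0" "Lp_norm M p f \<le> a" "Lp_norm M p g \<le> b" for a b
  proof -
    define u v where "u = a / (a + b)" and "v = b / (a + b)"
    have uv: "u \<ge> 0" "v \<ge> 0" "u + v = 1" using that by (simp_all add: u_def v_def add_divide_distrib[symmetric])
    have le: "cmod (f x + g x) powr p \<le>
        (a + b) powr p * (u / a powr p * cmod (f x) powr p + v / b powr p * cmod (g x) powr p)" for x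
    proof -
      define s t where "s = cmod (f x) / a" and "t = cmod (g x) / b"
      have st: "s \<ge> 0" "t \<ge> 0" using that by (simp_all add: s_def t_def)
      have "cmod (f x + g x) powr p \<le> ((a + b) * (u * s + v * t)) powr p"
      proof (intro powr_mono2)
        have "(a + b) * u = a" "(a + b) * v = b" using that by (simp_all add: u_def v_def)
        then have "(a + b) * (u * s + v * t) = a * s + b * t"
          unfolding distrib_left mult.assoc[symmetric] by (simp only:)
        also have "\<dots> = cmod (f x) + cmod (g x)" using that by (simp add: s_def t_def)
        finally show "cmod (f x + g x) \<le> (a + b) * (u * s + v * t)"
          using norm_triangle_ineq[of "f x" "g x"] by simp
      qed (use p in auto)
      also have "\<dots> = (a + b) powr p * (u * s + v * t) powr p"
        using that st uv by (simp add: powr_mult)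
      also have "\<dots> \<le> (a + b) powr p * (u * s powr p + v * t powr p)"
        using uv st p by (intro mult_left_mono powr_convex_combination) auto
      finally show ?thesis using that by (simp add: s_def t_def powr_divide)
    qed
    have "(LINT x|M. cmod (f x + g x) powr p) \<le>
        (LINT x|M. (a + b) powr p * (u / a powr p * cmod (f x) powr p + v / b powr p * cmod (g x) powr p))"
      using le order_trans[OF powr_ge_zero le] Lp_integrable_powr[OF f] Lp_integrable_powr[OF g]
      by (intro integral_mono') auto
    also have "\<dots> = (a + b) powr p * (u / a powr p * (LINT x|M. cmod (f x) powr p) + v / b powr p * (LINT x|M. cmod (g x) powr p))"
      using Lp_integrable_powr[OF f] Lp_integrable_powr[OF g] by simp
    also have "\<dots> \<le> (a + b) powr p * (u / a powr p * a powr p + v / b powr p * b powr p)"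
      using that uv Lp_norm_le_iff[of a f] Lp_norm_le_iff[of b g]
      by (intro mult_left_mono add_mono) auto
    also have "\<dots> = (a + b) powr p" using that uv by simp
    finally show ?thesis using that by (subst Lp_norm_le_iff) auto
  qed
  show ?thesis
  proof (rule field_le_epsilon)
    fix e :: real assume "e > 0"
    then show "Lp_norm M p (\<lambda>x. f x + g x) \<le> Lp_norm M p f + Lp_norm M p g + e"
      using *[of "Lp_norm M p f + e / 2" "Lp_norm M p g + e / 2"] Lp_norm_nonneg[of f] Lp_norm_nonneg[of g]
      by simp
  qed
qed

lemma Lp_norm_triangle_diff:
  assumes "f \<in> Lp_space M p" "g \<in> Lp_space M p" "h \<in> Lp_space M p"
  shows "Lp_norm M p (\<lambda>x. f x - h x) \<le> Lp_norm M p (\<lambda>x. f x - g x) + Lp_norm M p (\<lambda>x. g x - h x)"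
  using Lp_norm_triangle[of "\<lambda>x. f x - g x" "\<lambda>x. g x - h x"] assms by (simp add: Lp_diff)

lemma Lp_norm_sum:
  assumes "finite I" "\<And>i. i \<in> I \<Longrightarrow> f i \<in> Lp_space M p"
  shows "Lp_norm M p (\<lambda>x. \<Sum>i\<in>I. f i x) \<le> (\<Sum>i\<in>I. Lp_norm M p (f i))"
  using assms
proof (induction I rule: finite_induct)
  case (insert i I)
  have "Lp_norm M p (\<lambda>x. f i x + (\<Sum>i\<in>I. f i x)) \<le> Lp_norm M p (f i) + Lp_norm M p (\<lambda>x. \<Sum>i\<in>I. f i x)"
    using insert by (intro Lp_norm_triangle Lp_sum) auto
  then show ?case using insert by fastforce
qed (simp add: Lp_norm_zero)

lemma integral_norm_le_Lp_norm:
  assumes f: "f \<in> Lp_space M p"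
  shows "(LINT x|M. cmod (f x)) \<le> Lp_norm M p f"
proof -
  have "(LINT x|M. 1 * cmod (f x)) powr p \<le> 1 powr (p - 1) * (LINT x|M. 1 * cmod (f x) powr p)"
    using p mass Lp_integrable[OF f] Lp_integrable_powr[OF f]
    by (intro integral_powr_jensen) auto
  then have "(LINT x|M. cmod (f x)) powr p \<le> Lp_norm M p f powr p"
    by (simp add: Lp_norm_powr)
  then show ?thesis
    using p Lp_norm_nonneg[of f] powr_less_mono2[of p "Lp_norm M p f" "LINT x|M. cmod (f x)"] by force
qed

lemma Lp_norm_tendsto_zero:
  assumes "\<And>n. s n \<in> borel_measurable M" "f \<in> borel_measurable M" and g: "g \<in> Lp_space M p"
    and lim: "\<And>x. x \<in> space M \<Longrightarrow> (\<lambda>n. s n x) \<longlonglongrightarrow> f x"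
    and bound: "\<And>n x. x \<in> space M \<Longrightarrow> cmod (f x - s n x) \<le> cmod (g x)"
  shows "(\<lambda>n. Lp_norm M p (\<lambda>x. f x - s n x)) \<longlonglongrightarrow> 0"
proof -
  have "(\<lambda>n. LINT x|M. cmod (f x - s n x) powr p) \<longlonglongrightarrow> (LINT x|M. 0)"
  proof (rule integral_dominated_convergence[where w = "\<lambda>x. cmod (g x) powr p"])
    show "AE x in M. (\<lambda>n. cmod (f x - s n x) powr p) \<longlonglongrightarrow> 0"
    proof (rule AE_I2)
      fix x assume "x \<in> space M"
      have "(\<lambda>n. cmod (f x - s n x) powr p) \<longlonglongrightarrow> cmod (f x - f x) powr p"
        using lim[OF \<open>x \<in> space M\<close>] p by (intro tendsto_intros tendsto_powr2) auto
      then show "(\<lambda>n. cmod (f x - s n x) powr p) \<longlonglongrightarrow> 0" using p by simp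
    qed
  qed (use assms p Lp_integrable_powr[OF g] in \<open>auto intro!: AE_I2 powr_mono2\<close>)
  then have "(\<lambda>n. (LINT x|M. cmod (f x - s n x) powr p) powr (1 / p)) \<longlonglongrightarrow> 0 powr (1 / p)"
    using p integral_powr_nonneg by (intro tendsto_powr2) (auto intro: always_eventually)
  then show ?thesis using p by (simp add: Lp_norm_def)
qed

end

section \<open>A criterion for nuclearity\<close>

context Lp_unit_measure
begin

lemma dual_norm_bounds:
  assumes "\<And>f. f \<in> Lp_space M p \<Longrightarrow> cmod (\<phi> f) \<le> a * Lp_norm M p f" "a \<ge> 0"
  shows "0 \<le> dual_norm (Lp_space M p) (Lp_norm M p) \<phi>" "dual_norm (Lp_space M p) (Lp_norm M p) \<phi> \<le> a"
proof -
  let ?S = "{f \<in> Lp_space M p. Lp_norm M p f \<le> 1}"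
  have le: "cmod (\<phi> f) \<le> a" if "f \<in> ?S" for f
    using assms(1)[of f] mult_left_mono[of "Lp_norm M p f" 1 a] that assms(2) by simp
  have zero: "(\<lambda>x. 0) \<in> ?S" by (simp add: Lp_zero Lp_norm_zero)
  have "bdd_above ((\<lambda>f. cmod (\<phi> f)) ` ?S)" using le by (auto intro!: bdd_aboveI)
  from cSUP_upper[OF zero this] show "0 \<le> dual_norm (Lp_space M p) (Lp_norm M p) \<phi>"
    unfolding dual_norm_def using norm_ge_zero order_trans by blast
  show "dual_norm (Lp_space M p) (Lp_norm M p) \<phi> \<le> a"
    unfolding dual_norm_def using zero le by (intro cSUP_least) auto
qed

lemma dual_space_sum:
  assumes "finite I" "\<And>i. i \<in> I \<Longrightarrow> c i \<in> dual_space (Lp_space M p) (Lp_norm M p)"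
  shows "(\<lambda>f. \<Sum>i\<in>I. B i * c i f) \<in> dual_space (Lp_space M p) (Lp_norm M p)"
proof -
  obtain C where C: "\<And>i f. i \<in> I \<Longrightarrow> f \<in> Lp_space M p \<Longrightarrow> cmod (c i f) \<le> C i * Lp_norm M p f"
    using assms(2) unfolding dual_space_def mem_Collect_eq by metis
  have "cmod (\<Sum>i\<in>I. B i * c i f) \<le> (\<Sum>i\<in>I. cmod (B i) * C i) * Lp_norm M p f" if "f \<in> Lp_space M p" for f
  proof -
    have "cmod (\<Sum>i\<in>I. B i * c i f) \<le> (\<Sum>i\<in>I. cmod (B i) * (C i * Lp_norm M p f))"
      using C that by (intro order_trans[OF norm_sum] sum_mono) (simp add: norm_mult mult_left_mono)
    then show ?thesis by (simp add: sum_distrib_right mult.assoc)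
  qed
  moreover have "(\<Sum>i\<in>I. B i * c i (\<lambda>x. f x + g x)) = (\<Sum>i\<in>I. B i * c i f) + (\<Sum>i\<in>I. B i * c i g)"
    if "f \<in> Lp_space M p" "g \<in> Lp_space M p" for f g
    using assms(2) that by (simp add: dual_space_def distrib_left sum.distrib)
  moreover have "(\<Sum>i\<in>I. B i * c i (\<lambda>x. d * f x)) = d * (\<Sum>i\<in>I. B i * c i f)"
    if "f \<in> Lp_space M p" for f d
    using assms(2) that by (simp add: dual_space_def sum_distrib_left mult.left_commute)
  ultimately show ?thesis unfolding dual_space_def by blast
qed

text \<open>
  The small multiple of the \<open>\<ell>\<^sup>1\<close>-norm makes the seminorm on the coefficients definite, so the
  functions \<open>b l\<close> need not be linearly independent.
\<close>

lemma finite_rank_decomposition: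
  assumes "finite I" and b: "\<And>l. l \<in> I \<Longrightarrow> b l \<in> Lp_space M p"
    and c: "\<And>l. l \<in> I \<Longrightarrow> c l \<in> dual_space (Lp_space M p) (Lp_norm M p)"
    and a: "a > 0" "\<And>f. f \<in> Lp_space M p \<Longrightarrow> Lp_norm M p (\<lambda>x. \<Sum>l\<in>I. c l f * b l x) \<le> a * Lp_norm M p f"
  obtains \<phi> y where "\<And>i. i < card I \<Longrightarrow> \<phi> i \<in> dual_space (Lp_space M p) (Lp_norm M p)"
    and "\<And>i. i < card I \<Longrightarrow> y i \<in> Lp_space M p"
    and "\<And>i. i < card I \<Longrightarrow> Lp_norm M p (y i) \<le> 1"
    and "\<And>i f. i < card I \<Longrightarrow> f \<in> Lp_space M p \<Longrightarrow> cmod (\<phi> i f) \<le> 3 * a * Lp_norm M p f"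
    and "\<And>f x. (\<Sum>l\<in>I. c l f * b l x) = (\<Sum>i<card I. \<phi> i f * y i x)"
proof -
  define n where "n = card I"
  obtain h where h: "bij_betw h {..<n} I"
    using ex_bij_betw_nat_finite[OF \<open>finite I\<close>] by (auto simp: n_def lessThan_atLeast0)
  have hI: "h m \<in> I" if "m < n" for m using h that by (auto simp: bij_betw_def)
  obtain C where C: "\<And>l f. l \<in> I \<Longrightarrow> f \<in> Lp_space M p \<Longrightarrow> cmod (c l f) \<le> C l * Lp_norm M p f"
    using c unfolding dual_space_def mem_Collect_eq by metis
  define S where "S = (\<Sum>m<n. \<bar>C (h m)\<bar>)"
  have S: "S \<ge> 0" by (simp add: S_def sum_nonneg)
  \<comment> \<open>Chosen so that the added term costs at most a / 2. The coefficient vector of f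
    then has \<open>q\<close> at most 3 a / 2 times the norm of f, and the factor 2 of
    \<open>near_auerbach\<close> yields 3 a.\<close>
  define \<epsilon> where "\<epsilon> = a / (2 * (S + 1))"
  have \<epsilon>: "\<epsilon> > 0" "\<epsilon> * S \<le> a / 2"
    using a(1) S by (simp_all add: \<epsilon>_def field_simps)
  define F where "F v x = (\<Sum>m<n. v m * b (h m) x)" for v x
  have F: "F v \<in> Lp_space M p" for v
    unfolding F_def using hI b by (intro Lp_sum Lp_scale) auto
  define q where "q v = Lp_norm M p (F v) + \<epsilon> * (\<Sum>m<n. cmod (v m))" for v
  have "\<epsilon> * cmod (v i) \<le> q v" if "i < n" for v i
  proof -
    have "cmod (v i) \<le> (\<Sum>m<n. cmod (v m))"
      using that by (intro member_le_sum) auto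
    then show ?thesis using \<epsilon> Lp_norm_nonneg[of "F v"] by (simp add: q_def add_increasing)
  qed
  moreover have "q (\<lambda>i. d * v i) = cmod d * q v" for d v
  proof -
    have "F (\<lambda>i. d * v i) = (\<lambda>x. d * F v x)"
      unfolding F_def by (rule ext) (simp add: sum_distrib_left mult.assoc)
    then show ?thesis
      by (simp add: q_def Lp_norm_scale norm_mult sum_distrib_left[symmetric] algebra_simps)
  qed
  ultimately obtain e B where e: "\<And>i. i < n \<Longrightarrow> q (e i) \<le> 1"
    and repr: "\<And>v l. l < n \<Longrightarrow> v l = (\<Sum>i<n. (\<Sum>m<n. B i m * v m) * e i l)"
    and coord: "\<And>v i. i < n \<Longrightarrow> cmod (\<Sum>m<n. B i m * v m) \<le> 2 * q v"
    using near_auerbach[OF \<epsilon>(1), of n q] by blast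
  define \<phi> where "\<phi> i f = (\<Sum>m<n. B i m * c (h m) f)" for i f
  have sum_eq: "(\<Sum>l\<in>I. c l f * b l x) = F (\<lambda>m. c (h m) f) x" for f x
    unfolding F_def by (rule sum.reindex_bij_betw[OF h, symmetric])
  show thesis
  proof
    fix i assume "i < card I"
    then have i: "i < n" by (simp add: n_def)
    show "\<phi> i \<in> dual_space (Lp_space M p) (Lp_norm M p)"
      unfolding \<phi>_def using hI c by (intro dual_space_sum) auto
    show "F (e i) \<in> Lp_space M p" by (rule F)
    have "0 \<le> \<epsilon> * (\<Sum>m<n. cmod (e i m))" using \<epsilon> by (simp add: sum_nonneg)
    then show "Lp_norm M p (F (e i)) \<le> 1" using e[OF i] by (simp add: q_def)
    fix f assume f: "f \<in> Lp_space M p"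
    have "(\<Sum>m<n. cmod (c (h m) f)) \<le> (\<Sum>m<n. \<bar>C (h m)\<bar> * Lp_norm M p f)"
    proof (intro sum_mono)
      fix m assume "m \<in> {..<n}"
      then have "cmod (c (h m) f) \<le> C (h m) * Lp_norm M p f" using C hI f by simp
      also have "\<dots> \<le> \<bar>C (h m)\<bar> * Lp_norm M p f"
        by (intro mult_right_mono Lp_norm_nonneg) simp
      finally show "cmod (c (h m) f) \<le> \<bar>C (h m)\<bar> * Lp_norm M p f" .
    qed
    then have "\<epsilon> * (\<Sum>m<n. cmod (c (h m) f)) \<le> (\<epsilon> * S) * Lp_norm M p f"
      using \<epsilon>(1) by (simp add: S_def sum_distrib_right)
    also have "\<dots> \<le> a / 2 * Lp_norm M p f"
      using \<epsilon>(2) by (intro mult_right_mono Lp_norm_nonneg)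
    finally have "q (\<lambda>m. c (h m) f) \<le> a * Lp_norm M p f + a / 2 * Lp_norm M p f"
      using a(2)[OF f] unfolding sum_eq q_def by (intro add_mono)
    then show "cmod (\<phi> i f) \<le> 3 * a * Lp_norm M p f"
      using coord[OF i, of "\<lambda>m. c (h m) f"] by (simp add: \<phi>_def)
  next
    fix f x
    have "F (\<lambda>m. c (h m) f) x = (\<Sum>m<n. (\<Sum>i<n. \<phi> i f * e i m) * b (h m) x)"
      unfolding F_def \<phi>_def using repr[of _ "\<lambda>m. c (h m) f"] by (intro sum.cong refl) simp
    also have "\<dots> = (\<Sum>i<n. \<phi> i f * F (e i) x)"
      unfolding F_def sum_distrib_left sum_distrib_right mult.assoc by (rule sum.swap)
    finally show "(\<Sum>l\<in>I. c l f * b l x) = (\<Sum>i<card I. \<phi> i f * F (e i) x)"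
      by (simp add: sum_eq n_def)
  qed
qed

text \<open>Used with J = 0 for summability along the enumeration, and with large J for what remains
  once the first J blocks are complete.\<close>

lemma sum_prod_decode_le:
  fixes a :: "nat \<Rightarrow> real"
  assumes "finite G" "\<And>j. a j \<ge> 0" "summable (\<lambda>j. real (n j) * a j)"
    and "\<And>j i. (j, i) \<in> G \<Longrightarrow> i < n j \<Longrightarrow> j \<ge> J"
  shows "(\<Sum>(j, i)\<in>G. if i < n j then a j else 0) \<le> (\<Sum>j. real (n (j + J)) * a (j + J))"
proof -
  obtain K where K: "\<And>j i. (j, i) \<in> G \<Longrightarrow> j < J + K"
    using finite_nat_set_iff_bounded[of "fst ` G"] \<open>finite G\<close>
    by (force simp: image_iff intro: less_le_trans trans_le_add2)
  have "(\<Sum>(j, i)\<in>G. if i < n j then a j else 0) = (\<Sum>(j, i)\<in>{(j, i)\<in>G. i < n j}. a j)"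
    using \<open>finite G\<close> by (intro sum.mono_neutral_cong_right) (auto split: if_splits)
  also have "\<dots> \<le> (\<Sum>(j, i)\<in>Sigma {J..<J + K} (\<lambda>j. {..<n j}). a j)"
    using assms K by (intro sum_mono2) auto
  also have "\<dots> = (\<Sum>j\<in>{J..<J + K}. real (n j) * a j)"
    by (subst sum.Sigma[symmetric]) auto
  also have "\<dots> = (\<Sum>j<K. real (n (j + J)) * a (j + J))"
    using sum.shift_bounds_nat_ivl[of "\<lambda>j. real (n j) * a j" 0 J K] by (simp add: lessThan_atLeast0 add.commute)
  also have "\<dots> \<le> (\<Sum>j. real (n (j + J)) * a (j + J))"
    using assms by (intro sum_le_suminf) (auto simp: summable_iff_shift[of "\<lambda>j. real (n j) * a j"])
  finally show ?thesis .
qed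

text \<open>Nuclearity asks for one sequence, so the pairs (block, index) are enumerated by
  \<open>prod_decode\<close>, with zero terms at indices outside a block. This order does not follow
  the blocks, so convergence of the block sums is not enough: summability with exponent 1 controls
  the stray terms.\<close>

lemma r_nuclear_onI_blocks:
  fixes n :: "nat \<Rightarrow> nat" and a :: "nat \<Rightarrow> real"
  assumes T: "linear_operator_on (Lp_space M p) (Lp_norm M p) T" and r: "r > 0"
    and \<phi>: "\<And>j i. i < n j \<Longrightarrow> \<phi> j i \<in> dual_space (Lp_space M p) (Lp_norm M p)"
    and y: "\<And>j i. i < n j \<Longrightarrow> y j i \<in> Lp_space M p"
    and y1: "\<And>j i. i < n j \<Longrightarrow> Lp_norm M p (y j i) \<le> 1"
    and \<phi>a: "\<And>j i f. i < n j \<Longrightarrow> f \<in> Lp_space M p \<Longrightarrow> cmod (\<phi> j i f) \<le> a j * Lp_norm M p f"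
    and a: "\<And>j. a j \<ge> 0" "summable (\<lambda>j. real (n j) * a j)" "summable (\<lambda>j. real (n j) * a j powr r)"
    and lim: "\<And>f. f \<in> Lp_space M p \<Longrightarrow>
      (\<lambda>J. Lp_norm M p (\<lambda>x. T f x - (\<Sum>j<J. \<Sum>i<n j. \<phi> j i f * y j i x))) \<longlonglongrightarrow> 0"
  shows "r_nuclear_on (Lp_space M p) (Lp_norm M p) r T"
proof -
  define P where "P m = (snd (prod_decode m) < n (fst (prod_decode m)))" for m
  define \<Phi> where "\<Phi> m = (if P m then \<phi> (fst (prod_decode m)) (snd (prod_decode m)) else (\<lambda>f. 0))" for m
  define Y where "Y m = (if P m then y (fst (prod_decode m)) (snd (prod_decode m)) else (\<lambda>x. 0))" for m
  define s where "s m = (case prod_decode m of (j, i) \<Rightarrow> if i < n j then a j powr r else 0)" for m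
  have \<Phi>: "\<Phi> m \<in> dual_space (Lp_space M p) (Lp_norm M p)" for m
    using \<phi> by (auto simp: \<Phi>_def P_def dual_space_def intro!: exI[of _ 0])
  have Y: "Y m \<in> Lp_space M p" for m
    using y Lp_zero by (auto simp: Y_def P_def)
  have le: "dual_norm (Lp_space M p) (Lp_norm M p) (\<Phi> m) powr r * Lp_norm M p (Y m) powr r \<le> s m" for m
  proof (cases "P m")
    case True
    obtain j i where ji: "prod_decode m = (j, i)" by fastforce
    then have i: "i < n j" using True by (simp add: P_def)
    have "dual_norm (Lp_space M p) (Lp_norm M p) (\<phi> j i) powr r * Lp_norm M p (y j i) powr r \<le> a j powr r * 1 powr r"
      using dual_norm_bounds[OF \<phi>a[OF i] a(1)] y1[OF i] Lp_norm_nonneg r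
      by (intro mult_mono powr_mono2) auto
    then show ?thesis using True i ji by (simp add: \<Phi>_def Y_def s_def)
  next
    case False
    then show ?thesis by (auto simp: Y_def Lp_norm_zero s_def split: prod.split)
  qed
  have "summable s"
  proof (rule summableI_nonneg_bounded)
    fix m
    show "0 \<le> s m" by (simp add: s_def split: prod.split)
    have "(\<Sum>k<m. s k) = (\<Sum>(j, i)\<in>prod_decode ` {..<m}. if i < n j then a j powr r else 0)"
      by (subst sum.reindex) (auto simp: s_def inj_prod_decode)
    also have "\<dots> \<le> (\<Sum>j. real (n (j + 0)) * a (j + 0) powr r)"
      using a(3) by (intro sum_prod_decode_le) auto
    finally show "(\<Sum>k<m. s k) \<le> (\<Sum>j. real (n (j + 0)) * a (j + 0) powr r)" .
  qed
  then have summ: "summable (\<lambda>m. dual_norm (Lp_space M p) (Lp_norm M p) (\<Phi> m) powr r * Lp_norm M p (Y m) powr r)"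
    by (rule summable_comparison_test'[of s 0]) (use le in \<open>simp add: abs_mult\<close>)
  have "(\<lambda>m. Lp_norm M p (\<lambda>x. T f x - (\<Sum>k<m. \<Phi> k f * Y k x))) \<longlonglongrightarrow> 0" if f: "f \<in> Lp_space M p" for f
  proof (rule LIMSEQ_I)
    fix \<epsilon> :: real assume "\<epsilon> > 0"
    define Nf where "Nf = Lp_norm M p f"
    have Nf: "Nf \<ge> 0" by (simp add: Nf_def Lp_norm_nonneg)
    have Tf: "T f \<in> Lp_space M p" using T f by (simp add: linear_operator_on_def)
    have "\<forall>\<^sub>F J in sequentially. Lp_norm M p (\<lambda>x. T f x - (\<Sum>j<J. \<Sum>i<n j. \<phi> j i f * y j i x)) < \<epsilon> / 2"
      using \<open>\<epsilon> > 0\<close> by (intro order_tendstoD(2)[OF lim[OF f]]) simp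
    moreover have "\<forall>\<^sub>F J in sequentially. (\<Sum>j. real (n (j + J)) * a (j + J)) < \<epsilon> / (2 * (Nf + 1))"
      using suminf_exist_split[OF _ a(2), of "\<epsilon> / (2 * (Nf + 1))"] \<open>\<epsilon> > 0\<close> Nf
      unfolding eventually_sequentially by (force simp: add_nonneg_pos)
    ultimately have "\<forall>\<^sub>F J in sequentially. Lp_norm M p (\<lambda>x. T f x - (\<Sum>j<J. \<Sum>i<n j. \<phi> j i f * y j i x)) < \<epsilon> / 2
        \<and> (\<Sum>j. real (n (j + J)) * a (j + J)) < \<epsilon> / (2 * (Nf + 1))"
      by eventually_elim simp
    then obtain J where J: "Lp_norm M p (\<lambda>x. T f x - (\<Sum>j<J. \<Sum>i<n j. \<phi> j i f * y j i x)) < \<epsilon> / 2"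
        "(\<Sum>j. real (n (j + J)) * a (j + J)) < \<epsilon> / (2 * (Nf + 1))"
      using eventually_happens'[OF sequentially_bot] by blast
    define F where "F = Sigma {..<J} (\<lambda>j. {..<n j})"
    define t where "t = (\<lambda>(j, i). if i < n j then \<lambda>x. \<phi> j i f * y j i x else (\<lambda>x. 0))"
    have "finite F" by (simp add: F_def)
    then obtain m0 where m0: "\<And>x. x \<in> F \<Longrightarrow> prod_encode x < m0"
      using finite_nat_set_iff_bounded[of "prod_encode ` F"] by auto
    have t_Lp: "t z \<in> Lp_space M p" for z
      using y by (cases z) (auto simp: t_def Lp_zero intro!: Lp_scale)
    have "Lp_norm M p (\<lambda>x. T f x - (\<Sum>k<m. \<Phi> k f * Y k x)) < \<epsilon>" if "m \<ge> m0" for m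
    proof -
      \<comment> \<open>The terms met so far outside the first J blocks; all of them lie in later
        blocks.\<close>
      define G where "G = prod_decode ` {..<m} - F"
      have "F \<subseteq> prod_decode ` {..<m}"
        using m0 that by (auto simp: image_iff) (metis lessThan_iff less_le_trans prod_encode_inverse)
      then have un: "prod_decode ` {..<m} = F \<union> G" "F \<inter> G = {}" "finite G"
        by (auto simp: G_def)
      have "(\<Sum>k<m. \<Phi> k f * Y k x) = (\<Sum>z\<in>prod_decode ` {..<m}. t z x)" for x
        by (subst sum.reindex)
          (auto simp: inj_prod_decode t_def \<Phi>_def Y_def P_def split: prod.split intro!: sum.cong)
      also have "\<dots> x = (\<Sum>j<J. \<Sum>i<n j. \<phi> j i f * y j i x) + (\<Sum>z\<in>G. t z x)" for x
        unfolding un(1) sum.union_disjoint[OF \<open>finite F\<close> un(3,2)]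
        unfolding F_def by (subst sum.Sigma) (auto simp: t_def intro!: sum.cong)
      finally have split: "(\<Sum>k<m. \<Phi> k f * Y k x) = (\<Sum>j<J. \<Sum>i<n j. \<phi> j i f * y j i x) + (\<Sum>z\<in>G. t z x)" for x .
      have "Lp_norm M p (\<lambda>x. \<Sum>z\<in>G. t z x) \<le> (\<Sum>z\<in>G. Lp_norm M p (t z))"
        using un(3) t_Lp by (intro Lp_norm_sum)
      also have "\<dots> \<le> (\<Sum>z\<in>G. Nf * (case z of (j, i) \<Rightarrow> if i < n j then a j else 0))"
      proof (intro sum_mono)
        fix z assume "z \<in> G"
        obtain j i where z: "z = (j, i)" by fastforce
        have "cmod (\<phi> j i f) * Lp_norm M p (y j i) \<le> a j * Nf * 1" if "i < n j"
          using \<phi>a[OF that f] y1[OF that] Lp_norm_nonneg a(1) Nf by (intro mult_mono) (auto simp: Nf_def)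
        then show "Lp_norm M p (t z) \<le> Nf * (case z of (j, i) \<Rightarrow> if i < n j then a j else 0)"
          by (simp add: z t_def Lp_norm_scale Lp_norm_zero mult.commute)
      qed
      also have "\<dots> = Nf * (\<Sum>(j, i)\<in>G. if i < n j then a j else 0)"
        by (simp add: sum_distrib_left)
      also have "\<dots> \<le> (Nf + 1) * (\<Sum>j. real (n (j + J)) * a (j + J))"
      proof (intro mult_mono)
        show "(\<Sum>(j, i)\<in>G. if i < n j then a j else 0) \<le> (\<Sum>j. real (n (j + J)) * a (j + J))"
          using un(3) by (intro sum_prod_decode_le a) (auto simp: G_def F_def)
        show "0 \<le> (\<Sum>(j, i)\<in>G. if i < n j then a j else 0)"
          using a(1) by (intro sum_nonneg) auto
      qed (use Nf in auto)
      also have "\<dots> < \<epsilon> / 2"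
        using J(2) Nf by (simp add: field_simps add_nonneg_pos)
      finally have small: "Lp_norm M p (\<lambda>x. \<Sum>z\<in>G. t z x) < \<epsilon> / 2" .
      have "Lp_norm M p (\<lambda>x. (T f x - (\<Sum>j<J. \<Sum>i<n j. \<phi> j i f * y j i x)) + (- 1) * (\<Sum>z\<in>G. t z x))
          \<le> Lp_norm M p (\<lambda>x. T f x - (\<Sum>j<J. \<Sum>i<n j. \<phi> j i f * y j i x)) + Lp_norm M p (\<lambda>x. (- 1) * (\<Sum>z\<in>G. t z x))"
        using y Tf un(3) t_Lp by (intro Lp_norm_triangle Lp_diff Lp_scale Lp_sum) auto
      also have "\<dots> < \<epsilon>"
        using J(1) small unfolding Lp_norm_scale by simp
      finally show ?thesis by (simp add: split diff_diff_eq)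
    qed
    then show "\<exists>m0. \<forall>m\<ge>m0. norm (Lp_norm M p (\<lambda>x. T f x - (\<Sum>k<m. \<Phi> k f * Y k x)) - 0) < \<epsilon>"
      using Lp_norm_nonneg by auto
  qed
  then show ?thesis
    unfolding r_nuclear_on_def using T \<Phi> Y summ by blast
qed

end

section \<open>Density of the matrix coefficients\<close>

text \<open>On SU(2) the conjugate of an entry is another entry up to sign. Hence real and imaginary
  parts, and all real polynomials in them, are representative functions.\<close>

lemma repfun_cnj_entry: "repfun (\<lambda>g. cnj (g$i$j))"
proof -
  have entry: "repfun (\<lambda>g. c * g$a$b)" for a b c
    using repfun.scale[OF repfun_entry[OF repfun_const[of 1]], of c a b] by simp
  have "repfun (\<lambda>g. cnj (g$1$1))"
    by (rule repfun.cong[OF entry[of 1 2 2]]) (simp add: SU2_entries)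
  moreover have "repfun (\<lambda>g. cnj (g$2$2))"
    by (rule repfun.cong[OF entry[of 1 1 1]]) (simp add: SU2_entries)
  moreover have "repfun (\<lambda>g. cnj (g$1$2))"
    by (rule repfun.cong[OF entry[of "-1" 2 1]]) (simp add: SU2_entries)
  moreover have "repfun (\<lambda>g. cnj (g$2$1))"
    by (rule repfun.cong[OF entry[of "-1" 1 2]]) (simp add: SU2_entries)
  ultimately show ?thesis using exhaust_2[of i] exhaust_2[of j] by auto
qed

lemma repfun_real_polynomial_function:
  "real_polynomial_function q \<Longrightarrow> repfun (\<lambda>g. of_real (q g))"
proof (induction rule: real_polynomial_function.induct)
  case (linear f)
  have entry: "repfun (\<lambda>g. g$i$j)" for i j
    using repfun_entry[OF repfun_const[of 1]] by simp
  have Re: "repfun (\<lambda>g. of_real (Re (g$i$j)))" for i j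
  proof -
    have "complex_of_real (Re z) = (1/2) * (z + cnj z)" for z by (simp add: complex_eq_iff)
    then show "repfun (\<lambda>g. of_real (Re (g$i$j)))"
      by (simp only:) (rule repfun.scale[OF repfun.add[OF entry repfun_cnj_entry]])
  qed
  have Im: "repfun (\<lambda>g. of_real (Im (g$i$j)))" for i j
  proof -
    have "complex_of_real (Im z) = (- \<i>/2) * (z - cnj z)" for z by (simp add: complex_eq_iff)
    then show "repfun (\<lambda>g. of_real (Im (g$i$j)))"
      by (simp only:) (rule repfun.scale[OF repfun_diff[OF entry repfun_cnj_entry]])
  qed
  have f: "f g = (\<Sum>b\<in>Basis. (g \<bullet> b) * f b)" for g
  proof -
    have "f g = f (\<Sum>b\<in>Basis. (g \<bullet> b) *\<^sub>R b)" by (simp add: euclidean_representation)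
    also have "\<dots> = (\<Sum>b\<in>Basis. (g \<bullet> b) * f b)"
      using linear by (simp add: linear_sum linear_scale bounded_linear.linear)
    finally show ?thesis .
  qed
  have "(\<lambda>g. complex_of_real (f g)) = (\<lambda>g. \<Sum>b\<in>Basis. of_real (f b) * of_real (g \<bullet> b))"
    by (rule ext, subst f) (simp add: mult.commute)
  moreover have "repfun (\<lambda>g. complex_of_real (g \<bullet> b))" if "b \<in> Basis" for b :: "complex^2^2"
    using that Re Im by (auto simp: Basis_vec_def Basis_complex_def inner_axis)
  ultimately show ?case by (auto intro!: repfun_sum repfun.scale)
next
  case (const c)
  show ?case by (rule repfun_const)
next
  case (add f g)
  then show ?case by (simp add: repfun.add)
next
  case (mult f g)
  then show ?case by (simp add: repfun_mult)
qed

locale Lp_SU2 = haar_SU2 +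
  fixes p :: real
  assumes p_ge: "p \<ge> 1"
begin

sublocale Lp_unit_measure \<mu> p
  by unfold_locales (use p_ge measure_haar in auto)

definition approximable :: "(complex^2^2 \<Rightarrow> complex) \<Rightarrow> bool"
  where "approximable f \<longleftrightarrow> f \<in> Lp_space \<mu> p \<and>
    (\<forall>\<epsilon>>0. \<exists>h. repfun h \<and> Lp_norm \<mu> p (\<lambda>x. f x - h x) < \<epsilon>)"

lemma Lp_repfun: "repfun h \<Longrightarrow> h \<in> Lp_space \<mu> p"
  using repfun_bounded[of h] Lp_bounded(1)[OF borel_measurable_repfun] by (metis space_haar)

lemma approximable_cong:
  "approximable f \<Longrightarrow> (\<And>x. x \<in> SU2 \<Longrightarrow> g x = f x) \<Longrightarrow> approximable g"
proof -
  assume f: "approximable f" and eq: "\<And>x. x \<in> SU2 \<Longrightarrow> g x = f x"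
  then have "g \<in> Lp_space \<mu> p"
    using Lp_space_cong[of g f] by (simp add: approximable_def space_haar)
  moreover have "Lp_norm \<mu> p (\<lambda>x. g x - h x) = Lp_norm \<mu> p (\<lambda>x. f x - h x)" for h
    by (intro Lp_norm_cong) (simp add: eq space_haar)
  ultimately show "approximable g" using f by (simp add: approximable_def)
qed

lemma approximable_limit:
  assumes f: "f \<in> Lp_space \<mu> p" and s: "\<And>n. approximable (s n)"
    and lim: "(\<lambda>n. Lp_norm \<mu> p (\<lambda>x. f x - s n x)) \<longlonglongrightarrow> 0"
  shows "approximable f"
  unfolding approximable_def
proof (intro conjI allI impI f)
  fix \<epsilon> :: real assume "\<epsilon> > 0"
  then have "\<epsilon> / 2 > 0" by simp
  from order_tendstoD(2)[OF lim this] obtain n where n: "Lp_norm \<mu> p (\<lambda>x. f x - s n x) < \<epsilon> / 2"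
    using eventually_sequentially by auto
  obtain h where h: "repfun h" "Lp_norm \<mu> p (\<lambda>x. s n x - h x) < \<epsilon> / 2"
    using s[of n] \<open>\<epsilon> / 2 > 0\<close> unfolding approximable_def by blast
  have "Lp_norm \<mu> p (\<lambda>x. f x - h x) < \<epsilon>"
    using Lp_norm_triangle_diff[OF f _ Lp_repfun[OF h(1)], of "s n"] s[of n] n h(2)
    by (simp add: approximable_def)
  then show "\<exists>h. repfun h \<and> Lp_norm \<mu> p (\<lambda>x. f x - h x) < \<epsilon>" using h by blast
qed

lemma approximable_repfun: "repfun h \<Longrightarrow> approximable h"
  unfolding approximable_def using Lp_repfun Lp_norm_zero by fastforce

lemma approximable_add:
  assumes f: "approximable f" and g: "approximable g"
  shows "approximable (\<lambda>x. f x + g x)"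
  unfolding approximable_def
proof (intro conjI allI impI Lp_add)
  fix \<epsilon> :: real assume "\<epsilon> > 0"
  then have "\<epsilon> / 2 > 0" by simp
  then obtain h k where h: "repfun h" "Lp_norm \<mu> p (\<lambda>x. f x - h x) < \<epsilon> / 2"
    and k: "repfun k" "Lp_norm \<mu> p (\<lambda>x. g x - k x) < \<epsilon> / 2"
    using f g unfolding approximable_def by meson
  have "Lp_norm \<mu> p (\<lambda>x. (f x - h x) + (g x - k x)) \<le> Lp_norm \<mu> p (\<lambda>x. f x - h x) + Lp_norm \<mu> p (\<lambda>x. g x - k x)"
    using f g Lp_repfun h k by (intro Lp_norm_triangle Lp_diff) (auto simp: approximable_def)
  moreover have "(\<lambda>x. (f x - h x) + (g x - k x)) = (\<lambda>x. f x + g x - (h x + k x))" by auto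
  ultimately have "Lp_norm \<mu> p (\<lambda>x. f x + g x - (h x + k x)) < \<epsilon>" using h k by simp
  then show "\<exists>h. repfun h \<and> Lp_norm \<mu> p (\<lambda>x. f x + g x - h x) < \<epsilon>"
    using repfun.add[OF h(1) k(1)] by blast
qed (use f g in \<open>auto simp: approximable_def\<close>)

lemma approximable_scale:
  assumes f: "approximable f"
  shows "approximable (\<lambda>x. c * f x)"
  unfolding approximable_def
proof (intro conjI allI impI Lp_scale)
  fix \<epsilon> :: real assume "\<epsilon> > 0"
  then have "\<epsilon> / (cmod c + 1) > 0" by (simp add: add_nonneg_pos)
  then obtain h where h: "repfun h" "Lp_norm \<mu> p (\<lambda>x. f x - h x) < \<epsilon> / (cmod c + 1)"
    using f unfolding approximable_def by meson
  have "Lp_norm \<mu> p (\<lambda>x. c * f x - c * h x) = cmod c * Lp_norm \<mu> p (\<lambda>x. f x - h x)"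
    unfolding Lp_norm_scale[symmetric] by (simp add: algebra_simps)
  also have "\<dots> \<le> (cmod c + 1) * Lp_norm \<mu> p (\<lambda>x. f x - h x)"
    by (intro mult_right_mono Lp_norm_nonneg) simp
  also have "\<dots> < \<epsilon>" using h(2) by (simp add: pos_less_divide_eq add_nonneg_pos mult.commute)
  finally show "\<exists>h. repfun h \<and> Lp_norm \<mu> p (\<lambda>x. c * f x - h x) < \<epsilon>"
    using repfun.scale[OF h(1)] by blast
qed (use f in \<open>auto simp: approximable_def\<close>)

lemma approximable_sum:
  "finite I \<Longrightarrow> (\<And>i. i \<in> I \<Longrightarrow> approximable (f i)) \<Longrightarrow> approximable (\<lambda>x. \<Sum>i\<in>I. f i x)"
  by (induction I rule: finite_induct)
    (auto intro: approximable_add approximable_repfun[OF repfun_const])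

lemma approximable_continuous:
  fixes u :: "complex^2^2 \<Rightarrow> real"
  assumes u: "continuous_on SU2 u"
  shows "approximable (\<lambda>x. of_real (u x))"
proof -
  have meas: "(\<lambda>x. complex_of_real (u x)) \<in> borel_measurable \<mu>"
    by (intro borel_measurable_haar continuous_intros u)
  have "bounded (u ` SU2)"
    using compact_SU2 u compact_continuous_image compact_imp_bounded by blast
  then obtain B where "\<And>x. x \<in> SU2 \<Longrightarrow> \<bar>u x\<bar> \<le> B"
    unfolding bounded_iff by auto
  then have "(\<lambda>x. of_real (u x)) \<in> Lp_space \<mu> p"
    by (intro Lp_bounded(1)[OF meas, of B]) (auto simp: space_haar)
  moreover have "\<exists>h. repfun h \<and> Lp_norm \<mu> p (\<lambda>x. of_real (u x) - h x) < \<epsilon>" if "\<epsilon> > 0" for \<epsilon>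
  proof -
    obtain q where q: "real_polynomial_function q" "\<And>x. x \<in> SU2 \<Longrightarrow> \<bar>u x - q x\<bar> < \<epsilon> / 2"
      using Stone_Weierstrass_real_polynomial_function[OF compact_SU2 u, of "\<epsilon> / 2"] \<open>\<epsilon> > 0\<close> by auto
    have h: "repfun (\<lambda>x. of_real (q x))" by (rule repfun_real_polynomial_function[OF q(1)])
    have "cmod (of_real (u x) - of_real (q x)) \<le> \<epsilon> / 2" if "x \<in> SU2" for x
      using q(2)[OF that] unfolding of_real_diff[symmetric] norm_of_real by simp
    then have "Lp_norm \<mu> p (\<lambda>x. of_real (u x) - of_real (q x)) \<le> \<epsilon> / 2"
      using borel_measurable_repfun[OF h] meas by (intro Lp_bounded(2)) (auto simp: space_haar)
    also have "\<epsilon> / 2 < \<epsilon>" using that by simp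
    finally show ?thesis using h by blast
  qed
  ultimately show ?thesis unfolding approximable_def by blast
qed

lemma borel_measurable_indicator_haar:
  "B \<in> sets borel \<Longrightarrow> (\<lambda>x. indicator B x :: complex) \<in> borel_measurable \<mu>"
  unfolding measurable_cong_sets[OF sets_haar refl]
  by (intro measurable_restrict_space1 borel_measurable_indicator)

lemma Lp_indicator: "B \<in> sets borel \<Longrightarrow> indicator B \<in> Lp_space \<mu> p"
  using borel_measurable_indicator_haar[of B] by (intro Lp_bounded(1)[where B = 1]) (auto split: split_indicator)

lemma approximable_indicator_closed:
  assumes A: "closed A"
  shows "approximable (indicator A)"
\<comment> \<open>By convention \<open>infdist\<close> to the empty set is 0, which would make the
  cut-offs below equal to 1.\<close>
proof (cases "A = {}")
  case True
  then show ?thesis using approximable_repfun[OF repfun_const[of 0]]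
    by (rule_tac approximable_cong) auto
next
  case False
  \<comment> \<open>Continuous cut-offs, equal to 1 on A, whose support shrinks to A.\<close>
  define u where "u n x = max 0 (1 - real n * infdist x A)" for n x
  have u: "continuous_on SU2 (u n)" for n
    unfolding u_def by (intro continuous_intros)
  have lim: "(\<lambda>n. complex_of_real (u n x)) \<longlonglongrightarrow> indicator A x" for x
  proof (cases "x \<in> A")
    case True
    then show ?thesis by (simp add: u_def)
  next
    case False
    then have pos: "infdist x A > 0" using infdist_pos_not_in_closed[OF A \<open>A \<noteq> {}\<close>] by blast
    then obtain m where m: "1 < real m * infdist x A" using reals_Archimedean3 by blast
    have "u n x = 0" if "n \<ge> m" for n
    proof -
      have "real m * infdist x A \<le> real n * infdist x A" using that pos by simp
      then show ?thesis using m by (simp add: u_def)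
    qed
    then have "\<forall>\<^sub>F n in sequentially. complex_of_real (u n x) = 0"
      by (auto simp: eventually_sequentially)
    then show ?thesis using False by (simp add: tendsto_eventually)
  qed
  have "(\<lambda>n. Lp_norm \<mu> p (\<lambda>x. indicator A x - complex_of_real (u n x))) \<longlonglongrightarrow> 0"
  proof (rule Lp_norm_tendsto_zero[where g = "\<lambda>x. 1"])
    show "cmod (indicator A x - complex_of_real (u n x)) \<le> cmod 1" for n x
    proof (cases "x \<in> A")
      case False
      have "\<bar>u n x\<bar> \<le> 1" using infdist_nonneg[of x A] by (auto simp: u_def)
      then show ?thesis using False by simp
    qed (simp add: u_def)
  qed (use A lim borel_measurable_indicator_haar[of A] Lp_repfun[OF repfun_const]
      in \<open>auto intro!: borel_measurable_haar continuous_intros u\<close>)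
  then show ?thesis
    using A by (intro approximable_limit[OF Lp_indicator approximable_continuous[OF u]]) auto
qed

text \<open>Dynkin's argument: closed sets form an intersection-stable generator, and the property
  passes to complements and, by dominated convergence, to disjoint countable unions.\<close>

lemma approximable_indicator:
  assumes "B \<in> sets borel"
  shows "approximable (indicator B)"
proof -
  have sets: "sets borel = sigma_sets UNIV (Collect closed :: (complex^2^2) set set)"
    by (subst borel_eq_closed) simp
  have stable: "Int_stable (Collect closed :: (complex^2^2) set set)"
    by (auto simp: Int_stable_def)
  have B: "B \<in> sigma_sets UNIV (Collect closed)"
    using assms sets by simp
  have sub: "Collect closed \<subseteq> Pow (UNIV :: (complex^2^2) set)" by simp
  from stable sub B show ?thesis
  proof (induction B rule: sigma_sets_induct_disjoint)
    case (basic A)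
    then show ?case by (simp add: approximable_indicator_closed)
  next
    case empty
    show ?case by (rule approximable_indicator_closed) simp
  next
    case (compl A)
    show ?case
      by (rule approximable_cong[OF approximable_add[OF approximable_repfun[OF repfun_const[of 1]]
              approximable_scale[OF compl(2), of "- 1"]]])
        (simp add: indicator_def)
  next
    case (union A)
    then have meas: "A i \<in> sets borel" for i unfolding sets by auto
    show ?case
    proof (rule approximable_limit)
      show "indicator (\<Union> (range A)) \<in> Lp_space \<mu> p"
        using meas by (intro Lp_indicator) auto
      show "approximable (indicator (\<Union>i<n. A i))" for n
      proof (rule approximable_cong[OF approximable_sum[of "{..<n}" "\<lambda>i. indicator (A i)"]])
        show "indicator (\<Union>i<n. A i) x = (\<Sum>i<n. indicator (A i) x)" for x
          using union(1) by (intro indicator_UN_disjoint) (auto simp: disjoint_family_on_def)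
      qed (use union in auto)
      show "(\<lambda>n. Lp_norm \<mu> p (\<lambda>x. indicator (\<Union> (range A)) x - indicator (\<Union>i<n. A i) x)) \<longlonglongrightarrow> 0"
        using meas
        by (intro Lp_norm_tendsto_zero[where g = "\<lambda>x. 1"] LIMSEQ_indicator_UN
            borel_measurable_indicator_haar Lp_repfun[OF repfun_const])
          (auto simp: indicator_def)
    qed
  qed
qed

lemma approximable_Lp:
  assumes f: "f \<in> Lp_space \<mu> p"
  shows "approximable f"
proof -
  from borel_measurable_implies_sequence_metric[OF Lp_measurable[OF f], of 0]
  obtain s where s: "\<And>i. simple_function \<mu> (s i)"
    and lim: "\<And>x. x \<in> SU2 \<Longrightarrow> (\<lambda>i. s i x) \<longlonglongrightarrow> f x"
    and bound: "\<And>i x. x \<in> SU2 \<Longrightarrow> cmod (s i x) \<le> 2 * cmod (f x)"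
    unfolding space_haar dist_0_norm by (metis dist_norm diff_zero)
  have "approximable (s i)" for i
  proof -
    \<comment> \<open>Level sets are measurable only inside SU(2); they are traces of Borel sets of
      the whole matrix space, to which \<open>approximable_indicator\<close> applies.\<close>
    have "\<exists>B\<in>sets borel. s i -` {y} \<inter> SU2 = SU2 \<inter> B" for y
      using simple_functionD(2)[OF s, of i "{y}"] sets_haar by (auto simp: sets_restrict_space space_haar)
    then obtain B where B: "\<And>y. B y \<in> sets borel" "\<And>y. s i -` {y} \<inter> SU2 = SU2 \<inter> B y"
      by metis
    have appr: "approximable (\<lambda>x. \<Sum>y\<in>s i ` space \<mu>. y * indicator (B y) x)"
      using s[of i] B(1) by (intro approximable_sum approximable_scale approximable_indicator)
        (auto dest: simple_functionD)
    have "s i x = (\<Sum>y\<in>s i ` space \<mu>. y * indicator (B y) x)" if x: "x \<in> SU2" for x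
    proof -
      have "s i x = (\<Sum>y \<in> s i ` space \<mu>. indicator (s i -` {y} \<inter> space \<mu>) x *\<^sub>R y)"
        by (rule simple_function_indicator_representation_banach[OF s]) (simp add: space_haar x)
      also have "\<dots> = (\<Sum>y\<in>s i ` space \<mu>. y * indicator (B y) x)"
        using x B(2) by (intro sum.cong refl) (auto simp: space_haar indicator_def)
      finally show ?thesis .
    qed
    then show ?thesis by (rule approximable_cong[OF appr])
  qed
  moreover have "(\<lambda>n. Lp_norm \<mu> p (\<lambda>x. f x - s n x)) \<longlonglongrightarrow> 0"
  proof (rule Lp_norm_tendsto_zero[where g = "\<lambda>x. 3 * f x"])
    show "cmod (f x - s n x) \<le> cmod (3 * f x)" if "x \<in> space \<mu>" for n x
      using norm_triangle_ineq4[of "f x" "s n x"] bound[of x n] that by (simp add: space_haar norm_mult)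
  qed (use Lp_measurable[OF f] borel_measurable_simple_function[OF s] Lp_scale[OF f] lim in \<open>auto simp: space_haar\<close>)
  ultimately show ?thesis by (rule approximable_limit[OF f])
qed

lemma Lp_dense:
  assumes "f \<in> Lp_space \<mu> p" "\<epsilon> > 0"
  obtains h where "repfun h" "Lp_norm \<mu> p (\<lambda>x. f x - h x) < \<epsilon>"
  using approximable_Lp[OF assms(1)] assms(2) unfolding approximable_def by blast

end

section \<open>Convolution with class functions\<close>

text \<open>
  Every class function of SU(2) has the form \<open>\<kappa> (rtr g)\<close>.
\<close>

definition class_conv :: "(complex^2^2) measure \<Rightarrow> (real \<Rightarrow> real) \<Rightarrow> (complex^2^2 \<Rightarrow> complex) \<Rightarrow> complex^2^2 \<Rightarrow> complex"
  where "class_conv \<mu> \<kappa> f x = (LINT y|\<mu>. of_real (\<kappa> (rtr (x ** su2_inv y))) * f y)"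

context Lp_SU2
begin

lemma borel_measurable_entry [measurable]: "(\<lambda>g. g $ i $ j) \<in> borel_measurable \<mu>"
  by (rule borel_measurable_haar[OF continuous_on_entry])

lemma borel_measurable_pair_rtr [measurable]:
  "(\<lambda>(x, y). rtr (x ** su2_inv y)) \<in> borel_measurable (\<mu> \<Otimes>\<^sub>M \<mu>)"
  unfolding rtr_def matrix_matrix_mult_def by simp

lemma abs_rtr_quotient_le: "x \<in> SU2 \<Longrightarrow> y \<in> SU2 \<Longrightarrow> \<bar>rtr (x ** su2_inv y)\<bar> \<le> 2"
  by (intro abs_rtr_le SU2_mult SU2_su2_inv)

context
  fixes \<kappa> :: "real \<Rightarrow> real" and B :: real
  assumes \<kappa> [measurable]: "\<kappa> \<in> borel_measurable borel" and B: "\<And>t. \<bar>t\<bar> \<le> 2 \<Longrightarrow> \<bar>\<kappa> t\<bar> \<le> B"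
begin

lemma borel_measurable_quotient:
  "x \<in> SU2 \<Longrightarrow> (\<lambda>y. \<kappa> (rtr (x ** su2_inv y))) \<in> borel_measurable \<mu>"
  "y \<in> SU2 \<Longrightarrow> (\<lambda>x. \<kappa> (rtr (x ** su2_inv y))) \<in> borel_measurable \<mu>"
  unfolding rtr_def matrix_matrix_mult_def by simp_all

lemma kernel_bound: "x \<in> SU2 \<Longrightarrow> y \<in> SU2 \<Longrightarrow> \<bar>\<kappa> (rtr (x ** su2_inv y))\<bar> \<le> B"
  by (intro B abs_rtr_quotient_le)

lemma kernel_bound_nonneg: "B \<ge> 0"
  using B[of 0] by simp

text \<open>Both marginals reduce to left translation: the trace is cyclic, and on a quotient it may
  be read from either side.\<close>

lemma integral_kernel:
  "x \<in> SU2 \<Longrightarrow> (LINT y|\<mu>. \<bar>\<kappa> (rtr (x ** su2_inv y))\<bar>) = (LINT g|\<mu>. \<bar>\<kappa> (rtr g)\<bar>)"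
  "y \<in> SU2 \<Longrightarrow> (LINT x|\<mu>. \<bar>\<kappa> (rtr (x ** su2_inv y))\<bar>) = (LINT g|\<mu>. \<bar>\<kappa> (rtr g)\<bar>)"
proof -
  have meas: "(\<lambda>g. \<bar>\<kappa> (rtr g)\<bar>) \<in> borel_measurable \<mu>" by measurable
  show "(LINT y|\<mu>. \<bar>\<kappa> (rtr (x ** su2_inv y))\<bar>) = (LINT g|\<mu>. \<bar>\<kappa> (rtr g)\<bar>)" if "x \<in> SU2" for x
    using integral_translate[OF SU2_su2_inv[OF that] meas] by (simp add: rtr_mult_su2_inv)
  show "(LINT x|\<mu>. \<bar>\<kappa> (rtr (x ** su2_inv y))\<bar>) = (LINT g|\<mu>. \<bar>\<kappa> (rtr g)\<bar>)" if "y \<in> SU2" for y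
    using integral_translate[OF SU2_su2_inv[OF that] meas] by (simp add: rtr_mult_commute[of _ "su2_inv y"])
qed

lemma integrable_kernel_mult:
  fixes u :: "complex^2^2 \<Rightarrow> 'b::{real_normed_field, banach, second_countable_topology}"
  assumes "x \<in> SU2" "integrable \<mu> u"
  shows "integrable \<mu> (\<lambda>y. of_real (\<kappa> (rtr (x ** su2_inv y))) * u y)"
proof (rule Bochner_Integration.integrable_bound[of \<mu> "\<lambda>y. B * norm (u y)"])
  show "(\<lambda>y. of_real (\<kappa> (rtr (x ** su2_inv y))) * u y) \<in> borel_measurable \<mu>"
    using borel_measurable_quotient(1)[OF assms(1)] assms(2) by (auto intro: borel_measurable_integrable)
  show "AE y in \<mu>. norm (of_real (\<kappa> (rtr (x ** su2_inv y))) * u y) \<le> norm (B * norm (u y))"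
    using kernel_bound[OF assms(1)] kernel_bound_nonneg
    by (intro AE_I2) (simp add: norm_mult abs_mult space_haar mult_right_mono)
qed (use assms in simp)

lemma borel_measurable_class_conv:
  assumes [measurable]: "f \<in> borel_measurable \<mu>"
  shows "class_conv \<mu> \<kappa> f \<in> borel_measurable \<mu>"
  unfolding class_conv_def[abs_def]
  by (rule borel_measurable_lebesgue_integral) (simp add: split_beta')

lemma class_conv_add:
  assumes "x \<in> SU2" "f \<in> Lp_space \<mu> p" "g \<in> Lp_space \<mu> p"
  shows "class_conv \<mu> \<kappa> (\<lambda>y. f y + g y) x = class_conv \<mu> \<kappa> f x + class_conv \<mu> \<kappa> g x"
  unfolding class_conv_def distrib_left
  using assms by (intro Bochner_Integration.integral_add integrable_kernel_mult Lp_integrable)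

lemma class_conv_scale: "class_conv \<mu> \<kappa> (\<lambda>y. c * f y) x = c * class_conv \<mu> \<kappa> f x"
  unfolding class_conv_def by (subst mult.left_commute) simp

lemma norm_class_conv_le:
  assumes "x \<in> SU2" "f \<in> Lp_space \<mu> p"
  shows "cmod (class_conv \<mu> \<kappa> f x) \<le> (LINT y|\<mu>. \<bar>\<kappa> (rtr (x ** su2_inv y))\<bar> * cmod (f y))"
  unfolding class_conv_def
  by (rule order_trans[OF integral_norm_bound]) (simp add: norm_mult)

text \<open>Young's inequality for L^1 and L^p. Jensen at fixed x, with the kernel as a weight of
  mass at most \<open>L\<close>, contributes L^(p - 1); Fubini and the other marginal contribute the
  last factor \<open>L\<close>.\<close>

lemma Lp_norm_class_conv:
  assumes f: "f \<in> Lp_space \<mu> p" and L: "(LINT g|\<mu>. \<bar>\<kappa> (rtr g)\<bar>) \<le> L" "L > 0"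
  shows "class_conv \<mu> \<kappa> f \<in> Lp_space \<mu> p" "Lp_norm \<mu> p (class_conv \<mu> \<kappa> f) \<le> L * Lp_norm \<mu> p f"
proof -
  note measurable_integral = borel_measurable_lebesgue_integral
  interpret pair_sigma_finite \<mu> \<mu> by unfold_locales
  define K where "K x y = \<bar>\<kappa> (rtr (x ** su2_inv y))\<bar>" for x y
  define u where "u y = cmod (f y) powr p" for y
  have [measurable]: "f \<in> borel_measurable \<mu>" by (rule Lp_measurable[OF f])
  have u0: "u y \<ge> 0" for y by (simp add: u_def)
  have u: "integrable \<mu> u" unfolding u_def by (rule Lp_integrable_powr[OF f])
  have Ku: "integrable \<mu> (\<lambda>y. K x y * v y)" if "x \<in> SU2" "integrable \<mu> v" for x v
    using integrable_norm[OF integrable_kernel_mult[OF that]] integrable_abs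
    unfolding K_def
    by (rule_tac Bochner_Integration.integrable_bound[OF integrable_norm[OF integrable_kernel_mult[OF that]]])
      (use borel_measurable_quotient(1)[OF that(1)] that(2) in \<open>auto simp: abs_mult intro: borel_measurable_integrable\<close>)
  define J where "J x = (LINT y|\<mu>. K x y * u y)" for x
  have meas: "(\<lambda>(x, y). K x y * u y) \<in> borel_measurable (\<mu> \<Otimes>\<^sub>M \<mu>)"
    unfolding K_def u_def by (simp add: split_beta')
  have J0: "J x \<ge> 0" for x
    unfolding J_def K_def u_def by (intro integral_nonneg_AE AE_I2) simp
  have prod: "integrable (\<mu> \<Otimes>\<^sub>M \<mu>) (\<lambda>(x, y). K x y * u y)"
  proof (rule Fubini_integrable[OF meas])
    have "integrable \<mu> J"
    proof (rule integrable_bounded[where B = "B * integral\<^sup>L \<mu> u"])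
      show "J \<in> borel_measurable \<mu>"
        unfolding J_def[abs_def] by (rule measurable_integral[OF meas])
      fix x assume x: "x \<in> SU2"
      have "J x \<le> (LINT y|\<mu>. B * u y)"
        unfolding J_def using u Ku[OF x u] kernel_bound[OF x]
        by (intro integral_mono) (auto simp: K_def space_haar u0 intro!: mult_right_mono)
      then show "norm (J x) \<le> B * integral\<^sup>L \<mu> u" using J0[of x] by simp
    qed
    then show "integrable \<mu> (\<lambda>x. LINT y|\<mu>. norm (case (x, y) of (x, y) \<Rightarrow> K x y * u y))"
      by (simp add: J_def[abs_def] abs_mult) (simp add: K_def u_def)
    show "AE x in \<mu>. integrable \<mu> (\<lambda>y. case (x, y) of (x, y) \<Rightarrow> K x y * u y)"
      using Ku[OF _ u] by (intro AE_I2) (simp add: space_haar)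
  qed
  have J: "integrable \<mu> J"
    using integrable_fst'[OF prod] by (simp add: J_def[abs_def])
  have IJ: "integral\<^sup>L \<mu> J \<le> L * integral\<^sup>L \<mu> u"
  proof -
    have "integral\<^sup>L \<mu> J = (LINT y|\<mu>. LINT x|\<mu>. K x y * u y)"
      using Fubini_integral[of "\<lambda>x y. K x y * u y"] prod by (simp add: J_def[abs_def])
    also have "\<dots> = (LINT y|\<mu>. (LINT g|\<mu>. \<bar>\<kappa> (rtr g)\<bar>) * u y)"
      by (intro Bochner_Integration.integral_cong refl) (simp add: K_def integral_kernel space_haar)
    also have "\<dots> \<le> L * integral\<^sup>L \<mu> u"
      unfolding integral_mult_right_zero by (intro mult_right_mono L integral_nonneg_AE AE_I2 u0)
    finally show ?thesis .
  qed
  have le: "cmod (class_conv \<mu> \<kappa> f x) powr p \<le> L powr (p - 1) * J x" if x: "x \<in> space \<mu>" for x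
  proof -
    have x': "x \<in> SU2" using x by (simp add: space_haar)
    have "cmod (class_conv \<mu> \<kappa> f x) powr p \<le> (LINT y|\<mu>. K x y * cmod (f y)) powr p"
      using norm_class_conv_le[OF x' f] p by (intro powr_mono2) (auto simp: K_def)
    also have "\<dots> \<le> L powr (p - 1) * (LINT y|\<mu>. K x y * cmod (f y) powr p)"
    proof (rule integral_powr_jensen[OF p])
      show "integrable \<mu> (K x)" using Ku[OF x', of "\<lambda>_. 1"] by simp
      show "integrable \<mu> (\<lambda>y. K x y * cmod (f y))"
        by (rule Ku[OF x' integrable_norm[OF Lp_integrable[OF f]]])
      show "integrable \<mu> (\<lambda>y. K x y * cmod (f y) powr p)"
        using Ku[OF x' u] by (simp add: u_def)
      show "integral\<^sup>L \<mu> (K x) \<le> L" using L integral_kernel(1)[OF x'] by (simp add: K_def[abs_def])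
    qed (use L in \<open>auto simp: K_def\<close>)
    finally show ?thesis by (simp add: J_def u_def)
  qed
  have meas': "class_conv \<mu> \<kappa> f \<in> borel_measurable \<mu>" by (rule borel_measurable_class_conv) measurable
  show "class_conv \<mu> \<kappa> f \<in> Lp_space \<mu> p"
    using J by (intro Lp_spaceI[OF meas' _ le]) auto
  have "(LINT x|\<mu>. cmod (class_conv \<mu> \<kappa> f x) powr p) \<le> (LINT x|\<mu>. L powr (p - 1) * J x)"
    using J le J0 by (intro integral_mono') auto
  also have "\<dots> \<le> L powr (p - 1) * (L * integral\<^sup>L \<mu> u)"
    using IJ by (simp add: mult_left_mono)
  also have "\<dots> = (L * Lp_norm \<mu> p f) powr p"
    using L Lp_norm_nonneg by (simp add: powr_mult Lp_norm_powr u_def[abs_def] powr_diff)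
  finally show "Lp_norm \<mu> p (class_conv \<mu> \<kappa> f) \<le> L * Lp_norm \<mu> p f"
    using L Lp_norm_nonneg[of f] by (subst Lp_norm_le_iff) auto
qed

lemma bounded_operator_class_conv:
  "bounded_operator_on (Lp_space \<mu> p) (Lp_norm \<mu> p) (class_conv \<mu> \<kappa>)"
proof -
  define L where "L = (LINT g|\<mu>. \<bar>\<kappa> (rtr g)\<bar>) + 1"
  have "(LINT g|\<mu>. \<bar>\<kappa> (rtr g)\<bar>) \<ge> 0" by (intro integral_nonneg_AE AE_I2) simp
  then have L: "(LINT g|\<mu>. \<bar>\<kappa> (rtr g)\<bar>) \<le> L" "L > 0" unfolding L_def by linarith+
  note conv = Lp_norm_class_conv[OF _ L]
  have "Lp_norm \<mu> p (class_conv \<mu> \<kappa> f) = 0" if "f \<in> Lp_space \<mu> p" "Lp_norm \<mu> p f = 0" for f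
    using conv(2)[OF that(1)] that(2) Lp_norm_nonneg[of "class_conv \<mu> \<kappa> f"] by simp
  moreover have "Lp_norm \<mu> p (\<lambda>x. class_conv \<mu> \<kappa> (\<lambda>y. f y + g y) x - (class_conv \<mu> \<kappa> f x + class_conv \<mu> \<kappa> g x)) = 0"
    if "f \<in> Lp_space \<mu> p" "g \<in> Lp_space \<mu> p" for f g
    using Lp_norm_cong[of _ "\<lambda>_. 0"] Lp_norm_zero class_conv_add[OF _ that] by (simp add: space_haar)
  ultimately show ?thesis
    unfolding bounded_operator_on_def linear_operator_on_def
    using conv Lp_norm_zero by (auto simp: class_conv_scale intro!: exI[of _ L])
qed

end

lemma borel_measurable_cheb [measurable]: "(\<lambda>t::real. cheb k t) \<in> borel_measurable borel"
  by (intro borel_measurable_continuous_onI continuous_on_cheb)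

lemma class_conv_cheb_mono_coeff:
  assumes x: "x \<in> SU2" and i: "i \<le> j + n"
  shows "class_conv \<mu> (\<lambda>t. \<Sum>k<K. c k * cheb k t) (mono_coeff i j n) x =
    (if j + n < K then of_real (c (j + n)) / of_nat (j + n + 1) else 0) * mono_coeff i j n x"
proof -
  have int: "integrable \<mu> (\<lambda>y. of_real (c k) * (of_real (cheb k (rtr (x ** su2_inv y))) * mono_coeff i j n y))" for k
    by (intro integrable_mult_right integrable_kernel_mult[where \<kappa> = "cheb k" and B = "real k + 1"]
        integrable_repfun repfun.mono x abs_cheb_le) (use borel_measurable_cheb in auto)
  have "class_conv \<mu> (\<lambda>t. \<Sum>k<K. c k * cheb k t) (mono_coeff i j n) x =
      (LINT y|\<mu>. (\<Sum>k<K. of_real (c k) * (of_real (cheb k (rtr (x ** su2_inv y))) * mono_coeff i j n y)))"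
    unfolding class_conv_def by (simp add: sum_distrib_right mult.assoc)
  also have "\<dots> = (\<Sum>k<K. of_real (c k) * (if k = j + n then mono_coeff i j n x / of_nat (k + 1) else 0))"
    using int by (subst Bochner_Integration.integral_sum) (auto simp: integral_cheb_mono_coeff[OF x i] simp del: of_nat_add)
  also have "\<dots> = (if j + n < K then of_real (c (j + n)) / of_nat (j + n + 1) else 0) * mono_coeff i j n x"
    by (simp add: if_distrib cong: if_cong)
  finally show ?thesis .
qed

text \<open>The character at x y^-1 is the trace of the product of the matrices at x and y^-1, so
  the kernel separates into finitely many products of a function of x and one of y.\<close>

lemma class_conv_finite_rank:
  fixes c :: "nat \<Rightarrow> real" and K :: nat
  defines "I \<equiv> Sigma {..<K} (\<lambda>k. {..k} \<times> {..k})"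
  obtains \<psi> where "\<And>z. z \<in> I \<Longrightarrow> \<psi> z \<in> dual_space (Lp_space \<mu> p) (Lp_norm \<mu> p)"
    and "\<And>f x. f \<in> Lp_space \<mu> p \<Longrightarrow> x \<in> SU2 \<Longrightarrow> class_conv \<mu> (\<lambda>t. \<Sum>k<K. c k * cheb k t) f x =
      (\<Sum>z\<in>I. \<psi> z f * (case z of (k, i, l) \<Rightarrow> mono_coeff i l (k - l) x))"
proof -
  define u where "u = (\<lambda>(k, i, l) y. of_real (c k) * mono_coeff l i (k - i) (su2_inv y))"
  define \<psi> where "\<psi> z f = (LINT y|\<mu>. u z y * f y)" for z f
  have cont: "continuous_on SU2 (u z)" for z
  proof -
    have "continuous_on SU2 su2_inv" by (intro continuous_intros)
    then show ?thesis
      by (auto simp: u_def split: prod.split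
          intro!: continuous_intros continuous_on_compose2[OF continuous_on_mono_coeff[of UNIV]])
  qed
  have meas: "u z \<in> borel_measurable \<mu>" for z by (rule borel_measurable_haar[OF cont])
  have "\<exists>B. \<forall>y\<in>SU2. cmod (u z y) \<le> B" for z
    using compact_imp_bounded[OF compact_continuous_image[OF cont compact_SU2]] by (auto simp: bounded_iff)
  then obtain B where B: "\<And>z y. y \<in> SU2 \<Longrightarrow> cmod (u z y) \<le> B z" by metis
  have B0: "B z \<ge> 0" for z using B[OF su2_rot_SU2] norm_ge_zero order_trans by blast
  have int: "integrable \<mu> (\<lambda>y. u z y * f y)" if "f \<in> Lp_space \<mu> p" for z f
  proof (rule Bochner_Integration.integrable_bound[of \<mu> "\<lambda>y. B z * cmod (f y)"])
    show "integrable \<mu> (\<lambda>y. B z * cmod (f y))"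
      using Lp_integrable[OF that] by simp
    show "(\<lambda>y. u z y * f y) \<in> borel_measurable \<mu>"
      by (rule borel_measurable_times[OF meas Lp_measurable[OF that]])
    show "AE y in \<mu>. norm (u z y * f y) \<le> norm (B z * cmod (f y))"
      using B B0 by (intro AE_I2) (simp add: norm_mult space_haar mult_right_mono)
  qed
  show thesis
  proof
    fix z
    have "cmod (\<psi> z f) \<le> B z * Lp_norm \<mu> p f" if f: "f \<in> Lp_space \<mu> p" for f
    proof -
      have "cmod (\<psi> z f) \<le> (LINT y|\<mu>. B z * cmod (f y))"
        unfolding \<psi>_def
      proof (rule order_trans[OF integral_norm_bound integral_mono])
        show "cmod (u z y * f y) \<le> B z * cmod (f y)" if "y \<in> space \<mu>" for y
          using B that by (simp add: norm_mult space_haar mult_right_mono)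
      qed (use int[OF f] Lp_integrable[OF f] in simp_all)
      also have "\<dots> \<le> B z * Lp_norm \<mu> p f"
        using integral_norm_le_Lp_norm[OF f] B0 by (simp add: mult_left_mono)
      finally show ?thesis .
    qed
    moreover have "\<psi> z (\<lambda>y. f y + g y) = \<psi> z f + \<psi> z g" if "f \<in> Lp_space \<mu> p" "g \<in> Lp_space \<mu> p" for f g
      unfolding \<psi>_def distrib_left using int that by simp
    moreover have "\<psi> z (\<lambda>y. d * f y) = d * \<psi> z f" for f d
      unfolding \<psi>_def mult.left_commute[of _ d] by simp
    ultimately show "\<psi> z \<in> dual_space (Lp_space \<mu> p) (Lp_norm \<mu> p)"
      unfolding dual_space_def by blast
  next
    fix f x assume f: "f \<in> Lp_space \<mu> p" and x: "x \<in> SU2"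
    have kernel: "of_real (\<Sum>k<K. c k * cheb k (rtr (x ** su2_inv y))) =
        (\<Sum>z\<in>I. (case z of (k, i, l) \<Rightarrow> mono_coeff i l (k - l) x) * u z y)" if "y \<in> SU2" for y
    proof -
      have "complex_of_real (cheb k (rtr (x ** su2_inv y))) =
          (\<Sum>i\<le>k. \<Sum>l\<le>k. mono_coeff i l (k - l) x * mono_coeff l i (k - i) (su2_inv y))" for k
        unfolding trace_mono_coeff_rtr[OF SU2_mult[OF x SU2_su2_inv[OF that]], symmetric] mono_coeff_mult
        by (intro sum.cong) auto
      then have "of_real (\<Sum>k<K. c k * cheb k (rtr (x ** su2_inv y))) =
          (\<Sum>k<K. \<Sum>i\<le>k. \<Sum>l\<le>k. mono_coeff i l (k - l) x * u (k, i, l) y)"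
        by (simp add: sum_distrib_left u_def mult_ac)
      also have "\<dots> = (\<Sum>z\<in>I. (case z of (k, i, l) \<Rightarrow> mono_coeff i l (k - l) x) * u z y)"
        unfolding I_def sum.cartesian_product by (subst sum.Sigma) (auto intro!: sum.cong)
      finally show ?thesis .
    qed
    have "class_conv \<mu> (\<lambda>t. \<Sum>k<K. c k * cheb k t) f x =
        (LINT y|\<mu>. (\<Sum>z\<in>I. (case z of (k, i, l) \<Rightarrow> mono_coeff i l (k - l) x) * (u z y * f y)))"
      unfolding class_conv_def
      by (intro Bochner_Integration.integral_cong refl)
        (simp add: kernel space_haar sum_distrib_right mult.assoc del: of_real_sum)
    also have "\<dots> = (\<Sum>z\<in>I. (case z of (k, i, l) \<Rightarrow> mono_coeff i l (k - l) x) * \<psi> z f)"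
      unfolding \<psi>_def using int[OF f] by (subst Bochner_Integration.integral_sum) auto
    finally show "class_conv \<mu> (\<lambda>t. \<Sum>k<K. c k * cheb k t) f x =
      (\<Sum>z\<in>I. \<psi> z f * (case z of (k, i, l) \<Rightarrow> mono_coeff i l (k - l) x))"
      by (simp add: mult.commute)
  qed
qed

end

section \<open>Dyadic decomposition of a smooth multiplier\<close>

lemma two_power_powr: "real (2 ^ j) powr s = (2 powr s) ^ j"
proof -
  have "real (2 ^ j) = 2 powr real j" by (simp add: powr_realpow)
  moreover have "(2 powr s) ^ j = (2 powr s) powr real j" by (simp add: powr_realpow)
  ultimately show ?thesis by (simp only: powr_powr mult.commute)
qed

text \<open>A symbol of order -\<alpha>, with differences only up to order two because the L^1
  estimate uses no more. Decay is expressed by a lower bound \<open>N\<close> of the argument, as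
  each dyadic block needs one bound for its whole range. The argument is the dimension and so starts
  at 1.\<close>

locale smooth_symbol =
  fixes m :: "nat \<Rightarrow> real" and C \<alpha> :: real
  assumes C: "C > 0"
    and m0: "\<And>N n. 1 \<le> N \<Longrightarrow> N \<le> n \<Longrightarrow> \<bar>m n\<bar> \<le> C * real N powr (- \<alpha>)"
    and m1: "\<And>N n. 1 \<le> N \<Longrightarrow> N \<le> n \<Longrightarrow> \<bar>m (n + 1) - m n\<bar> \<le> C * real N powr (- \<alpha> - 1)"
    and m2: "\<And>N n. 1 \<le> N \<Longrightarrow> N < n \<Longrightarrow> \<bar>m (n + 1) - 2 * m n + m (n - 1)\<bar> \<le> C * real N powr (- \<alpha> - 2)"
    and \<alpha>: "\<alpha> > 0"
begin

text \<open>
  \<open>tail N\<close> agrees with \<open>m\<close> from \<open>N\<close> on and continues it linearly below \<open>N\<close>, so that its second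
  difference has no jump at \<open>N\<close>.
\<close>

definition tail :: "nat \<Rightarrow> nat \<Rightarrow> real"
  where "tail N n = (if n < N then m N + (real N - real n) * (m N - m (N + 1)) else m n)"

text \<open>The line passes through the values of \<open>m\<close> at both N and N + 1, so the
  second difference at n = N still sees only the line.\<close>

lemma tail_linear: "n \<le> N + 1 \<Longrightarrow> tail N n = m N + (real N - real n) * (m N - m (N + 1))"
  by (cases "n < N"; cases "n = N") (auto simp: tail_def not_less le_Suc_eq)

lemma powr_shift: "N \<ge> 1 \<Longrightarrow> real N * real N powr (x - 1) = real N powr x"
  by (simp add: powr_diff)

lemma abs_tail_le:
  assumes "1 \<le> N"
  shows "\<bar>tail N n\<bar> \<le> 2 * C * real N powr (- \<alpha>)"
proof (cases "n < N")
  case True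
  have "\<bar>tail N n\<bar> \<le> \<bar>m N\<bar> + \<bar>(real N - real n) * (m N - m (N + 1))\<bar>"
    using True by (simp add: tail_def)
  also have "\<dots> \<le> C * real N powr (- \<alpha>) + real N * (C * real N powr (- \<alpha> - 1))"
    unfolding abs_mult using m0[OF assms, of N] m1[OF assms, of N] True
    by (intro add_mono mult_mono) (auto simp: abs_minus_commute)
  also have "\<dots> = 2 * C * real N powr (- \<alpha>)"
    using powr_shift[OF assms, of "- \<alpha>"] by (simp add: mult.left_commute[of _ C])
  finally show ?thesis .
next
  case False
  have "\<bar>m n\<bar> \<le> C * real N powr (- \<alpha>)" using False by (intro m0 assms) simp
  moreover have "0 \<le> C * real N powr (- \<alpha>)" using C by simp
  ultimately show ?thesis using False by (simp add: tail_def)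
qed

text \<open>By the product rule this is n times the second difference of \<open>tail\<close> plus
  two first differences. Up to N linearity leaves only the slope. Beyond N, the bound n \<le> 2 N
  raises the order -\<alpha> - 2 to -\<alpha> - 1, and 2 + 1 + 1 gives the factor 4.\<close>

lemma second_difference_tail:
  assumes "1 \<le> N" "1 \<le> n" "n \<le> 2 * N"
  shows "\<bar>2 * (real n * tail N n) - real (n - 1) * tail N (n - 1) - real (n + 1) * tail N (n + 1)\<bar>
    \<le> 4 * C * real N powr (- \<alpha> - 1)"
proof (cases "n \<le> N")
  case True
  have "2 * (real n * tail N n) - real (n - 1) * tail N (n - 1) - real (n + 1) * tail N (n + 1) =
      2 * (m N - m (N + 1))"
    using True \<open>1 \<le> n\<close> by (simp add: tail_linear of_nat_diff algebra_simps)
  moreover have "\<bar>m N - m (N + 1)\<bar> \<le> C * real N powr (- \<alpha> - 1)"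
    using m1[OF assms(1), of N] by (simp add: abs_minus_commute)
  moreover have "0 \<le> C * real N powr (- \<alpha> - 1)" using C by simp
  ultimately show ?thesis by simp
next
  case False
  have triangle: "\<bar>- (a * b) - c - d\<bar> \<le> a * \<bar>b\<bar> + \<bar>c\<bar> + \<bar>d\<bar>" if "a \<ge> 0" for a b c d :: real
  proof -
    have "\<bar>a * b\<bar> = a * \<bar>b\<bar>" using that by (simp add: abs_mult)
    then show ?thesis by linarith
  qed
  have "2 * (real n * tail N n) - real (n - 1) * tail N (n - 1) - real (n + 1) * tail N (n + 1) =
      - (real n * (m (n + 1) - 2 * m n + m (n - 1))) - (m (n + 1) - m n) - (m (n - 1 + 1) - m (n - 1))"
  proof -
    obtain k where "n = Suc k" "N \<le> k" using False by (cases n) auto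
    then show ?thesis by (simp add: tail_def algebra_simps)
  qed
  also have "\<bar>\<dots>\<bar> \<le> real n * \<bar>m (n + 1) - 2 * m n + m (n - 1)\<bar> + \<bar>m (n + 1) - m n\<bar> + \<bar>m (n - 1 + 1) - m (n - 1)\<bar>"
    by (rule triangle) simp
  also have "\<dots> \<le> real (2 * N) * (C * real N powr (- \<alpha> - 2)) + C * real N powr (- \<alpha> - 1) + C * real N powr (- \<alpha> - 1)"
    using assms False by (intro add_mono mult_mono m1 m2) auto
  also have "\<dots> = 4 * C * real N powr (- \<alpha> - 1)"
  proof -
    have "- \<alpha> - 1 - 1 = - \<alpha> - 2" by simp
    from powr_shift[OF assms(1), of "- \<alpha> - 1", unfolded this] show ?thesis
      by (simp add: mult.left_commute[of _ C])
  qed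
  finally show ?thesis .
qed

text \<open>The factor \<open>n\<close> is the dimension, by which convolution with a character
  divides (\<open>integral_cheb_mono_coeff\<close>). Differences of tails at N and 2 N telescope
  over dyadic N and vanish from 2 N on.\<close>

definition block_coeff :: "nat \<Rightarrow> nat \<Rightarrow> real"
  where "block_coeff N n = real n * (tail N n - tail (2 * N) n)"

lemma powr_double_le: "1 \<le> N \<Longrightarrow> x \<le> 0 \<Longrightarrow> real (2 * N) powr x \<le> real N powr x"
  by (intro powr_mono2') auto

lemma abs_block_coeff_le:
  assumes "1 \<le> N" "n \<le> 2 * N"
  shows "\<bar>block_coeff N n\<bar> \<le> (real N)\<^sup>2 * (8 * C * real N powr (- \<alpha> - 1))"
proof -
  have "\<bar>tail N n - tail (2 * N) n\<bar> \<le> 2 * C * real N powr (- \<alpha>) + 2 * C * real (2 * N) powr (- \<alpha>)"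
    using abs_tail_le[of N n] abs_tail_le[of "2 * N" n] assms by linarith
  also have "\<dots> \<le> 4 * C * real N powr (- \<alpha>)"
    using powr_double_le[OF assms(1), of "- \<alpha>"] \<alpha> C by simp
  finally have "\<bar>block_coeff N n\<bar> \<le> real (2 * N) * (4 * C * real N powr (- \<alpha>))"
    unfolding block_coeff_def abs_mult using assms by (intro mult_mono) auto
  also have "\<dots> = (real N)\<^sup>2 * (8 * C * real N powr (- \<alpha> - 1))"
    using powr_shift[OF assms(1), of "- \<alpha>"] by (simp add: power2_eq_square mult_ac)
  finally show ?thesis .
qed

lemma second_difference_block_coeff:
  assumes "1 \<le> N" "1 \<le> n" "n \<le> 2 * N"
  shows "\<bar>2 * block_coeff N n - block_coeff N (n - 1) - block_coeff N (n + 1)\<bar> \<le> 8 * C * real N powr (- \<alpha> - 1)"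
proof -
  define X where "X M = 2 * (real n * tail M n) - real (n - 1) * tail M (n - 1) - real (n + 1) * tail M (n + 1)" for M
  have "2 * block_coeff N n - block_coeff N (n - 1) - block_coeff N (n + 1) = X N - X (2 * N)"
    by (simp add: block_coeff_def X_def algebra_simps)
  moreover have "\<bar>X N\<bar> \<le> 4 * C * real N powr (- \<alpha> - 1)"
    unfolding X_def by (rule second_difference_tail[OF assms])
  moreover have "\<bar>X (2 * N)\<bar> \<le> 4 * C * real (2 * N) powr (- \<alpha> - 1)"
    unfolding X_def using assms by (intro second_difference_tail) auto
  moreover have "4 * C * real (2 * N) powr (- \<alpha> - 1) \<le> 4 * C * real N powr (- \<alpha> - 1)"
    using powr_double_le[OF assms(1), of "- \<alpha> - 1"] \<alpha> C by (intro mult_left_mono) auto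
  ultimately show ?thesis by linarith
qed

lemma block_coeff_ge: "n \<ge> 2 * N \<Longrightarrow> block_coeff N n = 0"
  by (simp add: block_coeff_def tail_def)

lemma sum_block_coeff: "n \<ge> 1 \<Longrightarrow> (\<Sum>j<J. block_coeff (2 ^ j) n / real n) = m n - tail (2 ^ J) n"
proof (induction J)
  case 0
  then show ?case by (simp add: tail_def)
qed (simp add: block_coeff_def)

lemma tail_tendsto_zero: "(\<lambda>J. tail (2 ^ J) n) \<longlonglongrightarrow> 0"
proof (rule Lim_null_comparison)
  show "\<forall>\<^sub>F J in sequentially. norm (tail (2 ^ J) n) \<le> 2 * C * (2 powr (- \<alpha>)) ^ J"
    using abs_tail_le[of "2 ^ _" n] unfolding two_power_powr by (intro always_eventually allI) simp
  have "\<bar>2 powr (- \<alpha>)\<bar> < (1::real)" using \<alpha> by (simp add: powr_less_one)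
  then have "(\<lambda>J. 2 * C * (2 powr (- \<alpha>)) ^ J) \<longlonglongrightarrow> 2 * C * 0"
    by (intro tendsto_mult tendsto_const LIMSEQ_power_zero) simp
  then show "(\<lambda>J. 2 * C * (2 powr (- \<alpha>)) ^ J) \<longlonglongrightarrow> 0" by simp
qed

definition block_kernel :: "nat \<Rightarrow> real \<Rightarrow> real"
  where "block_kernel j t = (\<Sum>k<2 * 2 ^ j. block_coeff (2 ^ j) (k + 1) * cheb k t)"

lemma borel_measurable_block_kernel [measurable]: "block_kernel j \<in> borel_measurable borel"
  unfolding block_kernel_def[abs_def]
  by (intro borel_measurable_sum borel_measurable_times borel_measurable_const
      borel_measurable_continuous_onI continuous_on_cheb)

text \<open>A crude count: 2 N terms with characters of size at most 2 N. It serves integrability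
  and, for \<alpha> > 3, the uniform convergence of the full kernel; the operator norms rest on the
  L^1 bound instead.\<close>

lemma abs_block_kernel_le:
  assumes t: "\<bar>t\<bar> \<le> 2"
  shows "\<bar>block_kernel j t\<bar> \<le> 32 * C * (2 powr (3 - \<alpha>)) ^ j"
proof -
  define N where "N = (2 ^ j :: nat)"
  have N: "1 \<le> N" by (simp add: N_def)
  have "\<bar>block_kernel j t\<bar> \<le> (\<Sum>k<2 * N. \<bar>block_coeff N (k + 1)\<bar> * \<bar>cheb k t\<bar>)"
    unfolding block_kernel_def N_def by (rule order_trans[OF sum_abs]) (simp add: abs_mult)
  also have "\<dots> \<le> (\<Sum>k<2 * N. ((real N)\<^sup>2 * (8 * C * real N powr (- \<alpha> - 1))) * real (2 * N))"
  proof (intro sum_mono mult_mono)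
    fix k assume k: "k \<in> {..<2 * N}"
    show "\<bar>block_coeff N (k + 1)\<bar> \<le> (real N)\<^sup>2 * (8 * C * real N powr (- \<alpha> - 1))"
      using k by (intro abs_block_coeff_le N) simp
    show "\<bar>cheb k t\<bar> \<le> real (2 * N)"
      using abs_cheb_le[OF t, of k] k by simp
  qed (use C in auto)
  also have "\<dots> = 32 * C * (real N ^ 4 * real N powr (- \<alpha> - 1))"
    by (simp add: power2_eq_square power4_eq_xxxx)
  also have "real N ^ 4 * real N powr (- \<alpha> - 1) = real N powr (3 - \<alpha>)"
  proof -
    have "real N ^ 4 = real N powr 4" using N by simp
    then show ?thesis by (simp only: powr_add[symmetric]) simp
  qed
  also have "\<dots> = (2 powr (3 - \<alpha>)) ^ j"
    unfolding N_def by (rule two_power_powr)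
  finally show ?thesis .
qed

end

section \<open>The symbol of the Bessel potential\<close>

lemma DERIV_powr_quadratic:
  fixes s x :: real
  shows "((\<lambda>x. ((x\<^sup>2 + 3) / 4) powr s) has_real_derivative (s * ((x\<^sup>2 + 3) / 4) powr (s - 1) * (x / 2))) (at x)"
proof -
  have "(x\<^sup>2 + 3) / 4 > 0" by (simp add: add_nonneg_pos)
  then show ?thesis
    by (auto intro!: derivative_eq_intros simp: powr_diff field_simps)
qed

text \<open>With n = 2l + 1 the base (n^2 + 3) / 4 is the eigenvalue 1 + l(l + 1). The difference
  bounds come from the first two derivatives by the mean value theorem.\<close>

lemma smooth_symbol_bessel:
  assumes "\<alpha> > 0"
  obtains C where "smooth_symbol (\<lambda>n. (((real n)\<^sup>2 + 3) / 4) powr (- \<alpha> / 2)) C \<alpha>"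
proof
  define \<beta> where "\<beta> = \<alpha> / 2"
  have \<beta>: "\<beta> > 0" using assms by (simp add: \<beta>_def)
  define y where "y x = (x\<^sup>2 + 3) / 4" for x :: real
  define f where "f x = y x powr (- \<beta>)" for x
  define f' where "f' x = - \<beta> * y x powr (- \<beta> - 1) * (x / 2)" for x
  define f'' where "f'' x = - \<beta> * (((- \<beta> - 1) * y x powr (- \<beta> - 2) * (x / 2)) * (x / 2) + y x powr (- \<beta> - 1) * (1 / 2))" for x
  \<comment> \<open>The first factor dominates the constants 1, \<beta> and \<beta> (\<beta> + 1) +
    \<beta> / 2 of the three bounds; the power of 4 comes from y \<ge> N^2 / 4.\<close>
  define C where "C = (1 + \<beta> + \<beta> * (\<beta> + 2)) * 4 powr (\<beta> + 1)"
  have y: "y x > 0" for x by (simp add: y_def add_nonneg_pos)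
  have f: "(f has_real_derivative f' x) (at x)" for x
    unfolding f_def f'_def y_def by (rule DERIV_powr_quadratic)
  have f': "(f' has_real_derivative f'' x) (at x)" for x
  proof -
    have "((\<lambda>x. x / 2) has_real_derivative 1 / 2) (at x)"
      by (auto intro!: derivative_eq_intros)
    from DERIV_cmult[OF DERIV_mult[OF DERIV_powr_quadratic[of "- \<beta> - 1" x] this], of "- \<beta>"]
    moreover have "- \<beta> - 1 - 1 = - \<beta> - 2" by simp
    ultimately show ?thesis unfolding f'_def[abs_def] f''_def y_def by (simp only: mult_ac)
  qed
  have y_powr: "y x powr (- s) \<le> 4 powr s * real N powr (- 2 * s)" if "s \<ge> 0" "1 \<le> N" "real N \<le> x" for s N x
  proof -
    have "(real N)\<^sup>2 / 4 \<le> y x" using that by (simp add: y_def) (metis add_increasing2 of_nat_0_le_iff power_mono zero_le_numeral)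
    then have "y x powr (- s) \<le> ((real N)\<^sup>2 / 4) powr (- s)"
      using that by (intro powr_mono2') auto
    also have "\<dots> = 4 powr s * real N powr (- 2 * s)"
    proof -
      have "(real N)\<^sup>2 = real N powr 2" using that by simp
      then have "((real N)\<^sup>2 / 4) powr (- s) = real N powr (- 2 * s) / 4 powr (- s)"
        by (simp only: powr_divide powr_powr) simp
      then show ?thesis by (simp add: powr_minus_divide)
    qed
    finally show ?thesis .
  qed
  have four: "4 powr s \<le> (4::real) powr (\<beta> + 1)" if "s \<le> \<beta> + 1" for s
    using that by (intro powr_mono) auto
  have C_bound: "c * (4 powr s * real N powr e) \<le> C * real N powr e"
    if "0 \<le> c" "c \<le> 1 + \<beta> + \<beta> * (\<beta> + 2)" "s \<le> \<beta> + 1" for c s e and N :: nat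
    using that \<beta> four[OF that(3)] unfolding C_def mult.assoc[symmetric]
    by (intro mult_right_mono mult_mono) auto
  have b0: "\<bar>f x\<bar> \<le> C * real N powr (- \<alpha>)" if "1 \<le> N" "real N \<le> x" for N x
    using y_powr[OF _ that, of \<beta>] C_bound[of 1 \<beta> N "- \<alpha>"] \<beta> by (simp add: f_def \<beta>_def)
  have b1: "\<bar>f' x\<bar> \<le> C * real N powr (- \<alpha> - 1)" if "1 \<le> N" "real N \<le> x" for N x
  proof -
    \<comment> \<open>Trades the factor x / 2 for half a power of \<open>y x\<close>.\<close>
    have "x / 2 = ((x / 2)\<^sup>2) powr (1/2)" using that by (simp add: powr_half_sqrt)
    also have "\<dots> \<le> y x powr (1/2)" using that by (intro powr_mono2) (auto simp: y_def power_divide)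
    finally have "\<bar>f' x\<bar> \<le> \<beta> * (y x powr (- \<beta> - 1) * y x powr (1/2))"
      using \<beta> that by (simp add: f'_def abs_mult mult_left_mono)
    also have "\<dots> = \<beta> * y x powr (- (\<beta> + 1/2))"
    proof -
      have "- \<beta> - 1 + 1/2 = - (\<beta> + 1/2)" by simp
      then show ?thesis by (simp only: powr_add[symmetric])
    qed
    also have "\<dots> \<le> \<beta> * (4 powr (\<beta> + 1/2) * real N powr (- 2 * (\<beta> + 1/2)))"
      using \<beta> by (intro mult_left_mono y_powr[OF _ that]) simp_all
    also have "\<dots> \<le> C * real N powr (- 2 * (\<beta> + 1/2))" using \<beta> by (intro C_bound) auto
    also have "- 2 * (\<beta> + 1/2) = - \<alpha> - 1" by (simp add: \<beta>_def)
    finally show ?thesis .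
  qed
  have b2: "\<bar>f'' x\<bar> \<le> C * real N powr (- \<alpha> - 2)" if "1 \<le> N" "real N \<le> x" for N x
  proof -
    have "y x powr (- \<beta> - 2) * (x / 2)\<^sup>2 \<le> y x powr (- \<beta> - 2) * y x powr 1"
      using y[of x] by (intro mult_left_mono) (auto simp: y_def power_divide)
    then have le: "y x powr (- \<beta> - 2) * (x / 2)\<^sup>2 \<le> y x powr (- \<beta> - 1)"
    proof -
      have "- \<beta> - 2 + 1 = - \<beta> - 1" by simp
      then show ?thesis
        using \<open>y x powr (- \<beta> - 2) * (x / 2)\<^sup>2 \<le> y x powr (- \<beta> - 2) * y x powr 1\<close>
        by (simp only: powr_add[symmetric])
    qed
    have "f'' x = \<beta> * (\<beta> + 1) * (y x powr (- \<beta> - 2) * (x / 2)\<^sup>2) - \<beta> / 2 * y x powr (- \<beta> - 1)"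
      by (simp add: f''_def power2_eq_square algebra_simps)
    also have "\<bar>\<dots>\<bar> \<le> \<beta> * (\<beta> + 1) * (y x powr (- \<beta> - 2) * (x / 2)\<^sup>2) + \<beta> / 2 * y x powr (- \<beta> - 1)"
      using \<beta> by (intro order_trans[OF abs_triangle_ineq4]) (simp add: abs_mult)
    also have "\<dots> \<le> \<beta> * (\<beta> + 1) * y x powr (- \<beta> - 1) + \<beta> / 2 * y x powr (- \<beta> - 1)"
      using le \<beta> by (intro add_mono mult_left_mono) auto
    also have "\<dots> = (\<beta> * (\<beta> + 1) + \<beta> / 2) * y x powr (- \<beta> - 1)"
      by (rule distrib_right[symmetric])
    also have "- \<beta> - 1 = - (\<beta> + 1)" by simp
    also have "(\<beta> * (\<beta> + 1) + \<beta> / 2) * y x powr (- (\<beta> + 1)) \<le> (\<beta> * (\<beta> + 1) + \<beta> / 2) * (4 powr (\<beta> + 1) * real N powr (- 2 * (\<beta> + 1)))"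
      using \<beta> by (intro mult_left_mono y_powr[OF _ that]) simp_all
    also have "\<dots> \<le> C * real N powr (- 2 * (\<beta> + 1))"
      using \<beta> by (intro C_bound) (auto simp: algebra_simps)
    also have "- 2 * (\<beta> + 1) = - \<alpha> - 2" by (simp add: \<beta>_def)
    finally show ?thesis .
  qed
  have m_eq: "(((real n)\<^sup>2 + 3) / 4) powr (- \<alpha> / 2) = f (real n)" for n
    by (simp add: f_def y_def \<beta>_def)
  show "smooth_symbol (\<lambda>n. (((real n)\<^sup>2 + 3) / 4) powr (- \<alpha> / 2)) C \<alpha>"
    unfolding m_eq
  proof
    show "C > 0" using \<beta> by (simp add: C_def add_pos_nonneg)
    fix N n :: nat assume N: "1 \<le> N"
    show "\<bar>f (real n)\<bar> \<le> C * real N powr (- \<alpha>)" if "N \<le> n"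
      using b0[OF N] that by simp
    show "\<bar>f (real (n + 1)) - f (real n)\<bar> \<le> C * real N powr (- \<alpha> - 1)" if "N \<le> n"
    proof -
      obtain z where "real n < z" "f (real (n + 1)) - f (real n) = (real (n + 1) - real n) * f' z"
        using MVT2[of "real n" "real (n + 1)" f f'] f by auto
      then show ?thesis using b1[OF N, of z] that by simp
    qed
    show "\<bar>f (real (n + 1)) - 2 * f (real n) + f (real (n - 1))\<bar> \<le> C * real N powr (- \<alpha> - 2)" if "N < n"
    proof -
      have n: "real (n - 1) = real n - 1" using that by (simp add: of_nat_diff)
      \<comment> \<open>The second difference is a first difference of x \<mapsto> f (x + 1) - f x,
        so the mean value theorem applies twice.\<close>
      have "((\<lambda>x. f (x + 1) - f x) has_real_derivative f' (x + 1) - f' x) (at x)" for x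
        using DERIV_shift[of f "f' (x + 1)" x 1] f by (intro DERIV_diff) auto
      then obtain z where z: "real n - 1 < z"
          "(f (real n + 1) - f (real n)) - (f (real n - 1 + 1) - f (real n - 1)) = (real n - (real n - 1)) * (f' (z + 1) - f' z)"
        using MVT2[of "real n - 1" "real n" "\<lambda>x. f (x + 1) - f x" "\<lambda>x. f' (x + 1) - f' x"] by auto
      obtain w where w: "z < w" "f' (z + 1) - f' z = (z + 1 - z) * f'' w"
        using MVT2[of z "z + 1" f' f''] f' by auto
      have "real N \<le> w" using that z(1) w(1) by linarith
      then show ?thesis using b2[OF N, of w] z(2) w(2) unfolding n by (simp add: algebra_simps)
    qed
  qed (rule assms)
qed

section \<open>The Bessel potential\<close>

context Lp_unit_measure
begin

lemma Lp_norm_diff_le: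
  assumes "f \<in> Lp_space M p" "g \<in> Lp_space M p"
  shows "Lp_norm M p (\<lambda>x. f x - g x) \<le> Lp_norm M p f + Lp_norm M p g"
  using Lp_norm_triangle[OF assms(1) Lp_scale[OF assms(2), of "- 1"]] Lp_norm_scale[of "- 1" g] by simp

lemma linear_operator_on_diff:
  assumes T: "linear_operator_on (Lp_space M p) (Lp_norm M p) T"
    and S: "linear_operator_on (Lp_space M p) (Lp_norm M p) S"
  shows "linear_operator_on (Lp_space M p) (Lp_norm M p) (\<lambda>f x. T f x - S f x)"
proof -
  note lin = T[unfolded linear_operator_on_def] S[unfolded linear_operator_on_def]
  have null: "Lp_norm M p (\<lambda>x. u x - v x) = 0"
    if "u \<in> Lp_space M p" "v \<in> Lp_space M p" "Lp_norm M p u = 0" "Lp_norm M p v = 0" for u v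
    using Lp_norm_diff_le[OF that(1,2)] that(3,4) Lp_norm_nonneg[of "\<lambda>x. u x - v x"] by simp
  have "Lp_norm M p (\<lambda>x. T (\<lambda>y. f y + g y) x - S (\<lambda>y. f y + g y) x - (T f x - S f x + (T g x - S g x))) = 0"
    if "f \<in> Lp_space M p" "g \<in> Lp_space M p" for f g
  proof -
    have "Lp_norm M p (\<lambda>x. (T (\<lambda>y. f y + g y) x - (T f x + T g x)) - (S (\<lambda>y. f y + g y) x - (S f x + S g x))) = 0"
      by (rule null) (use lin that in \<open>auto intro!: Lp_diff Lp_add\<close>)
    then show ?thesis by (simp add: algebra_simps)
  qed
  moreover have "Lp_norm M p (\<lambda>x. T (\<lambda>y. c * f y) x - S (\<lambda>y. c * f y) x - c * (T f x - S f x)) = 0"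
    if "f \<in> Lp_space M p" for f c
  proof -
    have "Lp_norm M p (\<lambda>x. (T (\<lambda>y. c * f y) x - c * T f x) - (S (\<lambda>y. c * f y) x - c * S f x)) = 0"
      by (rule null) (use lin that in \<open>auto intro!: Lp_diff Lp_scale\<close>)
    then show ?thesis by (simp add: algebra_simps)
  qed
  ultimately show ?thesis
    unfolding linear_operator_on_def using lin Lp_diff null by simp
qed

lemma linear_operator_on_norm_add:
  assumes "linear_operator_on (Lp_space M p) (Lp_norm M p) T" "f \<in> Lp_space M p" "g \<in> Lp_space M p"
  shows "Lp_norm M p (T (\<lambda>x. f x + g x)) \<le> Lp_norm M p (T f) + Lp_norm M p (T g)"
proof -
  have T: "T f \<in> Lp_space M p" "T g \<in> Lp_space M p" "T (\<lambda>x. f x + g x) \<in> Lp_space M p"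
    "Lp_norm M p (\<lambda>x. T (\<lambda>y. f y + g y) x - (T f x + T g x)) = 0"
    using assms Lp_add by (auto simp: linear_operator_on_def)
  have "Lp_norm M p (T (\<lambda>x. f x + g x)) \<le> 0 + Lp_norm M p (\<lambda>x. T f x + T g x)"
    using Lp_norm_triangle[OF Lp_diff[OF T(3) Lp_add[OF T(1,2)]] Lp_add[OF T(1,2)]] T(4) by simp
  then show ?thesis using Lp_norm_triangle[OF T(1,2)] by simp
qed

lemma linear_operator_on_norm_scale:
  assumes "linear_operator_on (Lp_space M p) (Lp_norm M p) T" "f \<in> Lp_space M p"
  shows "Lp_norm M p (T (\<lambda>x. c * f x)) \<le> cmod c * Lp_norm M p (T f)"
proof -
  have T: "T f \<in> Lp_space M p" "T (\<lambda>x. c * f x) \<in> Lp_space M p"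
    "Lp_norm M p (\<lambda>x. T (\<lambda>y. c * f y) x - c * T f x) = 0"
    using assms Lp_scale by (auto simp: linear_operator_on_def)
  have "Lp_norm M p (T (\<lambda>x. c * f x)) \<le> 0 + Lp_norm M p (\<lambda>x. c * T f x)"
    using Lp_norm_triangle[OF Lp_diff[OF T(2) Lp_scale[OF T(1)]] Lp_scale[OF T(1)], of c c] T(3) by simp
  then show ?thesis by (simp add: Lp_norm_scale)
qed

end

context Lp_SU2
begin

text \<open>Uniformly bounded operators that converge on a dense subspace converge everywhere. By
  linearity the subspace need only be tested on matrix coefficients.\<close>

lemma operators_tendsto_zero:
  assumes lin: "\<And>J. linear_operator_on (Lp_space \<mu> p) (Lp_norm \<mu> p) (D J)"
    and bound: "\<And>J f. f \<in> Lp_space \<mu> p \<Longrightarrow> Lp_norm \<mu> p (D J f) \<le> L * Lp_norm \<mu> p f"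
    and mono: "\<And>i j n. i \<le> j + n \<Longrightarrow> (\<lambda>J. Lp_norm \<mu> p (D J (mono_coeff i j n))) \<longlonglongrightarrow> 0"
    and f: "f \<in> Lp_space \<mu> p"
  shows "(\<lambda>J. Lp_norm \<mu> p (D J f)) \<longlonglongrightarrow> 0"
proof -
  have squeeze: "X \<longlonglongrightarrow> 0" if "\<And>J. 0 \<le> X J" "\<And>J. X J \<le> Y J" "Y \<longlonglongrightarrow> 0" for X Y :: "nat \<Rightarrow> real"
    using that by (intro tendsto_sandwich[OF _ _ tendsto_const that(3)] always_eventually) auto
  have null: "Lp_norm \<mu> p (D J u) = 0" if "u \<in> Lp_space \<mu> p" "Lp_norm \<mu> p u = 0" for u J
    using bound[OF that(1), of J] that(2) Lp_norm_nonneg[of "D J u"] by simp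
  have rep: "(\<lambda>J. Lp_norm \<mu> p (D J h)) \<longlonglongrightarrow> 0" if "repfun h" for h
    using that
  proof (induction rule: repfun.induct)
    case (mono i j n)
    show ?case
    proof (cases "i \<le> j + n")
      case False
      then have "mono_coeff i j n = (\<lambda>x. 0)" by (simp add: mono_coeff_gt fun_eq_iff)
      then show ?thesis using null[OF Lp_zero Lp_norm_zero] by simp
    qed (rule assms(3))
  next
    case (add f h)
    show ?case
      by (rule squeeze[OF Lp_norm_nonneg linear_operator_on_norm_add[OF lin Lp_repfun Lp_repfun]])
        (use add tendsto_add[OF add.IH] in auto)
  next
    case (scale f c)
    show ?case
      by (rule squeeze[OF Lp_norm_nonneg linear_operator_on_norm_scale[OF lin Lp_repfun]])
        (use scale tendsto_mult[OF tendsto_const scale.IH, of "cmod c"] in auto)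
  next
    \<comment> \<open>Operators act on representatives, so functions that agree on SU(2) must be
      compared through their difference, a null function.\<close>
    case (cong f h)
    have h: "h \<in> Lp_space \<mu> p" using repfun.cong[OF cong(1,2)] by (rule Lp_repfun)
    have "Lp_norm \<mu> p (\<lambda>x. h x - f x) = Lp_norm \<mu> p (\<lambda>x. 0)"
      by (rule Lp_norm_cong) (simp add: cong(2) space_haar)
    then have "Lp_norm \<mu> p (D J (\<lambda>x. h x - f x)) = 0" for J
      using null[OF Lp_diff[OF h Lp_repfun[OF cong(1)]]] by (simp add: Lp_norm_zero)
    then have "Lp_norm \<mu> p (D J h) \<le> Lp_norm \<mu> p (D J f)" for J
      using linear_operator_on_norm_add[OF lin Lp_diff[OF h Lp_repfun[OF cong(1)]] Lp_repfun[OF cong(1)], of J] by simp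
    then show ?case by (rule squeeze[OF Lp_norm_nonneg _ cong.IH])
  qed
  define L' where "L' = \<bar>L\<bar> + 1"
  have L': "L' > 0" "L \<le> L'" by (auto simp: L'_def)
  show ?thesis
  proof (rule LIMSEQ_I)
    fix \<epsilon> :: real assume "\<epsilon> > 0"
    then have "\<epsilon> / (2 * L') > 0" using L' by simp
    then obtain h where h: "repfun h" "Lp_norm \<mu> p (\<lambda>x. f x - h x) < \<epsilon> / (2 * L')"
      using Lp_dense[OF f] by blast
    have d: "(\<lambda>x. f x - h x) \<in> Lp_space \<mu> p" by (rule Lp_diff[OF f Lp_repfun[OF h(1)]])
    have less: "Lp_norm \<mu> p (D J f) < \<epsilon> / 2 + Lp_norm \<mu> p (D J h)" for J
    proof -
      have "Lp_norm \<mu> p (D J f) \<le> Lp_norm \<mu> p (D J (\<lambda>x. f x - h x)) + Lp_norm \<mu> p (D J h)"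
        using linear_operator_on_norm_add[OF lin d Lp_repfun[OF h(1)], of J] by simp
      also have "Lp_norm \<mu> p (D J (\<lambda>x. f x - h x)) \<le> L * Lp_norm \<mu> p (\<lambda>x. f x - h x)"
        by (rule bound[OF d])
      also have "\<dots> \<le> L' * Lp_norm \<mu> p (\<lambda>x. f x - h x)"
        using L' Lp_norm_nonneg by (intro mult_right_mono)
      also have "\<dots> < \<epsilon> / 2" using h(2) L' by (simp add: field_simps)
      finally show ?thesis by simp
    qed
    have "\<forall>\<^sub>F J in sequentially. Lp_norm \<mu> p (D J h) < \<epsilon> / 2"
      using \<open>\<epsilon> > 0\<close> by (intro order_tendstoD(2)[OF rep[OF h(1)]]) simp
    then obtain J0 where J0: "\<And>J. J \<ge> J0 \<Longrightarrow> Lp_norm \<mu> p (D J h) < \<epsilon> / 2"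
      by (auto simp: eventually_sequentially)
    then have "norm (Lp_norm \<mu> p (D J f) - 0) < \<epsilon>" if "J \<ge> J0" for J
      using less[of J] J0[OF that] Lp_norm_nonneg[of "D J f"] by simp
    then show "\<exists>J0. \<forall>J\<ge>J0. norm (Lp_norm \<mu> p (D J f) - 0) < \<epsilon>" by blast
  qed
qed

end

section \<open>Multiplier operators as sums of dyadic blocks\<close>

locale SU2_multiplier = Lp_SU2 \<mu> p + smooth_symbol m C \<alpha> for \<mu> p m C \<alpha>
begin

lemma integral_block_kernel:
  "(LINT g|\<mu>. \<bar>block_kernel j (rtr g)\<bar>) \<le> 40 * C * (2 powr (- \<alpha>)) ^ j"
proof -
  define N where "N = (2 ^ j :: nat)"
  have N: "1 \<le> N" by (simp add: N_def)
  have "(LINT g|\<mu>. \<bar>block_kernel j (rtr g)\<bar>) \<le> 5 * real N * (8 * C * real N powr (- \<alpha> - 1))"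
    unfolding block_kernel_def N_def[symmetric]
  proof (rule integral_abs_cheb_sum_le[OF N])
    show "0 < 8 * C * real N powr (- \<alpha> - 1)" using C N by simp
    show "block_coeff N 0 = 0" by (simp add: block_coeff_def)
  qed (use block_coeff_ge abs_block_coeff_le[OF N] second_difference_block_coeff[OF N] in simp_all)
  also have "\<dots> = 40 * C * real N powr (- \<alpha>)"
    using powr_shift[OF N, of "- \<alpha>"] by simp
  finally show ?thesis unfolding N_def two_power_powr .
qed

lemma kernel_sum_bound:
  assumes "\<bar>t\<bar> \<le> 2"
  shows "\<bar>\<Sum>j<J. block_kernel j t\<bar> \<le> (\<Sum>j<J. 32 * C * (2 powr (3 - \<alpha>)) ^ j)"
  by (intro order_trans[OF sum_abs] sum_mono abs_block_kernel_le assms)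

lemma borel_measurable_kernel_sum: "(\<lambda>t. \<Sum>j<J. block_kernel j t) \<in> borel_measurable borel"
  by measurable

abbreviation block_op :: "nat \<Rightarrow> (complex^2^2 \<Rightarrow> complex) \<Rightarrow> complex^2^2 \<Rightarrow> complex"
  where "block_op j \<equiv> class_conv \<mu> (block_kernel j)"

abbreviation partial_op :: "nat \<Rightarrow> (complex^2^2 \<Rightarrow> complex) \<Rightarrow> complex^2^2 \<Rightarrow> complex"
  where "partial_op J \<equiv> class_conv \<mu> (\<lambda>t. \<Sum>j<J. block_kernel j t)"

lemma partial_op_eq_sum:
  assumes "x \<in> SU2" "integrable \<mu> f"
  shows "partial_op J f x = (\<Sum>j<J. block_op j f x)"
proof -
  have "integrable \<mu> (\<lambda>y. of_real (block_kernel j (rtr (x ** su2_inv y))) * f y)" for j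
    by (rule integrable_kernel_mult[OF borel_measurable_block_kernel abs_block_kernel_le assms])
  then show ?thesis
    unfolding class_conv_def by (simp add: sum_distrib_right Bochner_Integration.integral_sum)
qed

lemma Lp_norm_block_op:
  assumes "f \<in> Lp_space \<mu> p"
  shows "block_op j f \<in> Lp_space \<mu> p" "Lp_norm \<mu> p (block_op j f) \<le> 40 * C * (2 powr (- \<alpha>)) ^ j * Lp_norm \<mu> p f"
  using Lp_norm_class_conv[OF borel_measurable_block_kernel abs_block_kernel_le assms integral_block_kernel] C
  by auto

lemma block_ratio: "0 < 2 powr (- \<alpha>)" "2 powr (- \<alpha>) < (1::real)"
  using \<alpha> by (auto simp: powr_less_one)

text \<open>The block norms form a geometric series; a bound independent of J is what
  \<open>operators_tendsto_zero\<close> requires.\<close>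

lemma Lp_norm_partial_op:
  assumes f: "f \<in> Lp_space \<mu> p"
  shows "partial_op J f \<in> Lp_space \<mu> p"
    "Lp_norm \<mu> p (partial_op J f) \<le> 40 * C / (1 - 2 powr (- \<alpha>)) * Lp_norm \<mu> p f"
proof -
  show "partial_op J f \<in> Lp_space \<mu> p"
    using bounded_operator_class_conv[OF borel_measurable_kernel_sum kernel_sum_bound] f
    by (simp add: bounded_operator_on_def linear_operator_on_def)
  have "Lp_norm \<mu> p (partial_op J f) = Lp_norm \<mu> p (\<lambda>x. \<Sum>j<J. block_op j f x)"
    using f by (intro Lp_norm_cong) (simp add: partial_op_eq_sum Lp_integrable space_haar)
  also have "\<dots> \<le> (\<Sum>j<J. Lp_norm \<mu> p (block_op j f))"
    using Lp_norm_block_op(1)[OF f] by (intro Lp_norm_sum) auto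
  also have "\<dots> \<le> (\<Sum>j<J. 40 * C * Lp_norm \<mu> p f * (2 powr (- \<alpha>)) ^ j)"
    using Lp_norm_block_op(2)[OF f] by (intro sum_mono) (simp add: mult_ac)
  also have "\<dots> \<le> (\<Sum>j. 40 * C * Lp_norm \<mu> p f * (2 powr (- \<alpha>)) ^ j)"
    using block_ratio C Lp_norm_nonneg[of f] by (intro sum_le_suminf summable_mult summable_geometric) auto
  also have "\<dots> = 40 * C / (1 - 2 powr (- \<alpha>)) * Lp_norm \<mu> p f"
    using block_ratio by (subst suminf_mult) (auto simp: suminf_geometric summable_geometric)
  finally show "Lp_norm \<mu> p (partial_op J f) \<le> 40 * C / (1 - 2 powr (- \<alpha>)) * Lp_norm \<mu> p f" .
qed

lemma block_op_mono_coeff: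
  assumes "x \<in> SU2" "i \<le> j + n"
  shows "block_op a (mono_coeff i j n) x =
    of_real (block_coeff (2 ^ a) (j + n + 1) / real (j + n + 1)) * mono_coeff i j n x"
proof -
  have "block_op a (mono_coeff i j n) x = class_conv \<mu> (\<lambda>t. \<Sum>k<2 * 2 ^ a. block_coeff (2 ^ a) (k + 1) * cheb k t) (mono_coeff i j n) x"
    unfolding block_kernel_def[abs_def] ..
  also have "\<dots> = of_real (block_coeff (2 ^ a) (j + n + 1) / real (j + n + 1)) * mono_coeff i j n x"
    unfolding class_conv_cheb_mono_coeff[OF assms]
    using block_coeff_ge[of "2 ^ a" "j + n + 1"] by simp
  finally show ?thesis .
qed

lemma partial_op_mono_coeff:
  assumes "x \<in> SU2" "i \<le> j + n"
  shows "partial_op J (mono_coeff i j n) x = of_real (m (j + n + 1) - tail (2 ^ J) (j + n + 1)) * mono_coeff i j n x"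
proof -
  have "partial_op J (mono_coeff i j n) x =
      of_real (\<Sum>a<J. block_coeff (2 ^ a) (j + n + 1) / real (j + n + 1)) * mono_coeff i j n x"
    unfolding partial_op_eq_sum[OF assms(1) integrable_repfun[OF repfun.mono]] block_op_mono_coeff[OF assms]
      sum_distrib_right[symmetric] of_real_sum[symmetric] ..
  also have "(\<Sum>a<J. block_coeff (2 ^ a) (j + n + 1) / real (j + n + 1)) = m (j + n + 1) - tail (2 ^ J) (j + n + 1)"
    by (rule sum_block_coeff) simp
  finally show ?thesis .
qed

text \<open>Identifies any bounded operator with the right eigenvalues as the limit of the block
  sums, so nuclearity is proved for every such \<open>T\<close> and not only for the one constructed
  below.\<close>

lemma partial_op_tendsto:
  assumes T: "bounded_operator_on (Lp_space \<mu> p) (Lp_norm \<mu> p) T"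
    and mono: "\<And>i j n. i \<le> j + n \<Longrightarrow>
      Lp_norm \<mu> p (\<lambda>x. T (mono_coeff i j n) x - of_real (m (j + n + 1)) * mono_coeff i j n x) = 0"
    and f: "f \<in> Lp_space \<mu> p"
  shows "(\<lambda>J. Lp_norm \<mu> p (\<lambda>x. T f x - partial_op J f x)) \<longlonglongrightarrow> 0"
proof -
  have lin: "linear_operator_on (Lp_space \<mu> p) (Lp_norm \<mu> p) T"
    "linear_operator_on (Lp_space \<mu> p) (Lp_norm \<mu> p) (partial_op J)" for J
    using T bounded_operator_class_conv[OF borel_measurable_kernel_sum kernel_sum_bound]
    by (auto simp: bounded_operator_on_def)
  have T_Lp: "T f \<in> Lp_space \<mu> p" if "f \<in> Lp_space \<mu> p" for f
    using lin(1) that by (simp add: linear_operator_on_def)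
  obtain B where B: "\<And>f. f \<in> Lp_space \<mu> p \<Longrightarrow> Lp_norm \<mu> p (T f) \<le> B * Lp_norm \<mu> p f"
    using T by (auto simp: bounded_operator_on_def)
  show ?thesis
  proof (rule operators_tendsto_zero[where D = "\<lambda>J f x. T f x - partial_op J f x"])
    show "linear_operator_on (Lp_space \<mu> p) (Lp_norm \<mu> p) (\<lambda>f x. T f x - partial_op J f x)" for J
      by (rule linear_operator_on_diff[OF lin])
    show "Lp_norm \<mu> p (\<lambda>x. T f x - partial_op J f x) \<le> (B + 40 * C / (1 - 2 powr (- \<alpha>))) * Lp_norm \<mu> p f"
      if "f \<in> Lp_space \<mu> p" for J f
      using Lp_norm_diff_le[OF T_Lp[OF that] Lp_norm_partial_op(1)[OF that]] B[OF that] Lp_norm_partial_op(2)[OF that, of J]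
      unfolding distrib_right by (meson add_mono order_trans)
    show "(\<lambda>J. Lp_norm \<mu> p (\<lambda>x. T (mono_coeff i j n) x - partial_op J (mono_coeff i j n) x)) \<longlonglongrightarrow> 0"
      if i: "i \<le> j + n" for i j n
    proof -
      define h where "h = mono_coeff i j n"
      define k where "k = j + n + 1"
      have h: "h \<in> Lp_space \<mu> p" unfolding h_def by (rule Lp_repfun[OF repfun.mono])
      have "Lp_norm \<mu> p (\<lambda>x. T h x - partial_op J h x) \<le> \<bar>tail (2 ^ J) k\<bar> * Lp_norm \<mu> p h" for J
      proof -
        have "Lp_norm \<mu> p (\<lambda>x. T h x - partial_op J h x) \<le> Lp_norm \<mu> p (\<lambda>x. T h x - of_real (m k) * h x)
            + Lp_norm \<mu> p (\<lambda>x. of_real (m k) * h x - partial_op J h x)"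
          by (intro Lp_norm_triangle_diff T_Lp h Lp_scale Lp_norm_partial_op)
        also have "Lp_norm \<mu> p (\<lambda>x. T h x - of_real (m k) * h x) = 0"
          using mono[OF i] by (simp add: h_def k_def)
        also have "Lp_norm \<mu> p (\<lambda>x. of_real (m k) * h x - partial_op J h x) =
            Lp_norm \<mu> p (\<lambda>x. of_real (tail (2 ^ J) k) * h x)"
          using partial_op_mono_coeff[OF _ i, of _ J]
          by (intro Lp_norm_cong) (simp add: h_def k_def space_haar algebra_simps)
        finally show ?thesis by (simp add: Lp_norm_scale)
      qed
      then have "\<forall>\<^sub>F J in sequentially.
          norm (Lp_norm \<mu> p (\<lambda>x. T h x - partial_op J h x)) \<le> \<bar>tail (2 ^ J) k\<bar> * Lp_norm \<mu> p h"
        by (intro always_eventually) (simp add: Lp_norm_nonneg)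
      moreover have "(\<lambda>J. \<bar>tail (2 ^ J) k\<bar> * Lp_norm \<mu> p h) \<longlonglongrightarrow> 0"
        using tendsto_mult[OF tendsto_rabs[OF tail_tendsto_zero[of k]] tendsto_const[of "Lp_norm \<mu> p h"]] by simp
      ultimately show ?thesis
        unfolding h_def[symmetric] by (rule Lim_null_comparison)
    qed
  qed (rule f)
qed

definition block_index :: "nat \<Rightarrow> (nat \<times> nat \<times> nat) set"
  where "block_index a = Sigma {..<2 * 2 ^ a} (\<lambda>k. {..k} \<times> {..k})"

lemma finite_block_index: "finite (block_index a)"
  by (simp add: block_index_def)

text \<open>The triples lie in a cube of side 2 * 2^a. Its exponent, the dimension of the group, is
  the 3 in \<alpha> > 3 / r.\<close>

lemma card_block_index_le: "real (card (block_index a)) \<le> 8 * 8 ^ a"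
proof -
  define K where "K = (2 * 2 ^ a :: nat)"
  have "block_index a \<subseteq> {..<K} \<times> {..<K} \<times> {..<K}"
    by (auto simp: block_index_def K_def)
  then have "card (block_index a) \<le> card ({..<K} \<times> {..<K} \<times> {..<K})"
    by (intro card_mono) auto
  also have "\<dots> = K * (K * K)" by simp
  finally have "real (card (block_index a)) \<le> real (K * (K * K))" by (simp only: of_nat_le_iff)
  also have "\<dots> = 8 * (2 ^ a * 2 ^ a * 2 ^ a)" by (simp add: K_def)
  also have "(2 ^ a * 2 ^ a * 2 ^ a :: real) = 8 ^ a" by (simp add: power_mult_distrib[symmetric])
  finally show ?thesis .
qed

lemma block_op_decomposition:
  obtains \<phi> y where "\<And>i. i < card (block_index a) \<Longrightarrow> \<phi> i \<in> dual_space (Lp_space \<mu> p) (Lp_norm \<mu> p)"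
    and "\<And>i. i < card (block_index a) \<Longrightarrow> y i \<in> Lp_space \<mu> p"
    and "\<And>i. i < card (block_index a) \<Longrightarrow> Lp_norm \<mu> p (y i) \<le> 1"
    and "\<And>i f. i < card (block_index a) \<Longrightarrow> f \<in> Lp_space \<mu> p \<Longrightarrow>
      cmod (\<phi> i f) \<le> 120 * C * (2 powr (- \<alpha>)) ^ a * Lp_norm \<mu> p f"
    and "\<And>f x. f \<in> Lp_space \<mu> p \<Longrightarrow> x \<in> SU2 \<Longrightarrow>
      block_op a f x = (\<Sum>i<card (block_index a). \<phi> i f * y i x)"
proof -
  define b :: "nat \<times> nat \<times> nat \<Rightarrow> complex^2^2 \<Rightarrow> complex"
    where "b z x = (case z of (k, i, l) \<Rightarrow> mono_coeff i l (k - l) x)" for z x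
  have b: "b z \<in> Lp_space \<mu> p" for z
    using Lp_repfun[OF repfun.mono] by (cases z) (simp add: b_def[abs_def])
  have kernel: "block_kernel a = (\<lambda>t. \<Sum>k<2 * 2 ^ a. block_coeff (2 ^ a) (k + 1) * cheb k t)"
    by (rule ext) (rule block_kernel_def)
  obtain \<psi> where \<psi>: "\<And>z. z \<in> block_index a \<Longrightarrow> \<psi> z \<in> dual_space (Lp_space \<mu> p) (Lp_norm \<mu> p)"
    and conv: "\<And>f x. f \<in> Lp_space \<mu> p \<Longrightarrow> x \<in> SU2 \<Longrightarrow> block_op a f x = (\<Sum>z\<in>block_index a. \<psi> z f * b z x)"
    unfolding block_index_def b_def kernel
    by (rule class_conv_finite_rank[of "2 * 2 ^ a" "\<lambda>k. block_coeff (2 ^ a) (k + 1)"]) blast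
  have pos: "40 * C * (2 powr (- \<alpha>)) ^ a > 0" using C by simp
  have bound: "Lp_norm \<mu> p (\<lambda>x. \<Sum>z\<in>block_index a. \<psi> z f * b z x) \<le> 40 * C * (2 powr (- \<alpha>)) ^ a * Lp_norm \<mu> p f"
    if f: "f \<in> Lp_space \<mu> p" for f
  proof -
    have "Lp_norm \<mu> p (\<lambda>x. \<Sum>z\<in>block_index a. \<psi> z f * b z x) = Lp_norm \<mu> p (block_op a f)"
      using conv[OF f] by (intro Lp_norm_cong) (simp add: space_haar)
    then show ?thesis using Lp_norm_block_op(2)[OF f, of a] by simp
  qed
  obtain \<phi> y where *: "\<And>i. i < card (block_index a) \<Longrightarrow> \<phi> i \<in> dual_space (Lp_space \<mu> p) (Lp_norm \<mu> p)"
    "\<And>i. i < card (block_index a) \<Longrightarrow> y i \<in> Lp_space \<mu> p"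
    "\<And>i. i < card (block_index a) \<Longrightarrow> Lp_norm \<mu> p (y i) \<le> 1"
    "\<And>i f. i < card (block_index a) \<Longrightarrow> f \<in> Lp_space \<mu> p \<Longrightarrow>
      cmod (\<phi> i f) \<le> 3 * (40 * C * (2 powr (- \<alpha>)) ^ a) * Lp_norm \<mu> p f"
    "\<And>f x. (\<Sum>z\<in>block_index a. \<psi> z f * b z x) = (\<Sum>i<card (block_index a). \<phi> i f * y i x)"
    by (rule finite_rank_decomposition[where I = "block_index a" and b = b and c = \<psi>,
          OF finite_block_index b \<psi> pos bound]) blast+
  show thesis
  proof (rule that[of \<phi> y])
    show "cmod (\<phi> i f) \<le> 120 * C * (2 powr (- \<alpha>)) ^ a * Lp_norm \<mu> p f"
      if "i < card (block_index a)" "f \<in> Lp_space \<mu> p" for i f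
      using *(4)[OF that] by simp
    show "block_op a f x = (\<Sum>i<card (block_index a). \<phi> i f * y i x)" if "f \<in> Lp_space \<mu> p" "x \<in> SU2" for f x
      unfolding conv[OF that] *(5) ..
  qed (use *(1-3) in auto)
qed

text \<open>Rank times norm to the power s is dominated by a geometric sequence of ratio 2^(3 -
  \<alpha> s). The case s = r gives nuclearity and s = 1 the convergence of the rearranged
  series.\<close>

lemma summable_blocks:
  assumes "s > 0" "\<alpha> * s > 3"
  shows "summable (\<lambda>a. real (card (block_index a)) * (120 * C * (2 powr (- \<alpha>)) ^ a) powr s)"
proof (rule summable_comparison_test'[where N = 0])
  have "(8::real) * 2 powr (- \<alpha> * s) = 2 powr (3 - \<alpha> * s)"
    by (simp add: powr_diff powr_minus_divide)
  also have "\<dots> < 1" using assms by (simp add: powr_less_one)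
  finally have lt: "8 * 2 powr (- \<alpha> * s) < (1::real)" .
  show "summable (\<lambda>a. 8 * (120 * C) powr s * (8 * 2 powr (- \<alpha> * s)) ^ a)"
    using lt by (intro summable_mult summable_geometric) simp
  fix a
  have "((2 powr (- \<alpha>)) ^ a) powr s = (2 powr (- \<alpha> * s)) ^ a"
  proof -
    have pow: "(2 powr t) ^ a = 2 powr (t * real a)" for t :: real
      by (metis powr_gt_zero powr_powr powr_realpow zero_neq_numeral)
    show ?thesis unfolding pow powr_powr by (simp add: mult_ac)
  qed
  then have "(120 * C * (2 powr (- \<alpha>)) ^ a) powr s = (120 * C) powr s * (2 powr (- \<alpha> * s)) ^ a"
    using C by (simp add: powr_mult)
  then have "real (card (block_index a)) * (120 * C * (2 powr (- \<alpha>)) ^ a) powr s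
      \<le> (8 * 8 ^ a) * ((120 * C) powr s * (2 powr (- \<alpha> * s)) ^ a)"
    using card_block_index_le[of a] by (simp add: mult_right_mono)
  then show "norm (real (card (block_index a)) * (120 * C * (2 powr (- \<alpha>)) ^ a) powr s)
      \<le> 8 * (120 * C) powr s * (8 * 2 powr (- \<alpha> * s)) ^ a"
    by (simp add: power_mult_distrib mult_ac)
qed

lemma r_nuclear_multiplier:
  assumes T: "bounded_operator_on (Lp_space \<mu> p) (Lp_norm \<mu> p) T"
    and mono: "\<And>i j n. i \<le> j + n \<Longrightarrow>
      Lp_norm \<mu> p (\<lambda>x. T (mono_coeff i j n) x - of_real (m (j + n + 1)) * mono_coeff i j n x) = 0"
    and r: "0 < r" "\<alpha> * r > 3" "\<alpha> > 3"
  shows "r_nuclear_on (Lp_space \<mu> p) (Lp_norm \<mu> p) r T"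
proof -
  define P where "P a \<phi> y \<longleftrightarrow> (\<forall>i<card (block_index a). \<phi> i \<in> dual_space (Lp_space \<mu> p) (Lp_norm \<mu> p) \<and>
      y i \<in> Lp_space \<mu> p \<and> Lp_norm \<mu> p (y i) \<le> 1 \<and>
      (\<forall>f\<in>Lp_space \<mu> p. cmod (\<phi> i f) \<le> 120 * C * (2 powr (- \<alpha>)) ^ a * Lp_norm \<mu> p f)) \<and>
      (\<forall>f\<in>Lp_space \<mu> p. \<forall>x\<in>SU2. block_op a f x = (\<Sum>i<card (block_index a). \<phi> i f * y i x))" for a \<phi> y
  have "\<exists>\<phi> y. P a \<phi> y" for a
    by (rule block_op_decomposition[of a]) (unfold P_def, blast)
  then obtain \<phi> y where "\<And>a. P a (\<phi> a) (y a)" by metis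
  note * = this[unfolded P_def]
  show ?thesis
  proof (rule r_nuclear_onI_blocks[where n = "\<lambda>a. card (block_index a)" and \<phi> = \<phi> and y = y
        and a = "\<lambda>a. 120 * C * (2 powr (- \<alpha>)) ^ a"])
    show "linear_operator_on (Lp_space \<mu> p) (Lp_norm \<mu> p) T"
      using T by (simp add: bounded_operator_on_def)
    show "summable (\<lambda>a. real (card (block_index a)) * (120 * C * (2 powr (- \<alpha>)) ^ a))"
      using summable_blocks[of 1] r(3) C by simp
    show "summable (\<lambda>a. real (card (block_index a)) * (120 * C * (2 powr (- \<alpha>)) ^ a) powr r)"
      by (rule summable_blocks[OF r(1,2)])
    fix f assume f: "f \<in> Lp_space \<mu> p"
    have "Lp_norm \<mu> p (\<lambda>x. T f x - (\<Sum>a<J. \<Sum>i<card (block_index a). \<phi> a i f * y a i x)) =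
        Lp_norm \<mu> p (\<lambda>x. T f x - partial_op J f x)" for J
      using * f by (intro Lp_norm_cong) (simp add: partial_op_eq_sum Lp_integrable space_haar)
    then show "(\<lambda>J. Lp_norm \<mu> p (\<lambda>x. T f x - (\<Sum>a<J. \<Sum>i<card (block_index a). \<phi> a i f * y a i x))) \<longlonglongrightarrow> 0"
      using partial_op_tendsto[OF T mono f] by simp
  qed (use * C r in auto)
qed

text \<open>For \<alpha> > 3 the block kernels sum uniformly on [-2, 2] to a bounded kernel, and
  convolution with it is the operator. Homogeneity is recorded pointwise so that the normalised
  entries can be handled as multiples of \<open>mono_coeff\<close>.\<close>

lemma multiplier_exists:
  assumes "\<alpha> > 3"
  obtains T where "bounded_operator_on (Lp_space \<mu> p) (Lp_norm \<mu> p) T"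
    and "\<And>c f x. T (\<lambda>y. c * f y) x = c * T f x"
    and "\<And>i j n x. i \<le> j + n \<Longrightarrow> x \<in> SU2 \<Longrightarrow>
      T (mono_coeff i j n) x = of_real (m (j + n + 1)) * mono_coeff i j n x"
proof -
  define \<kappa> where "\<kappa> t = (\<Sum>j. block_kernel j t)" for t
  define b where "b j = 32 * C * (2 powr (3 - \<alpha>)) ^ j" for j
  have "2 powr (3 - \<alpha>) < (1::real)" using assms by (simp add: powr_less_one)
  then have b: "summable b" unfolding b_def by (intro summable_mult summable_geometric) simp
  have le: "norm (block_kernel j t) \<le> b j" if "\<bar>t\<bar> \<le> 2" for j t
    using abs_block_kernel_le[OF that] by (simp add: b_def)
  have sums: "(\<lambda>J. \<Sum>j<J. block_kernel j t) \<longlonglongrightarrow> \<kappa> t" if "\<bar>t\<bar> \<le> 2" for t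
    unfolding \<kappa>_def by (intro summable_LIMSEQ summable_comparison_test'[OF b, of 0] le that)
  have b0: "b j \<ge> 0" for j using C by (simp add: b_def)
  have partial: "\<bar>\<Sum>j<J. block_kernel j t\<bar> \<le> suminf b" if "\<bar>t\<bar> \<le> 2" for J t
    using kernel_sum_bound[OF that, of J] sum_le_suminf[OF b, of "{..<J}"] b0 by (simp add: b_def)
  have meas: "\<kappa> \<in> borel_measurable borel"
    unfolding \<kappa>_def[abs_def] by measurable
  have bound: "\<bar>\<kappa> t\<bar> \<le> suminf b" if "\<bar>t\<bar> \<le> 2" for t
    by (rule LIMSEQ_le_const2[OF tendsto_rabs[OF sums[OF that]]]) (use partial[OF that] in auto)
  have "class_conv \<mu> \<kappa> (mono_coeff i j n) x = of_real (m (j + n + 1)) * mono_coeff i j n x"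
    if i: "i \<le> j + n" and x: "x \<in> SU2" for i j n x
  proof -
    define h where "h = mono_coeff i j n"
    have h: "integrable \<mu> h" unfolding h_def by (rule integrable_repfun[OF repfun.mono])
    have "(\<lambda>J. partial_op J h x) \<longlonglongrightarrow> class_conv \<mu> \<kappa> h x"
      unfolding class_conv_def
    proof (rule integral_dominated_convergence[where w = "\<lambda>y. suminf b * cmod (h y)"])
      show "(\<lambda>y. complex_of_real (\<kappa> (rtr (x ** su2_inv y))) * h y) \<in> borel_measurable \<mu>"
        by (intro borel_measurable_integrable integrable_kernel_mult[OF meas bound x h])
      show "(\<lambda>y. complex_of_real (\<Sum>j<J. block_kernel j (rtr (x ** su2_inv y))) * h y) \<in> borel_measurable \<mu>" for J
        by (intro borel_measurable_integrable integrable_kernel_mult[OF borel_measurable_kernel_sum kernel_sum_bound x h])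
      show "integrable \<mu> (\<lambda>y. suminf b * cmod (h y))" using h by simp
      show "AE y in \<mu>. (\<lambda>J. complex_of_real (\<Sum>j<J. block_kernel j (rtr (x ** su2_inv y))) * h y)
          \<longlonglongrightarrow> complex_of_real (\<kappa> (rtr (x ** su2_inv y))) * h y"
        using abs_rtr_quotient_le[OF x]
        by (intro AE_I2 tendsto_mult tendsto_of_real sums tendsto_const) (simp add: space_haar)
      show "AE y in \<mu>. norm (complex_of_real (\<Sum>j<J. block_kernel j (rtr (x ** su2_inv y))) * h y)
          \<le> suminf b * cmod (h y)" for J
        using abs_rtr_quotient_le[OF x] partial unfolding norm_mult norm_of_real
        by (intro AE_I2 mult_right_mono) (auto simp: space_haar)
    qed
    moreover have "(\<lambda>J. partial_op J h x) \<longlonglongrightarrow> of_real (m (j + n + 1) - 0) * h x"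
      unfolding h_def partial_op_mono_coeff[OF x i]
      by (intro tendsto_intros tail_tendsto_zero)
    ultimately show ?thesis unfolding h_def using LIMSEQ_unique by fastforce
  qed
  then show thesis
    using that[of "class_conv \<mu> \<kappa>"] bounded_operator_class_conv[OF meas bound] class_conv_scale[OF meas bound]
    by blast
qed

end

text \<open>The existence half keeps the universal half from being vacuous.\<close>

theorem corollary3p19:
  fixes \<mu> :: "(complex^2^2) measure" and r \<alpha> p :: real
  assumes "normalized_haar_SU2 \<mu>"
    and "0 < r" and "r \<le> 1" and "\<alpha> > 3 / r" and "1 \<le> p"
  shows "(\<exists>T. bessel_potential_SU2 \<mu> p \<alpha> T) \<and>
    (\<forall>T. bessel_potential_SU2 \<mu> p \<alpha> T \<longrightarrow>
      r_nuclear_on (Lp_space \<mu> p) (Lp_norm \<mu> p) r T)"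
proof -
  have \<alpha>r: "\<alpha> * r > 3" using assms(2,4) by (simp add: field_simps)
  \<comment> \<open>Here r \<le> 1 enters: it gives \<alpha> > 3, on which the kernel and the
    rearrangement depend.\<close>
  have "3 \<le> 3 / r" using assms(2,3) by (simp add: field_simps)
  with assms(4) have \<alpha>3: "\<alpha> > 3" by simp
  define m where "m n = (((real n)\<^sup>2 + 3) / 4) powr (- \<alpha> / 2)" for n
  have "\<exists>C. smooth_symbol m C \<alpha>"
  proof (rule smooth_symbol_bessel[of \<alpha>])
    show "\<alpha> > 0" using \<alpha>3 by simp
  qed (unfold m_def[abs_def], blast)
  then obtain C where "smooth_symbol m C \<alpha>" ..
  then interpret smooth_symbol m C \<alpha> .
  interpret SU2_multiplier \<mu> p m C \<alpha>
    by unfold_locales (use assms in auto)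
  have ev: "(1 + real k / 2 * (real k / 2 + 1)) powr (- \<alpha> / 2) = m (k + 1)" for k
    unfolding m_def by (rule arg_cong[where f = "\<lambda>x. x powr _"]) (simp add: power2_eq_square field_simps)
  define c where "c k i j = complex_of_real (sqrt (fact i * fact (k - i) / (fact j * fact (k - j))))" for k i j
  have c0: "c k i j \<noteq> 0" for k i j by (simp add: c_def)
  have rep: "su2_rep k i j = (\<lambda>g. c k i j * mono_coeff i j (k - j) g)" for k i j
    by (simp add: su2_rep_def mono_coeff_def c_def fun_eq_iff)
  obtain T where T: "bounded_operator_on (Lp_space \<mu> p) (Lp_norm \<mu> p) T"
    and scale: "\<And>c f x. T (\<lambda>y. c * f y) x = c * T f x"
    and mono: "\<And>i j n x. i \<le> j + n \<Longrightarrow> x \<in> SU2 \<Longrightarrow>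
      T (mono_coeff i j n) x = of_real (m (j + n + 1)) * mono_coeff i j n x"
    by (rule multiplier_exists[OF \<alpha>3]) blast
  have "T (su2_rep k i j) g = of_real (m (k + 1)) * su2_rep k i j g" if "i \<le> k" "j \<le> k" "g \<in> SU2" for k i j g
    using mono[of i j "k - j" g] that unfolding rep scale by simp
  then have "bessel_potential_SU2 \<mu> p \<alpha> T"
    unfolding bessel_potential_SU2_iff[OF assms(1)] ev using T by (auto simp: space_haar intro!: AE_I2)
  moreover have "r_nuclear_on (Lp_space \<mu> p) (Lp_norm \<mu> p) r S" if S: "bessel_potential_SU2 \<mu> p \<alpha> S" for S
  proof (rule r_nuclear_multiplier[OF _ _ assms(2) \<alpha>r \<alpha>3])
    have bounded: "bounded_operator_on (Lp_space \<mu> p) (Lp_norm \<mu> p) S"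
      and ae: "\<And>k i j. i \<le> k \<Longrightarrow> j \<le> k \<Longrightarrow> AE g in \<mu>. S (su2_rep k i j) g = of_real (m (k + 1)) * su2_rep k i j g"
      using S unfolding bessel_potential_SU2_iff[OF assms(1)] ev by auto
    then show "bounded_operator_on (Lp_space \<mu> p) (Lp_norm \<mu> p) S" by simp
    have lin: "linear_operator_on (Lp_space \<mu> p) (Lp_norm \<mu> p) S"
      using bounded by (simp add: bounded_operator_on_def)
    fix i j n :: nat assume i: "i \<le> j + n"
    define k where "k = j + n"
    \<comment> \<open>\<open>S\<close> is known on normalised entries only almost everywhere, and it
      is homogeneous only up to seminorm 0. Removing the nonzero normalising factor is therefore
      done inside \<open>Lp_norm\<close>.\<close>
    define d where "d = 1 / c k i j"
    define u where "u = su2_rep k i j"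
    have u: "u \<in> Lp_space \<mu> p"
      unfolding u_def rep by (intro Lp_scale Lp_repfun repfun.mono)
    have h: "mono_coeff i j n = (\<lambda>g. d * u g)"
      using c0 by (simp add: u_def rep d_def k_def)
    have S_Lp: "S f \<in> Lp_space \<mu> p" if "f \<in> Lp_space \<mu> p" for f
      using lin that by (simp add: linear_operator_on_def)
    have "Lp_norm \<mu> p (\<lambda>x. S (\<lambda>g. d * u g) x - d * S u x) = 0"
      using lin u by (simp add: linear_operator_on_def)
    moreover have "Lp_norm \<mu> p (\<lambda>x. d * S u x - of_real (m (j + n + 1)) * (d * u x)) = Lp_norm \<mu> p (\<lambda>x. 0)"
      using ae[of i k j] i u S_Lp[OF u] Lp_measurable
      by (intro Lp_norm_cong_AE) (auto simp: k_def u_def elim!: eventually_mono)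
    moreover have "Lp_norm \<mu> p (\<lambda>x. S (\<lambda>g. d * u g) x - of_real (m (j + n + 1)) * (d * u x))
        \<le> Lp_norm \<mu> p (\<lambda>x. S (\<lambda>g. d * u g) x - d * S u x)
          + Lp_norm \<mu> p (\<lambda>x. d * S u x - of_real (m (j + n + 1)) * (d * u x))"
      by (intro Lp_norm_triangle_diff S_Lp Lp_scale u)
    ultimately have "Lp_norm \<mu> p (\<lambda>x. S (\<lambda>g. d * u g) x - of_real (m (j + n + 1)) * (d * u x)) \<le> 0"
      using Lp_norm_zero by linarith
    then show "Lp_norm \<mu> p (\<lambda>x. S (mono_coeff i j n) x - of_real (m (j + n + 1)) * mono_coeff i j n x) = 0"
      unfolding h using Lp_norm_nonneg by (intro antisym) auto
  qed
  ultimately show ?thesis by blast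
qed

end
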